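(* Let $q>1$ be a prime power. For any positive integer $n$ and $1\le r\le n$: (i) $$\mathrm{Hilb}(A(U_{r,n}(q)),-1)=\begin{cases}0&\text{if $r$ is even},\\ \displaystyle(-1)^{\frac{r-1}{2}}\sum_{\substack{\sigma\in\mathfrak S_n\\ \mathrm{DES}(\sigma)=\mathrm{Even}(r-1)}}q^{\mathrm{inv}(\sigma)}&\text{if $r$ is odd}.\end{cases}$$ (ii) $$\mathrm{Hilb}(\widetilde A(U_{r,n}(q)),-1)=\begin{cases}\displaystyle(-1)^{\frac{r}{2}}\sum_{\substack{\sigma\in\mathfrak S_n\\ \mathrm{DES}(\sigma)=\mathrm{Odd}(r-1)}}q^{\mathrm{inv}(\sigma)}&\text{if $r$ is even},\\0&\text{if $r$ is odd}.\end{cases}$$ In particular, both Charney--Davis quantities $CD(A(U_{r,n}(q)))$ and $CD(\widetilde A(U_{r,n}(q)))$ are polynomials in $q$ with nonnegative integer coefficients (i.e. for fixed $n,r$ they are given, for all prime powers $q$, by a polynomial in $\mathbb Z_{\ge0}[q]$).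
   Context: The $q$-uniform matroid $U_{r,n}(q)$ is the rank $r$ matroid on $\mathbb{F}_q^n\setminus\{0\}$ whose flats are the sets $V\setminus\{0\}$, where $V$ is a linear subspace of $\mathbb{F}_q^n$ with $\dim V\le r-1$ or $V=\mathbb{F}_q^n$. For a loopless matroid $M$ on $E$ with lattice of flats $\mathcal L(M)$, the Chow ring is the graded $\mathbb{Q}$-algebra (all variables in degree 1) $A(M)=\mathbb{Q}[x_F:F\in\mathcal L(M)\setminus\{\emptyset\}]/(I+J)$, where $I$ is generated by $x_Fx_{F'}$ for incomparable $F,F'$, and $J$ by $\sum_{F:\,i\in F}x_F$ for $i\in E$. The augmented Chow ring is the graded $\mathbb Q$-algebra (all variables in degree 1) $$\widetilde A(M)=\mathbb{Q}\big[\{x_F\}_{F\in\mathcal L(M)\setminus\{E\}}\cup\{y_i\}_{i\in E}\big]/(\widetilde I_1+\widetilde I_2+\widetilde J),$$ where $\widetilde I_1$ is generated by $x_Fx_{F'}$ for incomparable proper flats $F,F'$; $\widetilde I_2$ by $y_ix_F$ for $i\in E$ and proper flats $F$ with $i\notin F$; $\widetilde J$ by $y_i-\sum_{F\in\mathcal L(M)\setminus\{E\}:\, i\notin F}x_F$ for $i\in E$. $\mathrm{Hilb}(A,t)=\sum_j\dim_{\mathbb{Q}}(A^j)t^j$. For rank $r$ matroids, $A(M)$ has top degree $r-1$ and $\widetilde A(M)$ has top degree $r$. For $A$ with Hilbert series of degree $m$, the Charney--Davis quantity is $CD(A)=(-1)^{m/2}\mathrm{Hilb}(A,-1)$ if $m$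 is even and $CD(A)=\mathrm{Hilb}(A,-1)$ if $m$ is odd. For $\sigma\in\mathfrak S_n$: $\mathrm{DES}(\sigma)=\{i\in[n-1]:\sigma_i>\sigma_{i+1}\}$, $\mathrm{inv}(\sigma)=|\{(i,j):i<j,\ \sigma_i>\sigma_j\}|$. $\mathrm{Even}(k)=\{2,4,\dots,k\}$ for even $k$ (empty for $k=0$), $\mathrm{Odd}(\ell)=\{1,3,\dots,\ell\}$ for odd $\ell$. *)

theory Defs
  imports
    "HOL-Library.Poly_Mapping"
    "HOL-Computational_Algebra.Polynomial"
    "HOL-Combinatorics.Permutations"
    "HOL-Number_Theory.Prime_Powers"
    "HOL-Algebra.QuotRing"
    "Jordan_Normal_Form.VS_Connect"
begin

section \<open>Polynomial rings over the rationals\<close>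

text \<open>
  A polynomial is a finitely supported map from monomials to coefficients, a monomial being a
  finitely supported map from variables to exponents; the library's convolution product on
  \<^typ>\<open>'a \<Rightarrow>\<^sub>0 'b\<close> is then multiplication of polynomials. The variables of a given ring
  are in general only a part of the variable type, hence the explicit carrier.
\<close>

type_synonym 'v qpoly = "('v \<Rightarrow>\<^sub>0 nat) \<Rightarrow>\<^sub>0 rat"

definition var :: "'v \<Rightarrow> 'v qpoly" where
  "var v = Poly_Mapping.single (Poly_Mapping.single v 1) 1"

definition qpoly_ring :: "'v set \<Rightarrow> 'v qpoly ring" where
  "qpoly_ring V =
     \<lparr>carrier = {p. \<forall>m \<in> Poly_Mapping.keys p. Poly_Mapping.keys m \<subseteq> V},
      mult = (*), one = 1, zero = 0, add = (+)\<rparr>"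

definition homogeneous :: "'v set \<Rightarrow> nat \<Rightarrow> 'v qpoly set" where
  "homogeneous V j =
     {p \<in> carrier (qpoly_ring V).
        \<forall>m \<in> Poly_Mapping.keys p. (\<Sum>v\<in>Poly_Mapping.keys m. Poly_Mapping.lookup m v) = j}"


section \<open>Graded algebras and Hilbert series\<close>

record ('k, 'a) graded_algebra = "('k, 'a) module" +
  piece :: "nat \<Rightarrow> 'a set"

text \<open>
  The quotient of a polynomial ring by a homogeneous ideal. A rational \<^term>\<open>c\<close> acts as
  multiplication by the class of the constant polynomial \<^term>\<open>c\<close>, and the piece of degree
  \<^term>\<open>j\<close> consists of the classes of the homogeneous polynomials of degree \<^term>\<open>j\<close>.
\<close>

definition quotient_algebra ::
  "'v set \<Rightarrow> 'v qpoly set \<Rightarrow> (rat, 'v qpoly set) graded_algebra" where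
  "quotient_algebra V I =
     (let R = qpoly_ring V; Q = R Quot I in
      \<lparr>carrier = carrier Q, mult = mult Q, one = one Q, zero = zero Q, add = add Q,
       smult = (\<lambda>c a. (I +>\<^bsub>R\<^esub> Poly_Mapping.single 0 c) \<otimes>\<^bsub>Q\<^esub> a),
       piece = (\<lambda>j. (\<lambda>p. I +>\<^bsub>R\<^esub> p) ` homogeneous V j)\<rparr>)"

text \<open>
  The Hilbert series is a polynomial only if almost all pieces vanish, as is the case for the two
  algebras below; \<^const>\<open>Abs_poly\<close> is unspecified otherwise.
\<close>

definition Hilb :: "(rat, 'a) graded_algebra \<Rightarrow> int poly" where
  "Hilb A = Abs_poly (\<lambda>j. int (vectorspace.dim class_ring (A\<lparr>carrier := piece A j\<rparr>)))"

definition charney_davis :: "(rat, 'a) graded_algebra \<Rightarrow> int" where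
  "charney_davis A =
     (let m = degree (Hilb A) in
      if even m then (-1) ^ (m div 2) * poly (Hilb A) (-1) else poly (Hilb A) (-1))"


section \<open>Chow rings of matroids\<close>

text \<open>
  A matroid is determined by its ground set and its flats, and only these enter the definitions
  of the two Chow rings; the record does not impose the matroid axioms.
\<close>

record 'a matroid =
  ground :: "'a set"
  flats :: "'a set set"

definition incomparable :: "'a set \<Rightarrow> 'a set \<Rightarrow> bool" where
  "incomparable F G \<longleftrightarrow> \<not> F \<subseteq> G \<and> \<not> G \<subseteq> F"

definition chow_ring :: "'a matroid \<Rightarrow> (rat, 'a set qpoly set) graded_algebra" where
  "chow_ring M =
     (let L = flats M - {{}};
          R = qpoly_ring L;
          I = Idl\<^bsub>R\<^esub> {var F * var G |F G. F \<in> L \<and> G \<in> L \<and> incomparable F G};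
          J = Idl\<^bsub>R\<^esub> {(\<Sum>F | F \<in> L \<and> i \<in> F. var F) |i. i \<in> ground M}
      in quotient_algebra L (I <+>\<^bsub>R\<^esub> J))"

datatype 'a aug_var = X "'a set" | Y 'a

definition augmented_chow_ring ::
  "'a matroid \<Rightarrow> (rat, 'a aug_var qpoly set) graded_algebra" where
  "augmented_chow_ring M =
     (let E = ground M;
          L = flats M - {E};
          V = X ` L \<union> Y ` E;
          R = qpoly_ring V;
          I1 = Idl\<^bsub>R\<^esub> {var (X F) * var (X G) |F G. F \<in> L \<and> G \<in> L \<and> incomparable F G};
          I2 = Idl\<^bsub>R\<^esub> {var (Y i) * var (X F) |i F. i \<in> E \<and> F \<in> L \<and> i \<notin> F};
          J = Idl\<^bsub>R\<^esub> {var (Y i) - (\<Sum>F | F \<in> L \<and> i \<notin> F. var (X F)) |i. i \<in> E}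
      in quotient_algebra V (I1 <+>\<^bsub>R\<^esub> I2 <+>\<^bsub>R\<^esub> J))"


section \<open>The q-uniform matroid\<close>

text \<open>
  The finite field is an arbitrary field structure \<^term>\<open>K\<close>, so that its order can be quantified
  over; \<^term>\<open>ring.func_space K {1..n}\<close> is the space of vectors of length \<^term>\<open>n\<close> over it.
\<close>

definition q_uniform :: "nat \<Rightarrow> nat \<Rightarrow> 'f ring \<Rightarrow> (nat \<Rightarrow> 'f) matroid" where
  "q_uniform r n K =
     (let S = ring.func_space K {1..n} in
      \<lparr>ground = carrier S - {\<zero>\<^bsub>S\<^esub>},
       flats = {W - {\<zero>\<^bsub>S\<^esub>} |W. subspace K W S \<and>
                  (vectorspace.dim K (S\<lparr>carrier := W\<rparr>) \<le> r - 1 \<or> W = carrier S)}\<rparr>)"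


section \<open>Permutation statistics\<close>

text \<open>A permutation of \<^term>\<open>{1..n}\<close> is a function that fixes every other natural number.\<close>

definition DES :: "nat \<Rightarrow> (nat \<Rightarrow> nat) \<Rightarrow> nat set" where
  "DES n \<sigma> = {i \<in> {1..n - 1}. \<sigma> i > \<sigma> (i + 1)}"

definition inv_num :: "nat \<Rightarrow> (nat \<Rightarrow> nat) \<Rightarrow> nat" where
  "inv_num n \<sigma> = card {(i, j). i \<in> {1..n} \<and> j \<in> {1..n} \<and> i < j \<and> \<sigma> i > \<sigma> j}"

definition Even :: "nat \<Rightarrow> nat set" where
  "Even k = {i \<in> {1..k}. even i}"

definition Odd :: "nat \<Rightarrow> nat set" where
  "Odd k = {i \<in> {1..k}. odd i}"

end

theory Submission
  imports Defs "HOL-Library.FuncSet"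
begin

text \<open>
  Both rings have a monomial basis, the one found by Feichtner and Yuzvinsky for the Chow ring, and
  once its monomials are counted the theorem is a signed count of flags of subspaces over a finite
  field.

  \<^emph>\<open>One presentation for both rings.\<close> In the augmented Chow ring put \<open>x_E\<close> for minus the sum of
  all \<open>x_F\<close> with \<open>F\<close> proper. Then \<open>y_i\<close> becomes \<open>- h_i\<close>, where \<open>h_i\<close> is the sum of the \<open>x_F\<close> with
  \<open>i \<in> F\<close> (the term \<open>F = E\<close> included), and \<open>x_{}\<close> becomes minus the sum of all \<open>x_F\<close> with \<open>F\<close>
  nonempty. So both rings are generated by the \<open>x_F\<close> with \<open>F\<close> a nonempty flat, subject to
  \<open>x_F x_G = 0\<close> for incomparable \<open>F\<close>, \<open>G\<close>, to \<open>x_F h_i = 0\<close> for \<open>i \<notin> F\<close>, and to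
  \<open>h_i ^ (1 + \<epsilon>) = 0\<close>, with \<open>\<epsilon> = 0\<close> for the Chow ring and \<open>\<epsilon> = 1\<close> for the augmented one. The effect of
  \<open>\<epsilon>\<close> is that the empty flat behaves as if it had rank \<open>- \<epsilon>\<close>.

  \<^emph>\<open>The basis.\<close> The basis consists of the monomials that are supported on a chain of flats and in
  which the exponent of each flat is smaller than its rank minus the rank of the flat before it
  (\<open>admissible\<close>). That they span is a straightening argument: a power of \<open>x_F\<close> that is too large can
  be traded for monomials in larger flats (\<open>straighten\<close>). That they are independent is shown with an
  explicit functional \<open>deg_mon\<close> in the top degree, given on chain monomials by a product over the
  chain. It kills the ideal because the relation \<open>h_i\<close>, multiplied by any chain monomial, telescopes
  along the chain; the telescoping is the Pascal rule for Gaussian binomials (\<open>insertion_sum\<close>).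
  Pairing with a dual monomial then gives a triangular matrix with nonzero diagonal
  (\<open>deg_mon_dual_triangular\<close>, \<open>deg_mon_dual_nonzero\<close>). This yields the dimension of every graded piece
  (\<open>dim_piece_admissibles\<close>).

  \<^emph>\<open>Evaluation at \<open>-1\<close>.\<close> Between consecutive flats of ranks \<open>a < b\<close> the exponents contribute the
  sum of \<open>(-1) ^ k\<close> over \<open>1 \<le> k < b - a\<close>, which is \<open>-1\<close> if \<open>b - a\<close> is even and \<open>0\<close> otherwise. So
  only chains whose ranks all have the parity of \<open>\<epsilon>\<close> survive. If \<open>r\<close> has that parity too, adding or
  removing the top flat \<open>E\<close> cancels everything. Otherwise the flats are proper subspaces, the number
  of flags with dimensions \<open>T\<close> is the sum of \<open>q ^ inv \<sigma>\<close> over the permutations with descents in \<open>T\<close>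
  (\<open>card_flags_of\<close>), and inclusion-exclusion over \<open>T\<close> leaves the permutations whose descent set is
  exactly the set of dimensions of the right parity below \<open>r\<close>.
\<close>

section \<open>Gaussian binomials and subspaces over a finite field\<close>

fun qbinom :: "int \<Rightarrow> nat \<Rightarrow> nat \<Rightarrow> int" where
  "qbinom q n 0 = 1"
| "qbinom q 0 (Suc k) = 0"
| "qbinom q (Suc n) (Suc k) = qbinom q n k + q ^ Suc k * qbinom q n (Suc k)"

lemma qbinom_eq_0: "n < k \<Longrightarrow> qbinom q n k = 0"
  by (induction q n k rule: qbinom.induct) auto

lemma qbinom_self [simp]: "qbinom q n n = 1"
  by (induction n) (auto simp: qbinom_eq_0)

text \<open>
The symmetric form of the two Pascal rules: their difference is exactly this identity, so it serves to
pass from the rule in the definition to the other one. In it both sides are the product formula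
for the Gaussian binomial with the denominators cleared.
\<close>

lemma qbinom_step: "(q ^ Suc k - 1) * qbinom q n (Suc k) = (q ^ (n - k) - 1) * qbinom q n k"
proof (induction n arbitrary: k)
  case 0
  show ?case by (cases k) auto
next
  case (Suc n)
  show ?case
  proof (cases "k \<le> n")
    case False
    then show ?thesis by (cases "k = Suc n") (auto simp: qbinom_eq_0)
  next
    case True
    have L: "(q ^ Suc k - 1) * qbinom q (Suc n) (Suc k) = (q ^ Suc n - 1) * qbinom q n k"
    proof -
      have "(q ^ Suc k - 1) * qbinom q (Suc n) (Suc k) =
          (q ^ Suc k - 1) * qbinom q n k + q ^ Suc k * ((q ^ Suc k - 1) * qbinom q n (Suc k))"
        by (simp add: algebra_simps)
      also have "\<dots> = (q ^ Suc k - 1) * qbinom q n k + q ^ Suc k * ((q ^ (n - k) - 1) * qbinom q n k)"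
        by (simp only: Suc.IH)
      also have "\<dots> = (q ^ (Suc k + (n - k)) - 1) * qbinom q n k"
        unfolding power_add by (simp add: algebra_simps)
      finally show ?thesis using True by simp
    qed
    show ?thesis
    proof (cases k)
      case 0
      then show ?thesis using L by simp
    next
      case (Suc j)
      have "(q ^ (Suc n - k) - 1) * qbinom q (Suc n) k =
          (q ^ (n - j) - 1) * qbinom q n j + q ^ k * ((q ^ (n - j) - 1) * qbinom q n k)"
        using Suc by (simp add: algebra_simps)
      also have "\<dots> = (q ^ k - 1) * qbinom q n k + q ^ k * ((q ^ (n - j) - 1) * qbinom q n k)"
        using Suc Suc.IH[of j] by simp
      also have "\<dots> = (q ^ (k + (n - j)) - 1) * qbinom q n k"
        unfolding power_add by (simp add: algebra_simps)
      also have "k + (n - j) = Suc n" using Suc True by simp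
      finally show ?thesis using L by simp
    qed
  qed
qed

text \<open>
This is how subspaces are counted: a pair of a \<open>(k+1)\<close>-dimensional subspace and a nonzero vector in it
can be chosen in either order.
\<close>

lemma qbinom_absorb:
  "(q ^ Suc k - 1) * qbinom q (Suc n) (Suc k) = (q ^ Suc n - 1) * qbinom q n k"
proof (cases "k \<le> n")
  case False
  then show ?thesis by (simp add: qbinom_eq_0)
next
  case True
  have "(q ^ Suc k - 1) * qbinom q (Suc n) (Suc k) =
      (q ^ Suc k - 1) * qbinom q n k + q ^ Suc k * ((q ^ Suc k - 1) * qbinom q n (Suc k))"
    by (simp add: algebra_simps)
  also have "\<dots> = (q ^ Suc k - 1) * qbinom q n k + q ^ Suc k * ((q ^ (n - k) - 1) * qbinom q n k)"
    by (simp only: qbinom_step)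
  also have "\<dots> = (q ^ (Suc k + (n - k)) - 1) * qbinom q n k"
    unfolding power_add by (simp add: algebra_simps)
  finally show ?thesis using True by simp
qed

lemma qbinom_Suc_Suc':
  assumes "k \<le> n"
  shows "qbinom q (Suc n) (Suc k) = q ^ (n - k) * qbinom q n k + qbinom q n (Suc k)"
proof -
  have "qbinom q (Suc n) (Suc k) - (q ^ (n - k) * qbinom q n k + qbinom q n (Suc k))
      = (q ^ Suc k - 1) * qbinom q n (Suc k) - (q ^ (n - k) - 1) * qbinom q n k"
    by (simp add: algebra_simps)
  then show ?thesis by (simp only: qbinom_step)
qed

lemma sum_indicator: "finite A \<Longrightarrow> (\<Sum>i\<in>A. if Q i then 1 else (0::int)) = int (card {i \<in> A. Q i})"
  by (simp add: sum.If_cases Int_def)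

text \<open>
The subspaces of a finite vector space, each without its zero vector, so that the proper flats of the
matroid are literally among them and the empty flat is the zero space. Cardinalities and the
existence of the span of a subspace and one more vector are what the counting arguments use.
\<close>

locale geometry =
  fixes P :: "'a set set" and E :: "'a set" and q :: nat and dm :: "'a set \<Rightarrow> nat"
  assumes q_ge_2: "2 \<le> q" and finite_E: "finite E" and P_sub: "F \<in> P \<Longrightarrow> F \<subseteq> E"
    and E_in: "E \<in> P" and empty_in: "{} \<in> P"
    and card_P: "F \<in> P \<Longrightarrow> card F = q ^ dm F - 1"
    and Int_in: "F \<in> P \<Longrightarrow> G \<in> P \<Longrightarrow> F \<inter> G \<in> P"
    and join: "F \<in> P \<Longrightarrow> i \<in> E \<Longrightarrow> i \<notin> F \<Longrightarrow>
      \<exists>G\<in>P. F \<subseteq> G \<and> i \<in> G \<and> dm G = Suc (dm F) \<and> (\<forall>H\<in>P. F \<subseteq> H \<and> i \<in> H \<longrightarrow> G \<subseteq> H)"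
begin

lemma join_obtain:
  assumes "F \<in> P" "i \<in> E" "i \<notin> F"
  obtains G where "G \<in> P" "F \<subseteq> G" "i \<in> G" "dm G = Suc (dm F)"
    "\<forall>H\<in>P. F \<subseteq> H \<longrightarrow> i \<in> H \<longrightarrow> G \<subseteq> H"
proof -
  from join[OF assms] obtain G where "G \<in> P"
    "F \<subseteq> G \<and> i \<in> G \<and> dm G = Suc (dm F) \<and> (\<forall>H\<in>P. F \<subseteq> H \<and> i \<in> H \<longrightarrow> G \<subseteq> H)" ..
  then show ?thesis by (intro that[of G]) simp_all
qed

lemma finite_in_P: "F \<in> P \<Longrightarrow> finite F"
  using P_sub finite_E finite_subset by blast

lemma finite_P: "finite P"
  using P_sub finite_E by (meson Pow_iff finite_Pow_iff finite_subset subsetI)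

lemma int_card_P: "F \<in> P \<Longrightarrow> int (card F) = int q ^ dm F - 1"
  using card_P[of F] q_ge_2 by (simp add: of_nat_diff)

lemma dm_empty [simp]: "dm {} = 0"
proof -
  have "int q ^ dm {} = 1" using int_card_P[OF empty_in] by simp
  then show ?thesis using q_ge_2 one_less_power[of "int q" "dm {}"] by (cases "dm {}") auto
qed

lemma dm_strict_mono: "F \<in> P \<Longrightarrow> G \<in> P \<Longrightarrow> F \<subset> G \<Longrightarrow> dm F < dm G"
proof -
  assume "F \<in> P" "G \<in> P" "F \<subset> G"
  then have "card F < card G" by (simp add: finite_in_P psubset_card_mono)
  then have "int q ^ dm F < int q ^ dm G"
    using int_card_P[OF \<open>F \<in> P\<close>] int_card_P[OF \<open>G \<in> P\<close>] by linarith
  then show ?thesis using q_ge_2 by simp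
qed

lemma dm_mono: "F \<in> P \<Longrightarrow> G \<in> P \<Longrightarrow> F \<subseteq> G \<Longrightarrow> dm F \<le> dm G"
  using dm_strict_mono[of F G] by (cases "F = G") (auto simp: psubset_eq intro: less_imp_le)

lemma dm_eq_imp_eq: "F \<in> P \<Longrightarrow> G \<in> P \<Longrightarrow> F \<subseteq> G \<Longrightarrow> dm F = dm G \<Longrightarrow> F = G"
  using dm_strict_mono[of F G] by (auto simp: psubset_eq)

lemma dm_eq_0_iff: "F \<in> P \<Longrightarrow> dm F = 0 \<longleftrightarrow> F = {}"
  using dm_eq_imp_eq[OF empty_in] by auto

lemma card_between:
  assumes "W \<in> P" "U \<in> P" "W \<subseteq> U"
  shows "int (card {G \<in> P. W \<subseteq> G \<and> G \<subseteq> U \<and> dm G = dm W + k}) = qbinom (int q) (dm U - dm W) k"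
  using assms
proof (induction k arbitrary: W)
  case 0
  have "G = W" if "G \<in> P" "W \<subseteq> G" "dm G = dm W" for G
    using dm_eq_imp_eq[OF 0(1) that(1,2)] that(3) by simp
  then have "{G \<in> P. W \<subseteq> G \<and> G \<subseteq> U \<and> dm G = dm W + 0} = {W}"
    using 0 by auto
  then show ?case by simp
next
  case (Suc k)
  let ?S = "{G \<in> P. W \<subseteq> G \<and> G \<subseteq> U \<and> dm G = dm W + Suc k}"
  let ?w = "int q ^ dm W"
  have finS: "finite ?S" using finite_P by simp
  have finU: "finite (U - W)" using Suc.prems finite_in_P by blast
  have q1: "int q > 1" using q_ge_2 by simp
  have wU: "dm W \<le> dm U" using Suc.prems dm_mono by blast
  \<comment> \<open>Count the pairs of a subspace \<open>G\<close> and a vector of \<open>G\<close> outside \<open>W\<close> in two ways.\<close>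
  have "(\<Sum>G\<in>?S. \<Sum>i\<in>U - W. if i \<in> G then 1 else (0::int)) = (\<Sum>G\<in>?S. ?w * (int q ^ Suc k - 1))"
  proof (rule sum.cong[OF refl])
    fix G assume G: "G \<in> ?S"
    have "(\<Sum>i\<in>U - W. if i \<in> G then 1 else (0::int)) = int (card (G - W))"
    proof -
      have "{i \<in> U - W. i \<in> G} = G - W" using G by auto
      then show ?thesis using sum_indicator[OF finU, of "\<lambda>i. i \<in> G"] by simp
    qed
    also have "\<dots> = int (card G) - int (card W)"
    proof -
      have "W \<subseteq> G" "finite G" using G finite_in_P by auto
      then show ?thesis
        by (metis card_Diff_subset card_mono finite_subset of_nat_diff)
    qed
    also have "\<dots> = int q ^ (dm W + Suc k) - ?w"
      using G Suc.prems int_card_P[of G] int_card_P[of W] by simp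
    finally show "(\<Sum>i\<in>U - W. if i \<in> G then 1 else (0::int)) = ?w * (int q ^ Suc k - 1)"
      unfolding power_add right_diff_distrib by simp
  qed
  also have "\<dots> = int (card ?S) * (?w * (int q ^ Suc k - 1))" by simp
  finally have byG: "(\<Sum>G\<in>?S. \<Sum>i\<in>U - W. if i \<in> G then 1 else (0::int)) = \<dots>" .
  have "(\<Sum>i\<in>U - W. \<Sum>G\<in>?S. if i \<in> G then (1::int) else 0)
      = (\<Sum>i\<in>U - W. qbinom (int q) (dm U - dm W - 1) k)"
  proof (rule sum.cong[OF refl])
    fix i assume i: "i \<in> U - W"
    then have "i \<in> E" "i \<notin> W" using P_sub[OF Suc.prems(2)] by auto
    from join_obtain[OF Suc.prems(1) this] obtain W' where W': "W' \<in> P" "W \<subseteq> W'" "i \<in> W'" "dm W' = Suc (dm W)"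
      "\<forall>H\<in>P. W \<subseteq> H \<longrightarrow> i \<in> H \<longrightarrow> W' \<subseteq> H" by metis
    have sub: "W' \<subseteq> U" using W'(5) Suc.prems i by auto
    have "(\<Sum>G\<in>?S. if i \<in> G then (1::int) else 0) = int (card {G \<in> ?S. i \<in> G})"
      by (rule sum_indicator[OF finS])
    also have "{G \<in> ?S. i \<in> G} = {G \<in> P. W' \<subseteq> G \<and> G \<subseteq> U \<and> dm G = dm W' + k}"
      using W' sub by auto
    also have "int (card \<dots>) = qbinom (int q) (dm U - dm W') k"
      using Suc.IH[OF W'(1) Suc.prems(2) sub] .
    finally show "(\<Sum>G\<in>?S. if i \<in> G then (1::int) else 0) = qbinom (int q) (dm U - dm W - 1) k"
      using W'(4) by simp
  qed
  also have "\<dots> = int (card (U - W)) * qbinom (int q) (dm U - dm W - 1) k" by simp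
  also have "int (card (U - W)) = ?w * (int q ^ (dm U - dm W) - 1)"
  proof -
    have "int (card (U - W)) = int (card U) - int (card W)"
      using Suc.prems finite_in_P by (metis card_Diff_subset card_mono of_nat_diff)
    also have "\<dots> = int q ^ (dm W + (dm U - dm W)) - ?w"
      using Suc.prems int_card_P wU by simp
    finally show ?thesis unfolding power_add right_diff_distrib by simp
  qed
  finally have "int (card ?S) * (?w * (int q ^ Suc k - 1)) =
      ?w * (int q ^ (dm U - dm W) - 1) * qbinom (int q) (dm U - dm W - 1) k"
    unfolding byG[symmetric] by (subst sum.swap)
  then have "?w * (int (card ?S) * (int q ^ Suc k - 1)) =
      ?w * ((int q ^ (dm U - dm W) - 1) * qbinom (int q) (dm U - dm W - 1) k)"
    by (simp only: mult.assoc mult.left_commute)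
  moreover have "?w \<noteq> 0" using q1 by simp
  ultimately have *: "int (card ?S) * (int q ^ Suc k - 1) =
      (int q ^ (dm U - dm W) - 1) * qbinom (int q) (dm U - dm W - 1) k"
    by (simp only: mult_cancel_left) simp
  have ne: "int q ^ Suc k - 1 \<noteq> 0" using q1 by (metis less_irrefl one_less_power zero_less_Suc eq_iff_diff_eq_0)
  show ?case
  proof (cases "dm U - dm W")
    case 0
    then show ?thesis using * ne by simp
  next
    case (Suc m)
    have "int (card ?S) * (int q ^ Suc k - 1) = qbinom (int q) (Suc m) (Suc k) * (int q ^ Suc k - 1)"
      using * qbinom_absorb[of "int q" k m] Suc by (simp add: mult.commute)
    then show ?thesis using ne Suc by simp
  qed
qed

text \<open>
Subspaces through \<open>W\<close> and \<open>i\<close> are the subspaces through their span, so this is the previous count in a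
quotient of dimension one less.
\<close>

lemma card_between_through:
  assumes "W \<in> P" "U \<in> P" "W \<subseteq> U" "i \<in> U" "i \<notin> W"
  shows "int (card {G \<in> P. W \<subseteq> G \<and> i \<in> G \<and> G \<subseteq> U \<and> dm G = dm W + Suc k}) =
    qbinom (int q) (dm U - dm W - 1) k"
proof -
  have "i \<in> E" using P_sub[OF assms(2)] assms(4) by auto
  from join_obtain[OF assms(1) this assms(5)] obtain W' where W': "W' \<in> P" "W \<subseteq> W'" "i \<in> W'" "dm W' = Suc (dm W)"
      "\<forall>H\<in>P. W \<subseteq> H \<longrightarrow> i \<in> H \<longrightarrow> W' \<subseteq> H" by metis
  have sub: "W' \<subseteq> U" using W'(5) assms by auto
  have "{G \<in> P. W \<subseteq> G \<and> i \<in> G \<and> G \<subseteq> U \<and> dm G = dm W + Suc k} =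
      {G \<in> P. W' \<subseteq> G \<and> G \<subseteq> U \<and> dm G = dm W' + k}" using W' by auto
  then show ?thesis using card_between[OF W'(1) assms(2) sub, of k] W'(4) by simp
qed

end

section \<open>Inversions of permutations with prescribed descents\<close>

lemma mono_between_descents:
  assumes "\<And>k. a \<le> k \<Longrightarrow> k < b \<Longrightarrow> k \<notin> DES n \<sigma>" "\<sigma> permutes {1..n}" "1 \<le> a" "b \<le> n"
    and "a \<le> i" "i < j" "j \<le> b"
  shows "\<sigma> i < \<sigma> j"
  using assms(6,7)
proof (induction "j - i" arbitrary: j)
  case 0
  then show ?case by simp
next
  case (Suc k)
  have step: "\<sigma> (j - 1) < \<sigma> j"
  proof -
    have "\<not> \<sigma> (j - 1) > \<sigma> (j - 1 + 1)"
      using assms(1)[of "j - 1"] assms(3-5) Suc.prems by (auto simp: DES_def)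
    moreover have "\<sigma> (j - 1) \<noteq> \<sigma> j"
      using inj_eq[OF permutes_inj[OF assms(2)], of "j - 1" j] Suc.prems by simp
    ultimately show ?thesis using Suc.prems by simp
  qed
  show ?case
  proof (cases "i = j - 1")
    case False
    then have "\<sigma> i < \<sigma> (j - 1)" using Suc.hyps(1)[of "j - 1"] Suc by simp
    then show ?thesis using step by simp
  qed (use step in simp)
qed

text \<open>
At the first place where the two functions differ, the smaller of the two values is attained by the other function
earlier, where they agree.
\<close>

lemma strict_mono_image_unique:
  fixes f g :: "nat \<Rightarrow> nat"
  assumes "\<And>i j. a \<le> i \<Longrightarrow> i < j \<Longrightarrow> j \<le> b \<Longrightarrow> f i < f j"
    and "\<And>i j. a \<le> i \<Longrightarrow> i < j \<Longrightarrow> j \<le> b \<Longrightarrow> g i < g j"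
    and im: "f ` {a..b} = g ` {a..b}"
    and "a \<le> i" "i \<le> b"
  shows "f i = g i"
  using assms(4,5)
proof (induction i rule: less_induct)
  case (less i)
  show ?case
  proof (rule linorder_cases[of "f i" "g i"])
    assume lt: "f i < g i"
    have "f i \<in> g ` {a..b}" using im less.prems by auto
    then obtain j where j: "a \<le> j" "j \<le> b" "f i = g j" by auto
    then have "j < i" using lt assms(2)[of i j] less.prems by (cases i j rule: linorder_cases) auto
    then have "f j = f i" using less.IH[of j] j by simp
    then show ?thesis using assms(1)[of j i] \<open>j < i\<close> j less.prems by simp
  next
    assume lt: "g i < f i"
    have "g i \<in> f ` {a..b}" using im less.prems by auto
    then obtain j where j: "a \<le> j" "j \<le> b" "g i = f j" by auto
    then have "j < i" using lt assms(1)[of i j] less.prems by (cases i j rule: linorder_cases) auto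
    then have "g j = g i" using less.IH[of j] j by simp
    then show ?thesis using assms(2)[of j i] \<open>j < i\<close> j less.prems by simp
  qed
qed

lemma increasing_enumeration:
  assumes "finite (A :: nat set)"
  obtains h where "bij_betw h {a+1..a+card A} A"
    "strict_mono_on {a+1..a+card A} h"
proof -
  obtain f where f: "bij_betw f {..<card A} A" "strict_mono_on {..<card A} f"
    using ex_bij_betw_strict_mono_card[OF assms] by auto
  have sh: "bij_betw (\<lambda>i. i - (a + 1)) {a+1..a+card A} {..<card A}"
    by (rule bij_betw_byWitness[where f' = "\<lambda>i. i + (a + 1)"]) auto
  have "bij_betw (f \<circ> (\<lambda>i. i - (a + 1))) {a+1..a+card A} A"
    by (rule bij_betw_trans[OF sh f(1)])
  moreover have "strict_mono_on {a+1..a+card A} (f \<circ> (\<lambda>i. i - (a + 1)))"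
    by (rule strict_mono_onI) (auto intro!: strict_mono_onD[OF f(2)])
  ultimately show ?thesis using that by blast
qed

text \<open>
The Grassmannian permutations with descent at \<open>d\<close>; they are the minimal coset representatives of
\<open>S_d \<times> S_(n-d)\<close> and correspond to the \<open>d\<close>-subsets of \<open>{1..n}\<close>.
\<close>

definition grassmannian :: "nat \<Rightarrow> nat \<Rightarrow> (nat \<Rightarrow> nat) set" where
  "grassmannian n d = {g. g permutes {1..n} \<and> DES n g \<subseteq> {d}}"

lemma grassmannian_mono:
  assumes "g \<in> grassmannian n d" "d \<le> n"
  shows "1 \<le> i \<Longrightarrow> i < j \<Longrightarrow> j \<le> d \<Longrightarrow> g i < g j" "d + 1 \<le> i \<Longrightarrow> i < j \<Longrightarrow> j \<le> n \<Longrightarrow> g i < g j"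
proof -
  have g: "g permutes {1..n}" "DES n g \<subseteq> {d}" using assms by (auto simp: grassmannian_def)
  show "1 \<le> i \<Longrightarrow> i < j \<Longrightarrow> j \<le> d \<Longrightarrow> g i < g j"
    by (rule mono_between_descents[OF _ g(1), of 1 d]) (use g(2) assms(2) in auto)
  show "d + 1 \<le> i \<Longrightarrow> i < j \<Longrightarrow> j \<le> n \<Longrightarrow> g i < g j"
    by (rule mono_between_descents[OF _ g(1), of "d + 1" n]) (use g(2) assms(2) in auto)
qed

lemma grassmannian_exists:
  assumes A: "A \<subseteq> {1..n}" and d: "card A = d"
  obtains g where "g \<in> grassmannian n d" "g ` {1..d} = A"
proof -
  have finA: "finite A" using finite_subset[OF A] by simp
  have dn: "d \<le> n" using card_mono[OF _ A] d by simp
  have cc: "card ({1..n} - A) = n - d" using card_Diff_subset[OF finA A] d by simp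
  obtain h where h: "bij_betw h {0+1..0+card A} A" "strict_mono_on {0+1..0+card A} h"
    using increasing_enumeration[OF finA, of 0] .
  have "finite ({1..n} - A)" by simp
  then obtain h' where h': "bij_betw h' {d+1..d+card ({1..n} - A)} ({1..n} - A)"
    "strict_mono_on {d+1..d+card ({1..n} - A)} h'"
    by (rule increasing_enumeration[of _ d])
  define g where "g i = (if i \<in> {1..d} then h i else if i \<in> {d+1..n} then h' i else i)" for i
  have b1: "bij_betw g {1..d} A"
    using h(1) d by (subst bij_betw_cong[of _ g h]) (auto simp: g_def)
  have b2: "bij_betw g {d+1..n} ({1..n} - A)"
    using h'(1) cc dn by (subst bij_betw_cong[of _ g h']) (auto simp: g_def)
  have "bij_betw g ({1..d} \<union> {d+1..n}) (A \<union> ({1..n} - A))"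
    by (rule bij_betw_combine[OF b1 b2]) auto
  moreover have "{1..d} \<union> {d+1..n} = {1..n}" "A \<union> ({1..n} - A) = {1..n}" using dn A by auto
  ultimately have "bij_betw g {1..n} {1..n}" by simp
  then have "g permutes {1..n}"
    by (rule bij_imp_permutes) (use dn in \<open>auto simp: g_def\<close>)
  moreover have "i = d" if i: "i \<in> DES n g" for i
  proof (rule ccontr)
    assume "i \<noteq> d"
    then consider "1 \<le> i" "i + 1 \<le> d" | "d + 1 \<le> i" "i + 1 \<le> n"
      using i by (fastforce simp: DES_def)
    then have "g i < g (i + 1)"
    proof cases
      case 1
      then show ?thesis using strict_mono_onD[OF h(2), of i "i + 1"] d by (simp add: g_def)
    next
      case 2
      then show ?thesis using strict_mono_onD[OF h'(2), of i "i + 1"] cc dn by (simp add: g_def)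
    qed
    then show False using i by (simp add: DES_def)
  qed
  ultimately have "g \<in> grassmannian n d" by (auto simp: grassmannian_def)
  moreover have "g ` {1..d} = A" using b1 by (simp add: bij_betw_def)
  ultimately show ?thesis using that by blast
qed

lemma image_complement:
  fixes \<sigma> :: "nat \<Rightarrow> nat"
  assumes "\<sigma> permutes {1..n}" "d \<le> n"
  shows "\<sigma> ` {d+1..n} = {1..n} - \<sigma> ` {1..d}"
proof -
  have "{d+1..n} = {1..n} - {1..d}" using assms by auto
  then show ?thesis
    using image_set_diff[OF permutes_inj[OF assms(1)], of "{1..n}" "{1..d}"] permutes_image[OF assms(1)] by simp
qed

lemma grassmannian_unique:
  assumes "g \<in> grassmannian n d" "\<sigma> permutes {1..n}" "d \<le> n" "\<sigma> ` {1..d} = g ` {1..d}"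
    and "\<And>i j. d + 1 \<le> i \<Longrightarrow> i < j \<Longrightarrow> j \<le> n \<Longrightarrow> \<sigma> i < \<sigma> j" "i \<notin> {1..d}"
  shows "\<sigma> i = g i"
proof (cases "i \<in> {1..n}")
  case True
  have gp: "g permutes {1..n}" using assms(1) by (simp add: grassmannian_def)
  show ?thesis
  proof (rule strict_mono_image_unique[where a = "d + 1" and b = n and f = \<sigma> and g = g and i = i])
    show "\<sigma> ` {d+1..n} = g ` {d+1..n}"
      using image_complement[OF assms(2,3)] image_complement[OF gp assms(3)] assms(4) by simp
  qed (use assms(5,6) grassmannian_mono(2)[OF assms(1,3)] True in auto)
next
  case False
  then show ?thesis
    using assms(1) permutes_not_in[OF assms(2) False] permutes_not_in[of g "{1..n}" i] by (simp add: grassmannian_def)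
qed

lemma grassmannian_inj: "d \<le> n \<Longrightarrow> inj_on (\<lambda>g. g ` {1..d}) (grassmannian n d)"
proof (rule inj_onI, rule ext)
  fix g g' i assume d: "d \<le> n" and g: "g \<in> grassmannian n d" "g' \<in> grassmannian n d" "g ` {1..d} = g' ` {1..d}"
  show "g i = g' i"
  proof (cases "i \<in> {1..d}")
    case True
    show ?thesis
      by (rule strict_mono_image_unique[where a = 1 and b = d and f = g and g = g' and i = i])
        (use grassmannian_mono(1)[OF g(1) d] grassmannian_mono(1)[OF g(2) d] g(3) True in auto)
  next
    case False
    then show ?thesis
      using grassmannian_unique[OF g(2) _ d g(3) grassmannian_mono(2)[OF g(1) d]] g(1) by (auto simp: grassmannian_def)
  qed
qed

definition crossings :: "nat \<Rightarrow> nat set \<Rightarrow> nat" where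
  "crossings n A = card {(a, b). a \<in> A \<and> b \<in> {1..n} - A \<and> b < a}"

text \<open>
Both blocks are increasing, so every inversion goes from the first block to the second.
\<close>

lemma inv_num_grassmannian:
  assumes g: "g \<in> grassmannian n d" and d: "d \<le> n"
  shows "inv_num n g = crossings n (g ` {1..d})"
    and "inv_num n g = card {(i, j). i \<in> {1..d} \<and> j \<in> {d+1..n} \<and> g j < g i}"
proof -
  have gp: "g permutes {1..n}" using g by (simp add: grassmannian_def)
  have eq: "{(i, j). i \<in> {1..n} \<and> j \<in> {1..n} \<and> i < j \<and> g i > g j} =
     {(i, j). i \<in> {1..d} \<and> j \<in> {d+1..n} \<and> g j < g i}"
  proof -
    have "i \<in> {1..d} \<and> j \<in> {d+1..n}" if ij: "i \<in> {1..n}" "j \<in> {1..n}" "i < j" "g i > g j" for i j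
    proof -
      have "\<not> j \<le> d" "\<not> d + 1 \<le> i" using grassmannian_mono[OF g d, of i j] ij by auto
      then show ?thesis using ij by auto
    qed
    moreover have "i \<in> {1..n} \<and> j \<in> {1..n} \<and> i < j" if "i \<in> {1..d}" "j \<in> {d+1..n}" for i j
      using that d by auto
    ultimately show ?thesis by blast
  qed
  then show 2: "inv_num n g = card {(i, j). i \<in> {1..d} \<and> j \<in> {d+1..n} \<and> g j < g i}"
    by (simp add: inv_num_def)
  have "bij_betw (map_prod g g) {(i, j). i \<in> {1..d} \<and> j \<in> {d+1..n} \<and> g j < g i}
     {(a, b). a \<in> g ` {1..d} \<and> b \<in> {1..n} - g ` {1..d} \<and> b < a}"
    unfolding bij_betw_def
  proof
    show "inj_on (map_prod g g) {(i, j). i \<in> {1..d} \<and> j \<in> {d+1..n} \<and> g j < g i}"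
      using permutes_inj[OF gp] by (auto simp: inj_on_def dest: injD)
    show "map_prod g g ` {(i, j). i \<in> {1..d} \<and> j \<in> {d+1..n} \<and> g j < g i} =
      {(a, b). a \<in> g ` {1..d} \<and> b \<in> {1..n} - g ` {1..d} \<and> b < a}"
      unfolding image_complement[OF gp d, symmetric] by (auto simp: image_iff)
  qed
  then show "inv_num n g = crossings n (g ` {1..d})"
    unfolding 2 crossings_def by (rule bij_betw_same_card)
qed

text \<open>
Removing the element \<open>n\<close> from the set gives the Pascal rule: if \<open>n\<close> lies in the set, it crosses each
element of the complement, and otherwise it crosses nothing.
\<close>

lemma sum_crossings:
  "(\<Sum>A | A \<subseteq> {1..n} \<and> card A = d. q ^ crossings n A) = qbinom q n d"
proof (induction q n d rule: qbinom.induct)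
  case (1 q n)
  have "{A. A \<subseteq> {1..n} \<and> card A = 0} = {{}}" using finite_subset[of _ "{1..n}"] by auto
  then show ?case by (simp add: crossings_def)
next
  case (2 q k)
  have "{A. A \<subseteq> {1..0::nat} \<and> card A = Suc k} = {}" by auto
  then show ?case by (simp only: sum.empty qbinom.simps)
next
  case (3 q n k)
  let ?S = "\<lambda>n k. {A. A \<subseteq> {1..n::nat} \<and> card A = k}"
  have finS: "finite (?S n k)" for n k :: nat by (rule finite_subset[of _ "Pow {1..n}"]) auto
  have notin: "Suc n \<notin> A" if "A \<subseteq> {1..n}" for A using that by auto
  have split: "?S (Suc n) (Suc k) = insert (Suc n) ` ?S n k \<union> ?S n (Suc k)" (is "?l = ?r")
  proof (rule Set.set_eqI, rule iffI)
    fix A assume A: "A \<in> ?l"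
    show "A \<in> ?r"
    proof (cases "Suc n \<in> A")
      case True
      then have "A - {Suc n} \<in> ?S n k" "A = insert (Suc n) (A - {Suc n})"
        using A by (auto simp: card_Diff_singleton)
      then show ?thesis by blast
    next
      case False
      then have "A \<subseteq> {1..n}" using A by (auto simp: le_Suc_eq)
      then show ?thesis using A by auto
    qed
  next
    fix A assume "A \<in> ?r"
    then show "A \<in> ?l"
    proof
      assume "A \<in> insert (Suc n) ` ?S n k"
      then obtain B where B: "B \<subseteq> {1..n}" "card B = k" "A = insert (Suc n) B" by auto
      then have "card A = Suc k" using notin[OF B(1)] finite_subset[OF B(1)] by simp
      then show ?thesis using B by auto
    qed auto
  qed
  have disj: "insert (Suc n) ` ?S n k \<inter> ?S n (Suc k) = {}" using notin by auto
  have inj: "inj_on (insert (Suc n)) (?S n k)"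
    using notin by (intro inj_onI) (metis (mono_tags, lifting) insert_ident mem_Collect_eq)
  have i1: "crossings (Suc n) (insert (Suc n) A) = crossings n A + (n - k)" if A: "A \<in> ?S n k" for A
  proof -
    have fA: "finite A" using A finite_subset[of A "{1..n}"] by auto
    have "{(a, b). a \<in> insert (Suc n) A \<and> b \<in> {1..Suc n} - insert (Suc n) A \<and> b < a} =
       {(a, b). a \<in> A \<and> b \<in> {1..n} - A \<and> b < a} \<union> {Suc n} \<times> ({1..n} - A)"
      using notin A by (auto simp: le_Suc_eq)
    moreover have "finite {(a, b). a \<in> A \<and> b \<in> {1..n} - A \<and> b < a}"
      by (rule finite_subset[of _ "A \<times> {1..n}"]) (use fA in auto)
    moreover have "{(a, b). a \<in> A \<and> b \<in> {1..n} - A \<and> b < a} \<inter> {Suc n} \<times> ({1..n} - A) = {}"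
      using notin A by auto
    ultimately have "crossings (Suc n) (insert (Suc n) A) = crossings n A + card ({Suc n} \<times> ({1..n} - A))"
      unfolding crossings_def by (simp add: card_Un_disjoint)
    also have "card ({Suc n} \<times> ({1..n} - A)) = n - k"
      using A fA card_Diff_subset[OF fA, of "{1..n}"] by (simp add: card_cartesian_product_singleton)
    finally show ?thesis .
  qed
  have i2: "crossings (Suc n) A = crossings n A" if A: "A \<in> ?S n (Suc k)" for A
  proof -
    have "{(a, b). a \<in> A \<and> b \<in> {1..Suc n} - A \<and> b < a} = {(a, b). a \<in> A \<and> b \<in> {1..n} - A \<and> b < a}"
      using A by fastforce
    then show ?thesis by (simp add: crossings_def)
  qed
  have "(\<Sum>A\<in>?S (Suc n) (Suc k). q ^ crossings (Suc n) A) =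
     (\<Sum>A\<in>insert (Suc n) ` ?S n k. q ^ crossings (Suc n) A) + (\<Sum>A\<in>?S n (Suc k). q ^ crossings (Suc n) A)"
    unfolding split by (rule sum.union_disjoint) (use disj in auto)
  also have "(\<Sum>A\<in>insert (Suc n) ` ?S n k. q ^ crossings (Suc n) A) = (\<Sum>A\<in>?S n k. q ^ (n - k) * q ^ crossings n A)"
    unfolding sum.reindex[OF inj] by (rule sum.cong) (auto simp: i1 power_add)
  also have "\<dots> = q ^ (n - k) * qbinom q n k" unfolding sum_distrib_left[symmetric] 3(1) ..
  also have "(\<Sum>A\<in>?S n (Suc k). q ^ crossings (Suc n) A) = (\<Sum>A\<in>?S n (Suc k). q ^ crossings n A)"
    by (rule sum.cong[OF refl]) (simp only: i2)
  also have "\<dots> = qbinom q n (Suc k)" by (rule 3(2))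
  finally have total: "(\<Sum>A\<in>?S (Suc n) (Suc k). q ^ crossings (Suc n) A) =
    q ^ (n - k) * qbinom q n k + qbinom q n (Suc k)" .
  show ?case
  proof (cases "k \<le> n")
    case True
    then show ?thesis unfolding total by (rule qbinom_Suc_Suc'[symmetric])
  next
    case False
    then show ?thesis unfolding total by (simp add: qbinom_eq_0)
  qed
qed

lemma sum_grassmannian:
  assumes "d \<le> n"
  shows "(\<Sum>g\<in>grassmannian n d. q ^ inv_num n g) = qbinom q n d"
proof -
  have im: "(\<lambda>g. g ` {1..d}) ` grassmannian n d = {A. A \<subseteq> {1..n} \<and> card A = d}"
  proof (rule Set.set_eqI, rule iffI)
    fix A assume "A \<in> (\<lambda>g. g ` {1..d}) ` grassmannian n d"
    then obtain g where g: "g permutes {1..n}" "A = g ` {1..d}" by (auto simp: grassmannian_def)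
    have "card A = d" using g card_image[OF inj_on_subset[OF permutes_inj[OF g(1)]], of "{1..d}"] by simp
    moreover have "A \<subseteq> {1..n}" using g permutes_image[OF g(1)] assms by auto
    ultimately show "A \<in> {A. A \<subseteq> {1..n} \<and> card A = d}" by simp
  next
    fix A assume "A \<in> {A. A \<subseteq> {1..n} \<and> card A = d}"
    then obtain g where "g \<in> grassmannian n d" "g ` {1..d} = A" using grassmannian_exists[of A n d] by auto
    then show "A \<in> (\<lambda>g. g ` {1..d}) ` grassmannian n d" by auto
  qed
  have "(\<Sum>g\<in>grassmannian n d. q ^ inv_num n g) = (\<Sum>g\<in>grassmannian n d. q ^ crossings n (g ` {1..d}))"
    by (rule sum.cong) (auto simp: inv_num_grassmannian(1)[OF _ assms])
  also have "\<dots> = (\<Sum>A\<in>(\<lambda>g. g ` {1..d}) ` grassmannian n d. q ^ crossings n A)"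
    unfolding sum.reindex[OF grassmannian_inj[OF assms]] comp_def ..
  finally show ?thesis unfolding im sum_crossings .
qed

text \<open>
The descents are only bounded by \<open>T\<close> here, not prescribed: this is the version that factors, and it
equals the Gaussian multinomial of the composition of \<open>n\<close> determined by \<open>T\<close>.
\<close>

definition descent_gf :: "int \<Rightarrow> nat \<Rightarrow> nat set \<Rightarrow> int" where
  "descent_gf q n T = (\<Sum>\<sigma> | \<sigma> permutes {1..n} \<and> DES n \<sigma> \<subseteq> T. q ^ inv_num n \<sigma>)"

lemma descent_gf_empty: "descent_gf q n {} = 1"
proof -
  have g: "grassmannian n 0 = {\<sigma>. \<sigma> permutes {1..n} \<and> DES n \<sigma> \<subseteq> {}}"
    by (auto simp: grassmannian_def DES_def)
  show ?thesis using sum_grassmannian[of 0 n q] unfolding g descent_gf_def by simp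
qed

text \<open>
The permutation \<open>\<tau>\<close> rearranges the positions of the first block of \<open>g\<close>. On that block \<open>g\<close> is
increasing and so preserves the inversions and descents of \<open>\<tau>\<close>, while the inversions between the two
blocks are merely relabelled.
\<close>

lemma compose_grassmannian:
  assumes d: "d \<le> n" and g: "g \<in> grassmannian n d" and \<tau>: "\<tau> permutes {1..d}"
  shows "g \<circ> \<tau> permutes {1..n}" "inv_num n (g \<circ> \<tau>) = inv_num n g + inv_num d \<tau>"
    "DES n (g \<circ> \<tau>) \<subseteq> insert d (DES d \<tau>)" "DES d \<tau> \<subseteq> DES n (g \<circ> \<tau>) - {d}"
proof -
  have gp: "g permutes {1..n}" using g by (simp add: grassmannian_def)
  have tn: "\<tau> permutes {1..n}" using permutes_subset[OF \<tau>] d by auto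
  show "g \<circ> \<tau> permutes {1..n}" by (rule permutes_compose[OF tn gp])
  have t_in: "\<tau> i \<in> {1..d}" if "i \<in> {1..d}" for i using that permutes_in_image[OF \<tau>] by blast
  have t_out: "\<tau> i = i" if "i \<notin> {1..d}" for i using permutes_not_in[OF \<tau> that] .
  have cmp: "g x < g y \<longleftrightarrow> x < y" if "x \<in> {1..d}" "y \<in> {1..d}" for x y
    using grassmannian_mono(1)[OF g d, of x y] grassmannian_mono(1)[OF g d, of y x] that
    by (cases x y rule: linorder_cases) auto
  show "DES n (g \<circ> \<tau>) \<subseteq> insert d (DES d \<tau>)"
  proof
    fix i assume i: "i \<in> DES n (g \<circ> \<tau>)"
    then have i': "1 \<le> i" "i + 1 \<le> n" "g (\<tau> i) > g (\<tau> (i + 1))" by (auto simp: DES_def)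
    consider "i + 1 \<le> d" | "i = d" | "d + 1 \<le> i" by linarith
    then show "i \<in> insert d (DES d \<tau>)"
    proof cases
      case 1
      then have "\<tau> i > \<tau> (i + 1)" using i' cmp[OF t_in t_in, of "i + 1" i] by auto
      then show ?thesis using 1 i' by (auto simp: DES_def)
    next
      case 3
      then have "\<tau> i = i" "\<tau> (i + 1) = i + 1" using t_out by auto
      then show ?thesis using i' 3 grassmannian_mono(2)[OF g d, of i "i + 1"] by simp
    qed simp
  qed
  show "DES d \<tau> \<subseteq> DES n (g \<circ> \<tau>) - {d}"
  proof
    fix i assume "i \<in> DES d \<tau>"
    then have i: "1 \<le> i" "i + 1 \<le> d" "\<tau> i > \<tau> (i + 1)" by (auto simp: DES_def)
    then have "g (\<tau> (i + 1)) < g (\<tau> i)" using cmp[OF t_in t_in, of "i + 1" i] by auto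
    then show "i \<in> DES n (g \<circ> \<tau>) - {d}" using i d by (auto simp: DES_def)
  qed
  let ?A = "{(i, j). i \<in> {1..d} \<and> j \<in> {1..d} \<and> i < j \<and> \<tau> i > \<tau> j}"
  let ?B = "{(i, j). i \<in> {1..d} \<and> j \<in> {d+1..n} \<and> g j < g (\<tau> i)}"
  have "{(i, j). i \<in> {1..n} \<and> j \<in> {1..n} \<and> i < j \<and> (g \<circ> \<tau>) i > (g \<circ> \<tau>) j} = ?A \<union> ?B"
  proof -
    have "(i \<in> {1..n} \<and> j \<in> {1..n} \<and> i < j \<and> (g \<circ> \<tau>) i > (g \<circ> \<tau>) j) \<longleftrightarrow> (i, j) \<in> ?A \<union> ?B" for i j
    proof -
      consider "j \<le> d" | "i \<le> d" "d < j" | "d < i" by linarith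
      then show ?thesis
      proof cases
        case 1
        then show ?thesis using d cmp[OF t_in t_in, of j i] by auto
      next
        case 2
        then show ?thesis using d t_out[of j] by auto
      next
        case 3
        then show ?thesis using t_out[of i] t_out[of j] grassmannian_mono(2)[OF g d, of i j] by auto
      qed
    qed
    then show ?thesis by auto
  qed
  moreover have "finite ?A" by (rule finite_subset[of _ "{1..d} \<times> {1..d}"]) auto
  moreover have "finite ?B" by (rule finite_subset[of _ "{1..d} \<times> {1..n}"]) auto
  moreover have "?A \<inter> ?B = {}" by auto
  ultimately have "inv_num n (g \<circ> \<tau>) = card ?A + card ?B"
    unfolding inv_num_def by (simp add: card_Un_disjoint)
  also have "card ?A = inv_num d \<tau>" by (simp add: inv_num_def)
  also have "card ?B = inv_num n g"
  proof -
    have "bij_betw (map_prod \<tau> id) ?B {(i, j). i \<in> {1..d} \<and> j \<in> {d+1..n} \<and> g j < g i}"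
      unfolding bij_betw_def
    proof
      show "inj_on (map_prod \<tau> id) ?B" using permutes_inj[OF \<tau>] by (auto simp: inj_on_def dest: injD)
      show "map_prod \<tau> id ` ?B = {(i, j). i \<in> {1..d} \<and> j \<in> {d+1..n} \<and> g j < g i}" (is "?l = ?r")
      proof
        show "?l \<subseteq> ?r"
        proof
          fix x assume "x \<in> ?l"
          then obtain i j where "x = (\<tau> i, j)" "i \<in> {1..d}" "j \<in> {d+1..n}" "g j < g (\<tau> i)" by auto
          then show "x \<in> ?r" using t_in[of i] by simp
        qed
        show "?r \<subseteq> ?l"
        proof
          fix x assume "x \<in> ?r"
          then obtain i j where x: "x = (i, j)" "i \<in> {1..d}" "j \<in> {d+1..n}" "g j < g i" by auto
          obtain i' where "i' \<in> {1..d}" "\<tau> i' = i" using x(2) permutes_image[OF \<tau>] by (metis imageE)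
          then show "x \<in> ?l" using x by (intro image_eqI[of _ _ "(i', j)"]) auto
        qed
      qed
    qed
    then show ?thesis using inv_num_grassmannian(2)[OF g d] by (simp add: bij_betw_same_card)
  qed
  finally show "inv_num n (g \<circ> \<tau>) = inv_num n g + inv_num d \<tau>"
    by (simp only: add.commute)
qed

text \<open>
A permutation is increasing after its last allowed descent \<open>d\<close>, hence factors uniquely as a
Grassmannian permutation and a permutation of the first \<open>d\<close> positions.
\<close>

lemma descent_gf_Max:
  assumes T: "T \<subseteq> {1..<n}" "T \<noteq> {}" and dT: "d = Max T"
  shows "descent_gf q n T = qbinom q n d * descent_gf q d (T - {d})"
proof -
  have finT: "finite T" using finite_subset[OF T(1)] by simp
  have d: "d \<in> T" "\<And>t. t \<in> T \<Longrightarrow> t \<le> d" using dT finT T(2) by auto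
  have dn: "d \<le> n" using d T by auto
  let ?P = "{\<sigma>. \<sigma> permutes {1..n} \<and> DES n \<sigma> \<subseteq> T}"
  let ?Q = "{\<tau>. \<tau> permutes {1..d} \<and> DES d \<tau> \<subseteq> T - {d}}"
  have inj: "inj_on (\<lambda>(g, \<tau>). g \<circ> \<tau>) (grassmannian n d \<times> ?Q)"
  proof (rule inj_onI, clarify)
    fix g \<tau> g' \<tau>' assume g: "g \<in> grassmannian n d" "g' \<in> grassmannian n d"
      and t: "\<tau> permutes {1..d}" "\<tau>' permutes {1..d}" and eq: "g \<circ> \<tau> = g' \<circ> \<tau>'"
    have "g ` {1..d} = (g \<circ> \<tau>) ` {1..d}" using permutes_image[OF t(1)] by (metis image_comp)
    also have "\<dots> = g' ` {1..d}" unfolding eq using permutes_image[OF t(2)] by (metis image_comp)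
    finally have gg: "g = g'" using inj_onD[OF grassmannian_inj[OF dn], of g g'] g by blast
    have "inj g" using g permutes_inj by (auto simp: grassmannian_def)
    then have "\<tau> = \<tau>'" using eq gg by (metis fun.inj_map_strong injD comp_apply ext)
    then show "g = g' \<and> \<tau> = \<tau>'" using gg by simp
  qed
  have im: "(\<lambda>(g, \<tau>). g \<circ> \<tau>) ` (grassmannian n d \<times> ?Q) = ?P"
  proof
    show "(\<lambda>(g, \<tau>). g \<circ> \<tau>) ` (grassmannian n d \<times> ?Q) \<subseteq> ?P"
    proof clarify
      fix g \<tau> assume a: "g \<in> grassmannian n d" "\<tau> permutes {1..d}" "DES d \<tau> \<subseteq> T - {d}"
      show "g \<circ> \<tau> permutes {1..n} \<and> DES n (g \<circ> \<tau>) \<subseteq> T"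
        using compose_grassmannian(1,3)[OF dn a(1,2)] a(3) d(1) by blast
    qed
    show "?P \<subseteq> (\<lambda>(g, \<tau>). g \<circ> \<tau>) ` (grassmannian n d \<times> ?Q)"
    proof
      fix \<sigma> assume "\<sigma> \<in> ?P"
      then have s: "\<sigma> permutes {1..n}" "DES n \<sigma> \<subseteq> T" by auto
      have "\<sigma> ` {1..d} \<subseteq> {1..n}" using permutes_image[OF s(1)] dn by auto
      moreover have "card (\<sigma> ` {1..d}) = d"
        using card_image[OF inj_on_subset[OF permutes_inj[OF s(1)]], of "{1..d}"] by simp
      ultimately obtain g where g: "g \<in> grassmannian n d" "g ` {1..d} = \<sigma> ` {1..d}"
        using grassmannian_exists[of "\<sigma> ` {1..d}" n d] by metis
      have gp: "g permutes {1..n}" using g by (simp add: grassmannian_def)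
      have incr: "\<sigma> i < \<sigma> j" if "d + 1 \<le> i" "i < j" "j \<le> n" for i j
        by (rule mono_between_descents[OF _ s(1), of "d + 1" n]) (use s(2) d(2) that in force)+
      define \<tau> where "\<tau> = inv_into UNIV g \<circ> \<sigma>"
      have gt: "g \<circ> \<tau> = \<sigma>" using permutes_inv_o(1)[OF gp] by (simp add: \<tau>_def o_assoc[symmetric]) (metis comp_assoc id_comp)
      have tb: "bij \<tau>" unfolding \<tau>_def by (intro bij_comp permutes_bij[OF s(1)] permutes_bij[OF permutes_inv[OF gp]])
      have "\<tau> i = i" if "i \<notin> {1..d}" for i
        using grassmannian_unique[OF g(1) s(1) dn g(2)[symmetric] incr that] permutes_inverses(2)[OF gp]
        by (simp add: \<tau>_def)
      then have t: "\<tau> permutes {1..d}" using tb by (auto simp: permutes_def bij_def) (metis tb bij_pointE)+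
      have "DES d \<tau> \<subseteq> T - {d}" using compose_grassmannian(4)[OF dn g(1) t] s(2) unfolding gt by blast
      then show "\<sigma> \<in> (\<lambda>(g, \<tau>). g \<circ> \<tau>) ` (grassmannian n d \<times> ?Q)"
        using g(1) t gt by (intro image_eqI[of _ _ "(g, \<tau>)"]) auto
    qed
  qed
  have "descent_gf q n T = (\<Sum>(g, \<tau>)\<in>grassmannian n d \<times> ?Q. q ^ inv_num n (g \<circ> \<tau>))"
    unfolding descent_gf_def im[symmetric] sum.reindex[OF inj] by (simp add: case_prod_unfold)
  also have "\<dots> = (\<Sum>(g, \<tau>)\<in>grassmannian n d \<times> ?Q. q ^ inv_num n g * q ^ inv_num d \<tau>)"
    by (rule sum.cong) (auto simp: compose_grassmannian(2)[OF dn] power_add)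
  also have "\<dots> = (\<Sum>g\<in>grassmannian n d. q ^ inv_num n g) * (\<Sum>\<tau>\<in>?Q. q ^ inv_num d \<tau>)"
    by (simp add: sum_product sum.cartesian_product)
  finally show ?thesis by (simp add: sum_grassmannian[OF dn] descent_gf_def)
qed

lemma descent_gf_inclusion_exclusion:
  assumes "finite S"
  shows "(\<Sum>T\<in>Pow S. (-1) ^ card T * descent_gf q n T) =
    (-1) ^ card S * (\<Sum>\<sigma> | \<sigma> permutes {1..n} \<and> DES n \<sigma> = S. q ^ inv_num n \<sigma>)"
proof (rule inclusion_exclusion_symmetric[symmetric, OF _ assms])
  fix T :: "nat set" assume T: "finite T"
  have "descent_gf q n T = (\<Sum>D\<in>Pow T. \<Sum>\<sigma>\<in>{\<sigma> \<in> {\<sigma>. \<sigma> permutes {1..n} \<and> DES n \<sigma> \<subseteq> T}. DES n \<sigma> = D}. q ^ inv_num n \<sigma>)"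
    unfolding descent_gf_def
    by (rule sum.group[symmetric]) (use T in \<open>auto simp: finite_permutations\<close>)
  also have "\<dots> = (\<Sum>D\<in>Pow T. (-1) ^ card D * ((-1) ^ card D * (\<Sum>\<sigma> | \<sigma> permutes {1..n} \<and> DES n \<sigma> = D. q ^ inv_num n \<sigma>)))"
  proof (rule sum.cong[OF refl])
    fix D assume "D \<in> Pow T"
    then have "{\<sigma> \<in> {\<sigma>. \<sigma> permutes {1..n} \<and> DES n \<sigma> \<subseteq> T}. DES n \<sigma> = D} = {\<sigma>. \<sigma> permutes {1..n} \<and> DES n \<sigma> = D}"
      by auto
    moreover have "(-1::int) ^ card D * ((-1) ^ card D * x) = x" for x
      by (simp add: mult.assoc[symmetric] power_mult_distrib[symmetric])
    ultimately show "(\<Sum>\<sigma>\<in>{\<sigma> \<in> {\<sigma>. \<sigma> permutes {1..n} \<and> DES n \<sigma> \<subseteq> T}. DES n \<sigma> = D}. q ^ inv_num n \<sigma>) =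
        (-1) ^ card D * ((-1) ^ card D * (\<Sum>\<sigma> | \<sigma> permutes {1..n} \<and> DES n \<sigma> = D. q ^ inv_num n \<sigma>))"
      by simp
  qed
  finally show "descent_gf q n T = (\<Sum>D\<in>Pow T. (-1) ^ card D * ((-1) ^ card D *
      (\<Sum>\<sigma> | \<sigma> permutes {1..n} \<and> DES n \<sigma> = D. q ^ inv_num n \<sigma>)))" .
qed

section \<open>A functional on chain monomials\<close>

text \<open>
The geometry truncated to rank \<open>r\<close>: a subspace is a flat if it has dimension less than \<open>r\<close> or is the
whole space. Monomials in the variables \<open>x_F\<close>, for \<open>F\<close> in the set \<open>L\<close> of nonempty flats, are
represented by their exponent functions.
\<close>

locale truncation = geometry +
  fixes r :: nat
  assumes r_ge_1: "1 \<le> r" and r_le: "r \<le> dm E"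
begin

definition L :: "'a set set" where
  "L = {F \<in> P. F \<noteq> {} \<and> (F = E \<or> dm F < r)}"

definition supp :: "('a set \<Rightarrow> nat) \<Rightarrow> 'a set set" where
  "supp e = {F \<in> L. 0 < e F}"

definition is_chain :: "('a set \<Rightarrow> nat) \<Rightarrow> bool" where
  "is_chain e \<longleftrightarrow> (\<forall>F\<in>supp e. \<forall>G\<in>supp e. F \<subseteq> G \<or> G \<subseteq> F)"

definition below :: "('a set \<Rightarrow> nat) \<Rightarrow> 'a set \<Rightarrow> 'a set set" where
  "below e U = {F \<in> supp e. F \<subset> U}"

abbreviation bump :: "('a set \<Rightarrow> nat) \<Rightarrow> 'a set \<Rightarrow> 'a set \<Rightarrow> nat" where
  "bump e G \<equiv> e(G := Suc (e G))"

text \<open>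
The contribution of a flat to the degree of a chain monomial, where \<open>a\<close> is its exponent, \<open>m\<close> its
codimension in the next larger flat of the chain (or in \<open>E\<close>), and \<open>\<rho>\<close> the rank still available in the
interval between the two. It is the number \<open>(a - 1) choose (\<rho> - 1)\<close> times the last coefficient
of the reduced characteristic polynomial, up to sign, of the truncation to rank \<open>\<rho>\<close> of an
\<open>m\<close>-dimensional geometry.
\<close>

definition degree_factor :: "nat \<Rightarrow> int \<Rightarrow> nat \<Rightarrow> int" where
  "degree_factor m \<rho> a = (if \<rho> \<ge> 1 then int ((a - 1) choose (nat \<rho> - 1)) * int q ^ (nat \<rho> choose 2) *
     qbinom (int q) (m - 1) (nat \<rho> - 1) else 0)"

text \<open>
The product of these contributions over the flats of the chain below \<open>U\<close>, from the top down. The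
state \<open>s\<close> is the rank of the truncation of \<open>U\<close> that is left: every factor of the monomial truncates
once, so \<open>s\<close> decreases by the exponent of the flat that is passed. The monomial has the right
degree exactly if the state ends at \<open>b\<close>, which is \<open>1 - \<epsilon>\<close>. The state is an integer because it may
become negative, in which case the contributions vanish.
\<close>

function degree_below :: "int \<Rightarrow> ('a set \<Rightarrow> nat) \<Rightarrow> 'a set \<Rightarrow> int \<Rightarrow> int" where
  "degree_below b e U s =
     (if below e U = {} then (if s = b then 1 else 0)
      else let F = \<Union>(below e U) in
        if F \<in> below e U \<and> finite U then (-1) ^ (e F - 1) * degree_factor (dm U - dm F) (s - int (dm F)) (e F) *
          degree_below b e F (s - int (e F)) else 0)"
  by pat_completeness auto
termination by (relation "measure (\<lambda>(b, e, U, s). card U)") (auto simp: below_def intro: psubset_card_mono)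

declare degree_below.simps [simp del]

lemma L_P: "F \<in> L \<Longrightarrow> F \<in> P" by (simp add: L_def)

lemma finite_L: "finite L"
  using finite_P by (auto simp: L_def)

lemma finite_supp: "finite (supp e)"
  using finite_L by (auto simp: supp_def)

lemma E_L: "E \<in> L"
  using E_in r_ge_1 r_le by (auto simp: L_def)

lemma below_L: "F \<in> below e U \<Longrightarrow> F \<in> L \<and> F \<subset> U \<and> 0 < e F"
  by (auto simp: below_def supp_def)

lemma finite_chain_top:
  assumes "finite A" "A \<noteq> {}" "\<forall>F\<in>A. \<forall>G\<in>A. F \<subseteq> G \<or> G \<subseteq> F"
  obtains T where "T \<in> A" "\<And>G. G \<in> A \<Longrightarrow> G \<subseteq> T"
proof -
  have "\<exists>T\<in>A. \<forall>G\<in>A. G \<subseteq> T" using assms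
  proof (induction rule: finite_ne_induct)
    case (insert x F)
    then obtain T where "T \<in> F" "\<forall>G\<in>F. G \<subseteq> T" by auto
    have "x \<subseteq> T \<or> T \<subseteq> x" using insert.prems \<open>T \<in> F\<close> by simp
    then show ?case
    proof
      assume "x \<subseteq> T"
      then show ?thesis using \<open>T \<in> F\<close> \<open>\<forall>G\<in>F. G \<subseteq> T\<close> by (intro bexI[of _ T]) auto
    next
      assume "T \<subseteq> x"
      then show ?thesis using \<open>\<forall>G\<in>F. G \<subseteq> T\<close> by (intro bexI[of _ x]) auto
    qed
  qed auto
  then show ?thesis using that by blast
qed

lemma chain_below_top:
  assumes "is_chain e" "below e U \<noteq> {}"
  obtains T where "T \<in> below e U" "\<And>G. G \<in> below e U \<Longrightarrow> G \<subseteq> T"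
  using assms finite_chain_top[of "below e U"] finite_supp[of e]
  by (metis (mono_tags, lifting) below_def is_chain_def mem_Collect_eq rev_finite_subset subsetI)

lemma degree_below_empty: "below e U = {} \<Longrightarrow> degree_below b e U s = (if s = b then 1 else 0)"
  by (simp add: degree_below.simps)

lemma degree_below_top:
  assumes "U \<in> P" "F \<in> below e U" "\<And>G. G \<in> below e U \<Longrightarrow> G \<subseteq> F"
  shows "degree_below b e U s = (-1) ^ (e F - 1) * degree_factor (dm U - dm F) (s - int (dm F)) (e F) *
          degree_below b e F (s - int (e F))"
proof -
  have "\<Union>(below e U) = F" using assms(2,3) by blast
  then show ?thesis using assms finite_in_P[OF assms(1)] below_L[OF assms(2)]
    by (subst degree_below.simps) (auto simp: Let_def)
qed

lemma below_cong: "(\<And>F. F \<in> L \<Longrightarrow> F \<subset> U \<Longrightarrow> e F = e' F) \<Longrightarrow> below e U = below e' U"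
  unfolding below_def supp_def by (intro Collect_cong) (metis (mono_tags, lifting) mem_Collect_eq)

lemma degree_below_cong:
  assumes "U \<in> P" "\<And>F. F \<in> L \<Longrightarrow> F \<subset> U \<Longrightarrow> e F = e' F"
  shows "degree_below b e U s = degree_below b e' U s"
  using assms
proof (induction "card U" arbitrary: U s rule: less_induct)
  case less
  have eq: "below e U = below e' U" by (rule below_cong) (rule less.prems)
  let ?F = "\<Union>(below e U)"
  show ?case
  proof (cases "below e U = {}")
    case True
    then show ?thesis using eq by (simp add: degree_below_empty)
  next
    case False
    show ?thesis
    proof (cases "?F \<in> below e U")
      case True
      then have F: "?F \<subset> U" "?F \<in> L" by (auto dest: below_L)
      have "degree_below b e ?F t = degree_below b e' ?F t" for t
        using F less.prems finite_in_P[OF less.prems(1)]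
        by (intro less.hyps) (auto intro: psubset_card_mono L_P)
      moreover have "e ?F = e' ?F" using less.prems(2) F by blast
      ultimately show ?thesis using eq by (subst (1 2) degree_below.simps) (simp add: Let_def)
    next
      case False
      then show ?thesis using eq \<open>below e U \<noteq> {}\<close> by (subst (1 2) degree_below.simps) (simp add: Let_def)
    qed
  qed
qed

lemma degree_factor_exponent_1: "degree_factor m \<rho> 1 = (if \<rho> = 1 then 1 else 0)"
proof (cases "\<rho> \<ge> 2")
  case True
  then have "nat \<rho> - 1 \<noteq> 0" by simp
  then show ?thesis using True by (simp add: degree_factor_def binomial_eq_0)
qed (auto simp: degree_factor_def binomial_eq_0)

lemma degree_factor_eq_0: "\<rho> \<le> 0 \<Longrightarrow> degree_factor m \<rho> a = 0"
  by (simp add: degree_factor_def)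

lemma degree_factor_nonzero:
  assumes "degree_factor m \<rho> a \<noteq> 0" "1 \<le> a" shows "1 \<le> \<rho>" "\<rho> \<le> int a"
proof -
  show 1: "1 \<le> \<rho>" using assms by (metis degree_factor_eq_0 int_one_le_iff_zero_less not_le)
  show "\<rho> \<le> int a"
  proof (rule ccontr)
    assume "\<not> ?thesis"
    then have "(a - 1) choose (nat \<rho> - 1) = 0" using assms(2) by (intro binomial_eq_0) linarith
    then show False using assms(1) 1 by (simp add: degree_factor_def)
  qed
qed

lemma degree_factor_rank_1: "degree_factor m 1 a = 1"
  by (simp add: degree_factor_def binomial_eq_0)

text \<open>
The one step of the telescoping. From left to right the terms stand for a new flat inserted just above the
given flat, for a variable inserted further up, and for a higher exponent of the given flat
itself. All of it amounts to a variable inserted further up, as seen from the next gap of the chain.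
The proof is the Pascal rule, for Gaussian binomials and for ordinary ones.
\<close>

lemma degree_factor_telescope:
  assumes "1 \<le> a" "k \<le> m"
  shows "qbinom (int q) (Suc m) k * degree_factor k (int k) a - degree_factor (Suc m) (int k) a + degree_factor (Suc m) (int k + 1) (Suc a) * -1
       = - degree_factor (Suc m) (int k + 1) a"
proof (cases k)
  case 0
  then show ?thesis using assms by (simp add: degree_factor_def)
next
  case (Suc j)
  obtain c where a: "a = Suc c" using assms by (cases a) auto
  have n1: "nat (int k + 1) = Suc k" by simp
  have ch: "Suc k choose 2 = k + (k choose 2)"
    by (simp add: numeral_2_eq_2)
  have pas: "qbinom (int q) (Suc m) k = qbinom (int q) m j + int q ^ k * qbinom (int q) m k"
    using Suc by simp
  have "(Suc c choose k) = (c choose j) + (c choose k)" using Suc by simp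
  moreover have "(1::int) \<le> int k" "nat (int k) = k" "k - 1 = j" using Suc by auto
  moreover have "qbinom (int q) (k - 1) (k - 1) = 1" by (rule qbinom_self)
  ultimately show ?thesis unfolding degree_factor_def n1 ch pas a by (simp add: algebra_simps power_add)
qed

text \<open>
The last step, in the gap where the vector \<open>i\<close> first appears: the new flat must now contain \<open>i\<close>, and
there the contributions cancel.
\<close>

lemma degree_factor_telescope_through:
  assumes "1 \<le> k"
  shows "qbinom (int q) m (k - 1) * degree_factor k (int k) a = degree_factor (Suc m) (int k) a"
  using assms by (simp add: degree_factor_def)

lemma card_gap:
  assumes "W \<in> P" "U \<in> P" "W \<subseteq> U" "1 \<le> k" "dm W + k < dm U" "dm W + k < r"
  shows "int (card {G \<in> L. W \<subset> G \<and> G \<subset> U \<and> dm G = dm W + k}) = qbinom (int q) (dm U - dm W) k"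
    and "i \<in> U \<Longrightarrow> i \<notin> W \<Longrightarrow>
      int (card {G \<in> L. W \<subset> G \<and> i \<in> G \<and> G \<subset> U \<and> dm G = dm W + k}) = qbinom (int q) (dm U - dm W - 1) (k - 1)"
proof -
  have "(G \<in> L \<and> W \<subset> G \<and> G \<subset> U \<and> dm G = dm W + k) = (G \<in> P \<and> W \<subseteq> G \<and> G \<subseteq> U \<and> dm G = dm W + k)" for G
    using assms by (auto simp: L_def)
  note eq = this
  show "int (card {G \<in> L. W \<subset> G \<and> G \<subset> U \<and> dm G = dm W + k}) = qbinom (int q) (dm U - dm W) k"
    unfolding eq using card_between[OF assms(1-3)] by simp
  assume i: "i \<in> U" "i \<notin> W"
  have "{G \<in> L. W \<subset> G \<and> i \<in> G \<and> G \<subset> U \<and> dm G = dm W + k} =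
    {G \<in> P. W \<subseteq> G \<and> i \<in> G \<and> G \<subseteq> U \<and> dm G = dm W + Suc (k - 1)}"
    using eq assms(4) by auto
  then show "int (card {G \<in> L. W \<subset> G \<and> i \<in> G \<and> G \<subset> U \<and> dm G = dm W + k}) = qbinom (int q) (dm U - dm W - 1) (k - 1)"
    using card_between_through[OF assms(1-3) i, of "k - 1"] by simp
qed

lemma split_set:
  "(\<And>x. x \<in> A \<Longrightarrow> x \<in> B \<or> x = y \<or> x \<in> C) \<Longrightarrow> (\<And>x. x \<in> B \<Longrightarrow> x \<in> A) \<Longrightarrow>
   (\<And>x. x \<in> C \<Longrightarrow> x \<in> A) \<Longrightarrow> y \<in> A \<Longrightarrow> A = B \<union> ({y} \<union> C)"
  by blast

text \<open>
With exponent one, a new top flat contributes only if it uses up the available rank, that is, if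
its dimension is exactly \<open>s - 1\<close>.
\<close>

lemma degree_below_shift_one:
  assumes U: "U \<in> P" and G: "G \<in> L" "G \<subset> U" and top: "\<And>F. F \<in> below e U \<Longrightarrow> F \<subset> G"
  shows "degree_below b (bump e G) U s = (if int (dm G) = s - 1 then degree_below b e G (s - 1) else 0)"
proof -
  have "e G = 0"
  proof (rule ccontr)
    assume "e G \<noteq> 0"
    then have "G \<in> below e U" using G by (auto simp: below_def supp_def)
    then show False using top by blast
  qed
  have mem: "G \<in> below (bump e G) U" using G by (auto simp: below_def supp_def)
  have top': "F \<subseteq> G" if "F \<in> below (bump e G) U" for F
  proof (cases "F = G")
    case False
    then have "F \<in> below e U" using that by (auto simp: below_def supp_def)
    then show ?thesis using top by blast
  qed auto
  have "degree_below b (bump e G) G t = degree_below b e G t" for t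
    by (rule degree_below_cong) (use G L_P in auto)
  then show ?thesis using degree_below_top[OF U mem top'] \<open>e G = 0\<close> degree_factor_exponent_1[of _ "s - int (dm G)"]
    by auto
qed

text \<open>
The core of the argument: the sum of the \<open>x_G\<close> with \<open>i \<in> G\<close>, multiplied by a chain monomial. The
subtracted term stands for a variable inserted above \<open>U\<close>, so the left side is what remains to be
cancelled below \<open>U\<close>. Going down the chain, each flat that contains \<open>i\<close> passes the remainder on
unchanged up to its own factor, and the first flat that misses \<open>i\<close> makes it vanish. If no flat
misses \<open>i\<close>, the remainder reaches the bottom, where for \<open>b = 1\<close> it cancels against the single line through
\<open>i\<close> and for \<open>b = 0\<close> nothing is left to cancel it.
\<close>

lemma insertion_sum:
  assumes "is_chain e" "U \<in> P" "i \<in> U" "s \<le> int (dm U)" "s \<le> int r" "b = 0 \<or> b = 1"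
  shows "(\<Sum>G | G \<in> L \<and> i \<in> G \<and> G \<subset> U \<and> (\<forall>F\<in>below e U. F \<subseteq> G \<or> G \<subseteq> F). degree_below b (bump e G) U s)
     - degree_below b e U (s - 1) = (if b = 1 \<or> (\<exists>F\<in>below e U. i \<notin> F) then 0 else - degree_below 1 e U s)"
  using assms(2-5)
proof (induction "card U" arbitrary: U s rule: less_induct)
  case less
  note U = less.prems(1) and i = less.prems(2)
  let ?C = "\<lambda>U. {G. G \<in> L \<and> i \<in> G \<and> G \<subset> U \<and> (\<forall>F\<in>below e U. F \<subseteq> G \<or> G \<subseteq> F)}"
  have finC: "finite (?C U)" for U using finite_L by auto
  show ?case
  proof (cases "below e U = {}")
    case True
    have "degree_below b (bump e G) U s = (if int (dm G) = s - 1 then (if s - 1 = b then 1 else 0) else 0)" if "G \<in> ?C U" for G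
    proof -
      have "below e G = {}" using True that by (auto simp: below_def)
      then show ?thesis using that degree_below_shift_one[OF U, of G e b s] True by (simp add: degree_below_empty)
    qed
    then have "(\<Sum>G\<in>?C U. degree_below b (bump e G) U s) = (\<Sum>G\<in>?C U. if int (dm G) = s - 1 then (if s - 1 = b then 1 else 0) else 0)"
      by (rule sum.cong[OF refl])
    also have "\<dots> = (if s - 1 = b then int (card {G \<in> ?C U. int (dm G) = s - 1}) else 0)"
      using sum_indicator[OF finC[of U], of "\<lambda>G. int (dm G) = s - 1"] by auto
    also have "\<dots> = (if b = 1 \<and> s = 2 then 1 else 0)"
    proof -
      define K where "K = {G \<in> ?C U. int (dm G) = s - 1}"
      have "dm G \<noteq> 0" if "G \<in> L" for G using that dm_eq_0_iff[of G] by (auto simp: L_def)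
      then have "K = {}" if "s = 1"
        using that by (auto simp: K_def)
      moreover have "int (card K) = 1" if "s = 2"
      proof -
        have "K = {G \<in> L. {} \<subset> G \<and> i \<in> G \<and> G \<subset> U \<and> dm G = dm {} + 1}"
          using that True by (auto simp: K_def)
        moreover have "int (card \<dots>) = qbinom (int q) (dm U - dm {} - 1) (1 - 1)"
          by (rule card_gap(2)) (use U i that less.prems empty_in in auto)
        ultimately show ?thesis by simp
      qed
      ultimately show ?thesis using \<open>b = 0 \<or> b = 1\<close> unfolding K_def[symmetric] by auto
    qed
    finally show ?thesis using True \<open>b = 0 \<or> b = 1\<close> by (auto simp: degree_below_empty)
  next
    case False
    then obtain F where F: "F \<in> below e U" and top: "\<And>G. G \<in> below e U \<Longrightarrow> G \<subseteq> F"
      using chain_below_top[OF assms(1)] by metis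
    have FL: "F \<in> L" "F \<subset> U" "0 < e F" "F \<in> P" using below_L[OF F] L_P by auto
    define a where "a = e F"
    define \<rho> where "\<rho> = s - int (dm F)"
    define Z where "Z = degree_below b e F (s - 1 - int a)"
    define sg where "sg = (-1::int) ^ (a - 1)"
    define m where "m = dm U - dm F"
    have a1: "1 \<le> a" using FL by (simp add: a_def)
    have dmF: "dm F < dm U" using dm_strict_mono[OF FL(4) U FL(2)] .
    have below_F: "below e F = below e U - {F}"
      using FL(2) top by (auto simp: below_def)
    have above: "degree_below b e U (s - 1) = sg * degree_factor m (\<rho> - 1) a * Z"
      using degree_below_top[OF U F top, of b "s - 1"] by (simp add: sg_def a_def m_def \<rho>_def Z_def algebra_simps)
    have one: "degree_below b' e U s = sg * degree_factor m \<rho> a * degree_below b' e F (s - int a)" for b'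
      using degree_below_top[OF U F top, of b' "s"] by (simp add: sg_def a_def m_def \<rho>_def)
    let ?up = "{G. G \<in> L \<and> F \<subset> G \<and> i \<in> G \<and> G \<subset> U}"
    have "degree_below b (bump e G) U s = (if int (dm G) = s - 1 then sg * degree_factor (nat (\<rho> - 1)) (\<rho> - 1) a * Z else 0)"
      if "G \<in> ?up" for G
    proof -
      have G: "G \<in> L" "F \<subset> G" "G \<subset> U" using that by auto
      have bG: "below e G = below e U" using G top by (auto simp: below_def)
      have "degree_below b e G (s - 1) = (-1) ^ (e F - 1) * degree_factor (dm G - dm F) (s - 1 - int (dm F)) (e F) *
          degree_below b e F (s - 1 - int (e F))"
        by (rule degree_below_top) (use G L_P F top bG in auto)
      moreover have "dm G - dm F = nat (\<rho> - 1)" if "int (dm G) = s - 1"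
        using that by (simp add: \<rho>_def)
      ultimately have "degree_below b e G (s - 1) = sg * degree_factor (nat (\<rho> - 1)) (\<rho> - 1) a * Z" if "int (dm G) = s - 1"
        using that by (simp add: sg_def a_def \<rho>_def Z_def algebra_simps)
      then show ?thesis using degree_below_shift_one[OF U G(1,3), of e b s] top G(2) by (metis psubset_subset_trans subset_psubset_trans)
    qed
    then have "(\<Sum>G\<in>?up. degree_below b (bump e G) U s) =
       (\<Sum>G\<in>?up. if int (dm G) = s - 1 then sg * degree_factor (nat (\<rho> - 1)) (\<rho> - 1) a * Z else 0)"
      by (rule sum.cong[OF refl])
    also have "\<dots> = int (card {G \<in> ?up. int (dm G) = s - 1}) * (sg * degree_factor (nat (\<rho> - 1)) (\<rho> - 1) a * Z)"
      using finite_L by (simp add: sum.If_cases Int_def)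
    finally have up: "(\<Sum>G\<in>?up. degree_below b (bump e G) U s) = int (card {G \<in> ?up. int (dm G) = s - 1}) *
        (sg * degree_factor (nat (\<rho> - 1)) (\<rho> - 1) a * Z)" .
    show ?thesis
    proof (cases "i \<in> F")
      case False
      have "?C U = ?up" using F False top by auto
      moreover have "(\<Sum>G\<in>?up. degree_below b (bump e G) U s) = degree_below b e U (s - 1)"
      proof (cases "2 \<le> \<rho>")
        case True
        define k where "k = nat (\<rho> - 1)"
        have k: "\<rho> - 1 = int k" "1 \<le> k" using True by (auto simp: k_def)
        have "{G \<in> ?up. int (dm G) = s - 1} = {G \<in> L. F \<subset> G \<and> i \<in> G \<and> G \<subset> U \<and> dm G = dm F + k}"
          using k \<rho>_def by auto
        moreover have "int (card \<dots>) = qbinom (int q) (dm U - dm F - 1) (k - 1)"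
          by (rule card_gap(2)) (use FL U i False k \<rho>_def less.prems in auto)
        ultimately have "int (card {G \<in> ?up. int (dm G) = s - 1}) = qbinom (int q) (m - 1) (k - 1)"
          by (simp add: m_def)
        moreover have "m = Suc (m - 1)" using dmF by (simp add: m_def)
        ultimately show ?thesis unfolding up above
          using degree_factor_telescope_through[OF k(2), of "m - 1" a] k(1) by (simp add: algebra_simps)
      next
        case False
        then show ?thesis unfolding up above by (simp add: degree_factor_eq_0)
      qed
      ultimately show ?thesis using F False by auto
    next
      case True
      have split: "?C U = ?C F \<union> ({F} \<union> ?up)"
      proof (rule split_set)
        show "G \<in> ?C F \<or> G = F \<or> G \<in> ?up" if "G \<in> ?C U" for G
          using that F below_F by blast
        show "G \<in> ?C U" if "G \<in> ?C F" for G
          using that below_F FL by auto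
        show "G \<in> ?C U" if "G \<in> ?up" for G
          using that top by blast
        show "F \<in> ?C U" using FL True top by auto
      qed
      have disj: "?C F \<inter> ({F} \<union> ?up) = {}" and notup: "F \<notin> ?up" by auto
      have total: "(\<Sum>G\<in>?C U. degree_below b (bump e G) U s) = (\<Sum>G\<in>?C F. degree_below b (bump e G) U s) +
          (degree_below b (bump e F) U s + (\<Sum>G\<in>?up. degree_below b (bump e G) U s))"
        unfolding split using finite_L
        by (subst sum.union_disjoint[OF _ _ disj]) (simp_all add: notup)
      have at_F: "degree_below b (bump e F) U s = - sg * degree_factor m \<rho> (Suc a) * Z"
      proof -
        have b1: "below (bump e F) U = below e U" using FL by (auto simp: below_def supp_def)
        have "degree_below b (bump e F) U s = (-1) ^ (bump e F F - 1) * degree_factor (dm U - dm F) (s - int (dm F)) (bump e F F) *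
          degree_below b (bump e F) F (s - int (bump e F F))"
          by (rule degree_below_top) (use U F top b1 in auto)
        moreover have "degree_below b (bump e F) F t = degree_below b e F t" for t
          by (rule degree_below_cong) (use FL in auto)
        moreover have "(-1::int) ^ a = - sg" using a1 by (cases a) (auto simp: sg_def)
        ultimately show ?thesis by (simp add: a_def m_def \<rho>_def Z_def algebra_simps)
      qed
      have "(\<Sum>G\<in>?C F. degree_below b (bump e G) U s) = sg * degree_factor m \<rho> a * (\<Sum>G\<in>?C F. degree_below b (bump e G) F (s - int a))"
        unfolding sum_distrib_left
      proof (rule sum.cong[OF refl])
        fix G assume G: "G \<in> ?C F"
        have top': "H \<subseteq> F" if "H \<in> below (bump e G) U" for H
        proof (cases "H = G")
          case False
          then have "H \<in> below e U" using that by (auto simp: below_def supp_def)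
          then show ?thesis by (rule top)
        qed (use G in auto)
        have FG: "F \<in> below (bump e G) U" using FL G by (auto simp: below_def supp_def)
        have ne: "F \<noteq> G" using G by auto
        show "degree_below b (bump e G) U s = sg * degree_factor m \<rho> a * degree_below b (bump e G) F (s - int a)"
          using degree_below_top[OF U FG top'] ne by (simp add: sg_def m_def \<rho>_def a_def)
      qed
      also have "\<dots> = sg * degree_factor m \<rho> a * (Z + (if b = 1 \<or> (\<exists>F'\<in>below e F. i \<notin> F') then 0 else - degree_below 1 e F (s - int a)))"
      proof (cases "degree_factor m \<rho> a = 0")
        case False
        have "card F < card U" using FL(2) finite_in_P[OF U] by (rule psubset_card_mono[rotated])
        moreover have "s - int a \<le> int (dm F)" using degree_factor_nonzero[OF False a1] by (simp add: \<rho>_def)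
        ultimately show ?thesis using less.hyps[of F "s - int a"] FL(4) True less.prems(4)
          by (simp add: Z_def algebra_simps)
      qed simp
      also have "(\<exists>F'\<in>below e F. i \<notin> F') \<longleftrightarrow> (\<exists>F'\<in>below e U. i \<notin> F')"
        using below_F True by auto
      finally have lower: "(\<Sum>G\<in>?C F. degree_below b (bump e G) U s) = sg * degree_factor m \<rho> a *
          (Z + (if b = 1 \<or> (\<exists>F'\<in>below e U. i \<notin> F') then 0 else - degree_below 1 e F (s - int a)))" .
      have cancel: "sg * degree_factor m \<rho> a * Z + (- sg * degree_factor m \<rho> (Suc a) * Z + int (card {G \<in> ?up. int (dm G) = s - 1}) *
        (sg * degree_factor (nat (\<rho> - 1)) (\<rho> - 1) a * Z)) - sg * degree_factor m (\<rho> - 1) a * Z = 0"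
      proof (cases "1 \<le> \<rho>")
        case True
        define k where "k = nat (\<rho> - 1)"
        have k: "\<rho> = int k + 1" using True by (auto simp: k_def)
        have m: "m = Suc (m - 1)" using dmF by (simp add: m_def)
        have "int (card {G \<in> ?up. int (dm G) = s - 1}) * degree_factor k (int k) a = qbinom (int q) m k * degree_factor k (int k) a"
        proof (cases "k = 0")
          case False
          have "{G \<in> ?up. int (dm G) = s - 1} = {G \<in> L. F \<subset> G \<and> G \<subset> U \<and> dm G = dm F + k}"
            using k \<rho>_def \<open>i \<in> F\<close> by auto
          moreover have "int (card \<dots>) = qbinom (int q) (dm U - dm F) k"
            by (rule card_gap(1)) (use FL U i False k \<rho>_def less.prems in auto)
          ultimately show ?thesis by (simp add: m_def)
        qed (simp add: degree_factor_eq_0)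
        moreover have "k \<le> m - 1" using k \<rho>_def less.prems(3) by (simp add: m_def)
        moreover define N where "N = int (card {G \<in> ?up. int (dm G) = s - 1})"
        ultimately have "degree_factor m \<rho> a - degree_factor m \<rho> (Suc a) + int (card {G \<in> ?up. int (dm G) = s - 1}) *
           degree_factor (nat (\<rho> - 1)) (\<rho> - 1) a - degree_factor m (\<rho> - 1) a = 0"
          using degree_factor_telescope[OF a1, of k "m - 1"] m k unfolding N_def[symmetric]
          by (auto simp: algebra_simps)
        then have "sg * Z * (degree_factor m \<rho> a - degree_factor m \<rho> (Suc a) + int (card {G \<in> ?up. int (dm G) = s - 1}) *
           degree_factor (nat (\<rho> - 1)) (\<rho> - 1) a - degree_factor m (\<rho> - 1) a) = 0" by simp
        then show ?thesis by (simp add: algebra_simps)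
      qed (simp add: degree_factor_eq_0)
      have "(\<Sum>G\<in>?C U. degree_below b (bump e G) U s) - degree_below b e U (s - 1) = sg * degree_factor m \<rho> a *
          (if b = 1 \<or> (\<exists>F'\<in>below e U. i \<notin> F') then 0 else - degree_below 1 e F (s - int a))"
        unfolding total lower at_F up above using cancel unfolding distrib_left by linarith
      then show ?thesis unfolding one by simp
    qed
  qed
qed

end

section \<open>The pairing of admissible monomials with their duals\<close>

context truncation begin

definition rk :: "'a set \<Rightarrow> nat" where
  "rk F = (if F = E then r else dm F)"

text \<open>
The degree of a chain monomial. The top flat \<open>E\<close> is treated separately because \<open>- x_E\<close> acts as plain
truncation.
\<close>

definition deg_mon :: "int \<Rightarrow> ('a set \<Rightarrow> nat) \<Rightarrow> int" where
  "deg_mon b e = (if is_chain e then (-1) ^ e E * degree_below b e E (int r - int (e E)) else 0)"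

lemma L_sub_E: "F \<in> L \<Longrightarrow> F \<subseteq> E"
  using L_P P_sub by blast

lemma L_proper: "F \<in> L \<Longrightarrow> F \<noteq> E \<Longrightarrow> F \<subset> E \<and> rk F = dm F \<and> dm F < r \<and> 0 < dm F"
  using L_sub_E dm_eq_0_iff[of F] by (auto simp: L_def rk_def)

lemma rk_le_r: "F \<in> L \<Longrightarrow> rk F \<le> r"
  using L_proper[of F] by (cases "F = E") (auto simp: rk_def)

lemma rk_pos: "F \<in> L \<Longrightarrow> 0 < rk F"
  using L_proper[of F] r_ge_1 by (cases "F = E") (auto simp: rk_def)

lemma rk_strict_mono: "F \<in> L \<Longrightarrow> G \<in> L \<Longrightarrow> F \<subset> G \<Longrightarrow> rk F < rk G"
proof -
  assume FG: "F \<in> L" "G \<in> L" "F \<subset> G"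
  then have "F \<noteq> E" using L_sub_E[of G] by auto
  then show ?thesis using FG L_proper[of F] L_proper[of G] dm_strict_mono[of F G] L_P
    by (cases "G = E") (auto simp: rk_def)
qed

lemma supp_bump: "G \<in> L \<Longrightarrow> supp (bump e G) = insert G (supp e)"
  by (auto simp: supp_def)

lemma is_chain_bump:
  "G \<in> L \<Longrightarrow> is_chain (bump e G) \<longleftrightarrow> is_chain e \<and> (\<forall>F\<in>supp e. F \<subseteq> G \<or> G \<subseteq> F)"
  by (simp only: is_chain_def supp_bump ball_simps ball_conj_distrib order_refl simp_thms)
    (rule iffI; (elim conjE)?; (intro conjI)?; simp add: disj_commute)

text \<open>
For \<open>b = 1\<close> this says that the functional respects \<open>h_i = 0\<close>. For \<open>b = 0\<close> it says that it respects
\<open>x_F h_i = 0\<close> for \<open>i \<notin> F\<close>, and that multiplying by \<open>h_i\<close> turns it into minus the functional for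
\<open>b = 1\<close>; so a second factor \<open>h_i\<close> kills it.
\<close>

lemma deg_mon_linear_relation:
  assumes "i \<in> E" "b = 0 \<or> b = 1"
  shows "(\<Sum>G | G \<in> L \<and> i \<in> G. deg_mon b (bump e G)) =
    (if b = 1 \<or> (\<exists>F\<in>supp e. i \<notin> F) then 0 else - deg_mon 1 e)"
proof (cases "is_chain e")
  case False
  then show ?thesis by (simp add: deg_mon_def is_chain_bump)
next
  case True
  define s where "s = int r - int (e E)"
  have be: "below e E = supp e - {E}"
    using L_sub_E by (auto simp: below_def supp_def)
  let ?A = "{G. G \<in> L \<and> i \<in> G \<and> G \<subset> E \<and> (\<forall>F\<in>below e E. F \<subseteq> G \<or> G \<subseteq> F)}"
  have fin: "finite {G. G \<in> L \<and> i \<in> G}" using finite_L by auto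
  have sub: "insert E ?A \<subseteq> {G. G \<in> L \<and> i \<in> G}" using E_L assms by auto
  have "(\<Sum>G | G \<in> L \<and> i \<in> G. deg_mon b (bump e G)) = (\<Sum>G\<in>insert E ?A. deg_mon b (bump e G))"
  proof (rule sum.mono_neutral_right[OF fin sub])
    show "\<forall>G\<in>{G. G \<in> L \<and> i \<in> G} - insert E ?A. deg_mon b (bump e G) = 0"
    proof
      fix G assume G: "G \<in> {G. G \<in> L \<and> i \<in> G} - insert E ?A"
      then have GL: "G \<in> L" "G \<subset> E" using L_sub_E by auto
      then obtain F where "F \<in> below e E" "\<not> F \<subseteq> G" "\<not> G \<subseteq> F" using G by auto
      then have "\<not> is_chain (bump e G)" using GL by (auto simp: is_chain_bump be)
      then show "deg_mon b (bump e G) = 0" by (simp add: deg_mon_def)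
    qed
  qed
  also have "\<dots> = deg_mon b (bump e E) + (\<Sum>G\<in>?A. deg_mon b (bump e G))"
    using finite_L by (subst sum.insert) auto
  also have "deg_mon b (bump e E) = - ((-1) ^ e E * degree_below b e E (s - 1))"
  proof -
    have "is_chain (bump e E)" using True E_L L_sub_E by (auto simp: is_chain_bump supp_def)
    moreover have "degree_below b (bump e E) E t = degree_below b e E t" for t
      by (rule degree_below_cong[OF E_in]) auto
    ultimately show ?thesis by (simp add: deg_mon_def s_def algebra_simps)
  qed
  also have "(\<Sum>G\<in>?A. deg_mon b (bump e G)) = (-1) ^ e E * (\<Sum>G\<in>?A. degree_below b (bump e G) E s)"
    unfolding sum_distrib_left
  proof (rule sum.cong[OF refl])
    fix G assume G: "G \<in> ?A"
    then have "F \<subseteq> G \<or> G \<subseteq> F" if "F \<in> supp e" for F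
      using that be by (cases "F = E") auto
    then have "is_chain (bump e G)" using G True by (auto simp: is_chain_bump)
    moreover have "G \<noteq> E" using G by auto
    ultimately show "deg_mon b (bump e G) = (-1) ^ e E * degree_below b (bump e G) E s"
      by (simp add: deg_mon_def s_def)
  qed
  also have "- ((-1) ^ e E * degree_below b e E (s - 1)) + (-1) ^ e E * (\<Sum>G\<in>?A. degree_below b (bump e G) E s)
     = (-1) ^ e E * ((\<Sum>G\<in>?A. degree_below b (bump e G) E s) - degree_below b e E (s - 1))"
    by (simp add: algebra_simps)
  also have "(\<Sum>G\<in>?A. degree_below b (bump e G) E s) - degree_below b e E (s - 1) =
     (if b = 1 \<or> (\<exists>F\<in>below e E. i \<notin> F) then 0 else - degree_below 1 e E s)"
    by (rule insertion_sum[OF True E_in assms(1) _ _ assms(2)]) (use r_le in \<open>auto simp: s_def\<close>)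
  also have "(\<exists>F\<in>below e E. i \<notin> F) \<longleftrightarrow> (\<exists>F\<in>supp e. i \<notin> F)"
    using be assms(1) by auto
  finally have "(\<Sum>G | G \<in> L \<and> i \<in> G. deg_mon b (bump e G)) =
    (-1) ^ e E * (if b = 1 \<or> (\<exists>F\<in>supp e. i \<notin> F) then 0 else - degree_below 1 e E s)" .
  then show ?thesis using True unfolding deg_mon_def[of 1 e] s_def[symmetric]
    by (simp only: if_True) simp
qed

definition admissible :: "nat \<Rightarrow> ('a set \<Rightarrow> nat) \<Rightarrow> bool" where
  "admissible \<epsilon> e \<longleftrightarrow> (\<forall>F. F \<notin> L \<longrightarrow> e F = 0) \<and> is_chain e \<and>
     (\<forall>F\<in>supp e. e F < rk F + \<epsilon> \<and> (\<forall>G\<in>supp e. G \<subset> F \<longrightarrow> e F + rk G < rk F))"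

text \<open>
The rank of the largest flat of the support strictly below \<open>U\<close>, the empty flat counting as \<open>- \<epsilon>\<close>.
\<close>

definition prev_rk :: "nat \<Rightarrow> ('a set \<Rightarrow> nat) \<Rightarrow> 'a set \<Rightarrow> int" where
  "prev_rk \<epsilon> e U = Max (insert (- int \<epsilon>) ((\<lambda>F. int (dm F)) ` below e U))"

text \<open>
The dual monomial is chosen so that, in the product of a monomial with its dual, every flat of the chain
except \<open>E\<close> has as its exponent the full rank difference to its predecessor, and \<open>E\<close> one less. In the
recursion for the degree every gap is then entered with exactly one rank available.
\<close>

definition dual :: "nat \<Rightarrow> ('a set \<Rightarrow> nat) \<Rightarrow> 'a set \<Rightarrow> nat" where
  "dual \<epsilon> e F =
     (if F = E then nat (int r - prev_rk \<epsilon> e E - 1 - int (e E))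
      else if F \<in> supp e then nat (int (dm F) - prev_rk \<epsilon> e F - int (e F)) else 0)"

lemma finite_below: "finite (below e U)"
  using finite_supp by (auto simp: below_def)

lemma prev_rk_empty: "below e U = {} \<Longrightarrow> prev_rk \<epsilon> e U = - int \<epsilon>"
  by (simp add: prev_rk_def)

lemma prev_rk_top:
  assumes "F \<in> below e U" "\<And>G. G \<in> below e U \<Longrightarrow> G \<subseteq> F"
  shows "prev_rk \<epsilon> e U = int (dm F)"
  unfolding prev_rk_def
proof (rule Max_eqI)
  show "finite (insert (- int \<epsilon>) ((\<lambda>F. int (dm F)) ` below e U))" using finite_below by simp
  show "int (dm F) \<in> insert (- int \<epsilon>) ((\<lambda>F. int (dm F)) ` below e U)" using assms by simp
  fix y assume "y \<in> insert (- int \<epsilon>) ((\<lambda>F. int (dm F)) ` below e U)"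
  then show "y \<le> int (dm F)" using assms below_L L_P dm_mono by fastforce
qed

lemma dm_below: "F \<in> below e U \<Longrightarrow> U \<in> L \<Longrightarrow> rk F = dm F"
  using below_L[of F e U] L_sub_E[of U] by (auto simp: rk_def)

lemma admissible_bound:
  assumes "admissible \<epsilon> e" "F \<in> supp e"
  shows "int (e F) + prev_rk \<epsilon> e F < int (rk F)"
proof (cases "below e F = {}")
  case True
  then show ?thesis using assms by (auto simp: prev_rk_empty admissible_def)
next
  case False
  obtain G where G: "G \<in> below e F" "\<And>H. H \<in> below e F \<Longrightarrow> H \<subseteq> G"
    using chain_below_top[OF _ False] assms(1) unfolding admissible_def by metis
  have "F \<in> L" "G \<in> supp e" "G \<subset> F" using assms G by (auto simp: supp_def below_def)
  then have "e F + rk G < rk F" using assms unfolding admissible_def by blast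
  then show ?thesis using prev_rk_top[OF G] dm_below[OF G(1) \<open>F \<in> L\<close>] by simp
qed

lemma dual_proper:
  assumes "admissible \<epsilon> e" "F \<in> supp e" "F \<noteq> E"
  shows "int (dual \<epsilon> e F) = int (dm F) - prev_rk \<epsilon> e F - int (e F)" "0 < dual \<epsilon> e F"
  using admissible_bound[OF assms(1,2)] assms(2,3) L_proper[of F] by (auto simp: dual_def supp_def)

lemma dual_E:
  assumes "admissible \<epsilon> e"
  shows "int (dual \<epsilon> e E) = int r - prev_rk \<epsilon> e E - 1 - int (e E)"
proof -
  have "int (e E) + prev_rk \<epsilon> e E < int r"
  proof (cases "E \<in> supp e")
    case True
    then show ?thesis using admissible_bound[OF assms True] by (simp add: rk_def)
  next
    case False
    then have "e E = 0" using E_L by (auto simp: supp_def)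
    moreover have "prev_rk \<epsilon> e E < int r"
      using finite_below below_L L_proper r_ge_1 by (fastforce simp: prev_rk_def)
    ultimately show ?thesis by simp
  qed
  then show ?thesis by (simp add: dual_def)
qed

lemma dual_zero: "F \<noteq> E \<Longrightarrow> F \<notin> supp e \<Longrightarrow> dual \<epsilon> e F = 0"
  by (simp add: dual_def)

text \<open>
Lexicographic comparison of exponents, reading the flats from the highest rank down.
\<close>

definition lex_less :: "('a set \<Rightarrow> nat) \<Rightarrow> ('a set \<Rightarrow> nat) \<Rightarrow> bool" where
  "lex_less e' e \<longleftrightarrow> (\<exists>F\<in>L. e' F < e F \<and> (\<forall>G\<in>L. G \<noteq> F \<and> rk F \<le> rk G \<longrightarrow> e' G = e G))"

text \<open>
Compare \<open>e'\<close> with \<open>e\<close> from the top flat down. As long as they agree, the recursion enters the next gap with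
state one more than the rank of the next flat of \<open>e\<close>, and this prevents \<open>e'\<close> from having a larger flat there. If at
some flat \<open>e'\<close> has the larger exponent, the state drops to that rank and the degree vanishes; if it has the
smaller one, \<open>e'\<close> precedes \<open>e\<close>.
\<close>

lemma degree_below_dual_triangular:
  assumes adm: "admissible \<epsilon> e" and "is_chain (\<lambda>F. e' F + dual \<epsilon> e F)"
    and "U = E \<or> U \<in> supp e"
    and "degree_below (1 - int \<epsilon>) (\<lambda>F. e' F + dual \<epsilon> e F) U (prev_rk \<epsilon> e U + 1 + (int (e U) - int (e' U))) \<noteq> 0"
  shows "(\<exists>F\<in>L. F \<subseteq> U \<and> e' F < e F \<and> (\<forall>G\<in>L. G \<subseteq> U \<and> G \<noteq> F \<and> rk F \<le> rk G \<longrightarrow> e' G = e G)) \<or>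
     (\<forall>G\<in>L. G \<subseteq> U \<longrightarrow> e' G = e G)"
  using assms(3,4)
proof (induction "card U" arbitrary: U rule: less_induct)
  case less
  define f where "f = (\<lambda>F. e' F + dual \<epsilon> e F)"
  define s where "s = prev_rk \<epsilon> e U + 1 + (int (e U) - int (e' U))"
  have ne: "degree_below (1 - int \<epsilon>) f U s \<noteq> 0" using less.prems(2) by (simp add: f_def s_def)
  have chf: "is_chain f" using assms(2) by (simp add: f_def)
  have che: "is_chain e" using adm by (simp add: admissible_def)
  have U: "U \<in> L" "U \<in> P" using less.prems(1) E_L L_P by (auto simp: supp_def)
  have bsub: "F \<in> below f U" if "F \<in> below e U" for F
  proof -
    have "F \<noteq> E" "F \<in> supp e" using that L_sub_E[OF U(1)] by (auto simp: below_def)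
    then show ?thesis using that dual_proper(2)[OF adm] by (auto simp: below_def supp_def f_def)
  qed
  have state: "int (dm T) < s"
    if T: "T \<in> below f U" "\<And>G. G \<in> below f U \<Longrightarrow> G \<subseteq> T" for T
  proof (rule ccontr)
    assume "\<not> ?thesis"
    then have "degree_below (1 - int \<epsilon>) f U s = 0" using degree_below_top[OF U(2) T] by (simp add: degree_factor_eq_0)
    then show False using ne by simp
  qed
  have empty_or_top: "below f U = {} \<or> (\<exists>T. T \<in> below f U \<and> (\<forall>G\<in>below f U. G \<subseteq> T))"
    using chain_below_top[OF chf, of U] by metis
  \<comment> \<open>If the state is too small, the largest flat of \<open>e\<close> below \<open>U\<close>, or the base state, makes the degree vanish.\<close>
  have small: "s > prev_rk \<epsilon> e U"
  proof (rule ccontr)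
    assume s: "\<not> ?thesis"
    show False
    proof (cases "below e U = {}")
      case True
      then have "s \<le> - int \<epsilon>" using s by (simp add: prev_rk_empty)
      then show False using empty_or_top ne state degree_below_empty[of f U "1 - int \<epsilon>" s] by fastforce
    next
      case False
      obtain F where F: "F \<in> below e U" "\<And>H. H \<in> below e U \<Longrightarrow> H \<subseteq> F"
        using chain_below_top[OF che False] by metis
      have "F \<in> below f U" using bsub F by auto
      with empty_or_top obtain T where T: "T \<in> below f U" "\<And>G. G \<in> below f U \<Longrightarrow> G \<subseteq> T" by auto
      have "F \<subseteq> T" using T \<open>F \<in> below f U\<close> by auto
      then have "dm F \<le> dm T" using dm_mono L_P below_L T(1) F(1) by blast
      then show False using state[OF T] s prev_rk_top[OF F, of \<epsilon>] by simp
    qed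
  qed
  show ?case
  proof (cases "e' U < e U")
    case True
    have "G = U" if "G \<in> L" "G \<subseteq> U" "rk U \<le> rk G" for G
      using rk_strict_mono[of G U] that U(1) by force
    then show ?thesis using True U(1) by blast
  next
    case False
    then have eqU: "e' U = e U" and s1: "s = prev_rk \<epsilon> e U + 1" using small by (auto simp: s_def)
    show ?thesis
    proof (cases "below e U = {}")
      case True
      then have "s \<le> 1" using s1 by (simp add: prev_rk_empty)
      have "below f U = {}"
      proof (rule ccontr)
        assume "below f U \<noteq> {}"
        then obtain T where T: "T \<in> below f U" "\<And>G. G \<in> below f U \<Longrightarrow> G \<subseteq> T"
          using empty_or_top by blast
        then have "dm T = 0" using state[OF T] \<open>s \<le> 1\<close> by simp
        then show False using below_L[OF T(1)] dm_eq_0_iff by (auto simp: L_def)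
      qed
      then have "e' G = e G" if "G \<in> L" "G \<subset> U" for G
      proof -
        have "G \<notin> below f U" "G \<notin> below e U" using True \<open>below f U = {}\<close> by auto
        then show ?thesis using that by (simp add: below_def supp_def f_def)
      qed
      then show ?thesis using eqU by (metis psubsetI)
    next
      case False
      obtain F where F: "F \<in> below e U" "\<And>H. H \<in> below e U \<Longrightarrow> H \<subseteq> F"
        using chain_below_top[OF che False] by metis
      have FL: "F \<in> L" "F \<subset> U" "F \<in> P" "F \<in> supp e" using below_L[OF F(1)] L_P F(1) by (auto simp: below_def)
      have FE: "F \<noteq> E" using FL L_sub_E[OF U(1)] by auto
      have Ff: "F \<in> below f U" using bsub F by auto
      have topF: "G \<subseteq> F" if G: "G \<in> below f U" for G
      proof -
        obtain T where T: "T \<in> below f U" "\<And>G. G \<in> below f U \<Longrightarrow> G \<subseteq> T" using empty_or_top G by auto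
        have "F \<subseteq> T" using T Ff by auto
        moreover have "dm T \<le> dm F" using state[OF T] s1 prev_rk_top[OF F, of \<epsilon>] by simp
        ultimately have "T = F" using dm_strict_mono[of F T] FL L_P below_L[OF T(1)] by force
        then show ?thesis using T G by auto
      qed
      have "degree_below (1 - int \<epsilon>) f F (s - int (f F)) \<noteq> 0"
        using ne degree_below_top[OF U(2) Ff topF, of "1 - int \<epsilon>" s] by auto
      moreover have "s - int (f F) = prev_rk \<epsilon> e F + 1 + (int (e F) - int (e' F))"
        using s1 prev_rk_top[OF F, of \<epsilon>] dual_proper(1)[OF adm FL(4) FE] by (simp add: f_def)
      ultimately have nz: "degree_below (1 - int \<epsilon>) (\<lambda>F. e' F + dual \<epsilon> e F) F
          (prev_rk \<epsilon> e F + 1 + (int (e F) - int (e' F))) \<noteq> 0"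
        unfolding f_def[symmetric] by simp
      have "card F < card U" using FL(2) finite_in_P[OF U(2)] by (rule psubset_card_mono[rotated])
      from less.hyps[OF this disjI2[OF FL(4)] nz]
      have IH: "(\<exists>F'\<in>L. F' \<subseteq> F \<and> e' F' < e F' \<and> (\<forall>G\<in>L. G \<subseteq> F \<and> G \<noteq> F' \<and> rk F' \<le> rk G \<longrightarrow> e' G = e G)) \<or>
         (\<forall>G\<in>L. G \<subseteq> F \<longrightarrow> e' G = e G)" .
      have out: "e' G = e G" if G: "G \<in> L" "G \<subseteq> U" "\<not> G \<subseteq> F" for G
      proof (cases "G = U")
        case False
        then have "G \<notin> below f U" "G \<notin> below e U" using G topF F(2) by auto
        then show ?thesis using False G by (auto simp: below_def supp_def f_def)
      qed (simp add: eqU)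
      show ?thesis using IH
      proof
        assume "\<exists>F'\<in>L. F' \<subseteq> F \<and> e' F' < e F' \<and> (\<forall>G\<in>L. G \<subseteq> F \<and> G \<noteq> F' \<and> rk F' \<le> rk G \<longrightarrow> e' G = e G)"
        then obtain F' where "F' \<in> L" "F' \<subseteq> F" "e' F' < e F'"
          "\<forall>G\<in>L. G \<subseteq> F \<and> G \<noteq> F' \<and> rk F' \<le> rk G \<longrightarrow> e' G = e G" by blast
        then have "e' G = e G" if "G \<in> L" "G \<subseteq> U" "G \<noteq> F'" "rk F' \<le> rk G" for G
          using that out[of G] by (cases "G \<subseteq> F") auto
        moreover have "F' \<subseteq> U" using \<open>F' \<subseteq> F\<close> FL(2) by blast
        ultimately show ?thesis using \<open>F' \<in> L\<close> \<open>e' F' < e F'\<close>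
          by (intro disjI1 bexI[of _ F']) simp_all
      next
        assume same: "\<forall>G\<in>L. G \<subseteq> F \<longrightarrow> e' G = e G"
        have "e' G = e G" if "G \<in> L" "G \<subseteq> U" for G
          using that out[of G] same by (cases "G \<subseteq> F") auto
        then show ?thesis by simp
      qed
    qed
  qed
qed

lemma degree_below_dual_nonzero:
  assumes adm: "admissible \<epsilon> e" and "U = E \<or> U \<in> supp e"
  shows "degree_below (1 - int \<epsilon>) (\<lambda>F. e F + dual \<epsilon> e F) U (prev_rk \<epsilon> e U + 1) \<noteq> 0"
  using assms(2)
proof (induction "card U" arbitrary: U rule: less_induct)
  case less
  define f where "f = (\<lambda>F. e F + dual \<epsilon> e F)"
  have U: "U \<in> L" "U \<in> P" using less.prems E_L L_P by (auto simp: supp_def)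
  have eq: "below f U = below e U"
  proof -
    have "0 < f F \<longleftrightarrow> 0 < e F" if "F \<in> L" "F \<subset> U" for F
    proof -
      have "F \<noteq> E" using that L_sub_E[OF U(1)] by auto
      then show ?thesis using that dual_zero[of F e \<epsilon>] by (cases "F \<in> supp e") (auto simp: f_def supp_def)
    qed
    then show ?thesis by (auto simp: below_def supp_def)
  qed
  show ?case
  proof (cases "below e U = {}")
    case True
    then show ?thesis using eq unfolding f_def[symmetric] by (simp add: degree_below_empty prev_rk_empty)
  next
    case False
    obtain F where F: "F \<in> below e U" "\<And>H. H \<in> below e U \<Longrightarrow> H \<subseteq> F"
      using chain_below_top[OF _ False] adm unfolding admissible_def by metis
    have FL: "F \<in> L" "F \<subset> U" "F \<in> supp e" using below_L[OF F(1)] F(1) by (auto simp: below_def)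
    have FE: "F \<noteq> E" using FL L_sub_E[OF U(1)] by auto
    have "card F < card U" using FL(2) finite_in_P[OF U(2)] by (rule psubset_card_mono[rotated])
    then have "degree_below (1 - int \<epsilon>) f F (prev_rk \<epsilon> e F + 1) \<noteq> 0" using less.hyps[of F] FL by (simp add: f_def)
    moreover have st: "prev_rk \<epsilon> e U + 1 - int (f F) = prev_rk \<epsilon> e F + 1"
      using prev_rk_top[OF F, of \<epsilon>] dual_proper(1)[OF adm FL(3) FE] by (simp add: f_def)
    moreover have "degree_below (1 - int \<epsilon>) f U (prev_rk \<epsilon> e U + 1) = (-1) ^ (f F - 1) *
        degree_factor (dm U - dm F) (prev_rk \<epsilon> e U + 1 - int (dm F)) (f F) *
        degree_below (1 - int \<epsilon>) f F (prev_rk \<epsilon> e U + 1 - int (f F))"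
      by (rule degree_below_top[OF U(2)]) (use F eq in auto)
    moreover have "prev_rk \<epsilon> e U + 1 - int (dm F) = 1" using prev_rk_top[OF F, of \<epsilon>] by simp
    ultimately show ?thesis unfolding f_def[symmetric] st by (simp add: degree_factor_rank_1 del: One_nat_def)
  qed
qed

lemma deg_mon_dual_nonzero:
  assumes adm: "admissible \<epsilon> e"
  shows "deg_mon (1 - int \<epsilon>) (\<lambda>F. e F + dual \<epsilon> e F) \<noteq> 0"
proof -
  have "supp (\<lambda>F. e F + dual \<epsilon> e F) \<subseteq> insert E (supp e)"
    by (auto simp: supp_def dual_def)
  moreover have "is_chain e" using adm by (simp add: admissible_def)
  ultimately have "is_chain (\<lambda>F. e F + dual \<epsilon> e F)"
    using L_sub_E unfolding is_chain_def supp_def by blast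
  moreover have "int r - int (e E + dual \<epsilon> e E) = prev_rk \<epsilon> e E + 1"
    using dual_E[OF adm] by simp
  ultimately show ?thesis using degree_below_dual_nonzero[OF adm, of E] by (simp add: deg_mon_def)
qed

lemma deg_mon_dual_triangular:
  assumes adm: "admissible \<epsilon> e" and "deg_mon (1 - int \<epsilon>) (\<lambda>F. e' F + dual \<epsilon> e F) \<noteq> 0"
  shows "lex_less e' e \<or> (\<forall>G\<in>L. e' G = e G)"
proof -
  have ch: "is_chain (\<lambda>F. e' F + dual \<epsilon> e F)"
    and ne: "degree_below (1 - int \<epsilon>) (\<lambda>F. e' F + dual \<epsilon> e F) E (int r - int (e' E + dual \<epsilon> e E)) \<noteq> 0"
    using assms(2) by (auto simp: deg_mon_def split: if_splits)
  have eq: "int r - int (e' E + dual \<epsilon> e E) = prev_rk \<epsilon> e E + 1 + (int (e E) - int (e' E))"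
    using dual_E[OF adm] by simp
  then have "(\<exists>F\<in>L. F \<subseteq> E \<and> e' F < e F \<and> (\<forall>G\<in>L. G \<subseteq> E \<and> G \<noteq> F \<and> rk F \<le> rk G \<longrightarrow> e' G = e G)) \<or>
     (\<forall>G\<in>L. G \<subseteq> E \<longrightarrow> e' G = e G)"
    using degree_below_dual_triangular[OF adm ch, of E] ne unfolding eq by simp
  then show ?thesis
  proof
    assume "\<exists>F\<in>L. F \<subseteq> E \<and> e' F < e F \<and> (\<forall>G\<in>L. G \<subseteq> E \<and> G \<noteq> F \<and> rk F \<le> rk G \<longrightarrow> e' G = e G)"
    then obtain F where F: "F \<in> L" "e' F < e F"
      "\<And>G. G \<in> L \<Longrightarrow> G \<subseteq> E \<and> G \<noteq> F \<and> rk F \<le> rk G \<Longrightarrow> e' G = e G" by auto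
    have "lex_less e' e"
      unfolding lex_less_def by (intro bexI[of _ F] conjI ballI impI) (use F L_sub_E in auto)
    then show ?thesis ..
  qed (use L_sub_E in auto)
qed

text \<open>
A weight that turns the lexicographic comparison into a comparison of numbers: to a base \<open>B\<close> exceeding
the total degree, the first difference outweighs everything of lower rank.
\<close>

lemma lex_less_measure:
  assumes "lex_less e' e" "(\<Sum>G\<in>L. e' G) < B"
  shows "(\<Sum>G\<in>L. e' G * B ^ rk G) < (\<Sum>G\<in>L. e G * B ^ rk G)"
proof -
  obtain F where F: "F \<in> L" "e' F < e F" and agree: "\<And>G. G \<in> L \<Longrightarrow> G \<noteq> F \<Longrightarrow> rk F \<le> rk G \<Longrightarrow> e' G = e G"
    using assms(1) unfolding lex_less_def by auto
  have B: "B \<ge> 1" using assms(2) by simp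
  let ?lo = "{G \<in> L. rk G < rk F}" and ?hi = "{G \<in> L. rk F \<le> rk G \<and> G \<noteq> F}"
  have split: "L = ?lo \<union> insert F ?hi" using F by auto
  have s: "(\<Sum>G\<in>L. g G) = (\<Sum>G\<in>?lo. g G) + (g F + (\<Sum>G\<in>?hi. g G))" for g :: "_ \<Rightarrow> nat"
  proof -
    have "(\<Sum>G\<in>L. g G) = (\<Sum>G\<in>?lo \<union> insert F ?hi. g G)" using split by simp
    also have "\<dots> = (\<Sum>G\<in>?lo. g G) + (\<Sum>G\<in>insert F ?hi. g G)"
      by (rule sum.union_disjoint) (use finite_L in auto)
    also have "(\<Sum>G\<in>insert F ?hi. g G) = g F + (\<Sum>G\<in>?hi. g G)"
      by (rule sum.insert) (use finite_L in auto)
    finally show ?thesis .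
  qed
  have "(\<Sum>G\<in>?lo. e' G * B ^ rk G) \<le> (\<Sum>G\<in>?lo. e' G * B ^ (rk F - 1))"
    using B by (intro sum_mono mult_left_mono power_increasing) auto
  also have "\<dots> \<le> (\<Sum>G\<in>L. e' G) * B ^ (rk F - 1)"
    unfolding sum_distrib_right[symmetric] using finite_L by (intro mult_right_mono sum_mono2) auto
  also have "\<dots> < B * B ^ (rk F - 1)" using assms(2) B by simp
  also have "\<dots> = B ^ rk F" using rk_pos[OF F(1)] by (metis power_eq_if less_numeral_extra(3))
  finally have lo: "(\<Sum>G\<in>?lo. e' G * B ^ rk G) < B ^ rk F" .
  have "(\<Sum>G\<in>?hi. e' G * B ^ rk G) = (\<Sum>G\<in>?hi. e G * B ^ rk G)"
    by (rule sum.cong) (auto simp: agree)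
  moreover have "e' F * B ^ rk F + B ^ rk F \<le> e F * B ^ rk F"
    using F(2) by (metis Suc_leI add.commute mult_Suc mult_le_mono1)
  ultimately show ?thesis using lo unfolding s[of "\<lambda>G. e' G * B ^ rk G"] s[of "\<lambda>G. e G * B ^ rk G"] by linarith
qed

end

section \<open>Polynomials, substitution, and graded quotients\<close>

abbreviation scal :: "rat \<Rightarrow> 'v qpoly" where "scal c \<equiv> Poly_Mapping.single 0 c"
abbreviation polys :: "'v set \<Rightarrow> 'v qpoly set" where "polys V \<equiv> carrier (qpoly_ring V)"

lemma scal_add: "scal (a + b) = scal a + scal b"
  by (rule single_add)

lemma scal_mult: "scal (a * b) = scal a * scal b"
  by (simp add: mult_single)

lemma polysI: "(\<And>m. m \<in> Poly_Mapping.keys p \<Longrightarrow> Poly_Mapping.keys m \<subseteq> V) \<Longrightarrow> p \<in> polys V"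
  by (simp add: qpoly_ring_def)

lemma polysD: "p \<in> polys V \<Longrightarrow> m \<in> Poly_Mapping.keys p \<Longrightarrow> Poly_Mapping.keys m \<subseteq> V"
  by (simp add: qpoly_ring_def)

lemma polys_0 [simp]: "0 \<in> polys V" by (rule polysI) simp
lemma polys_scal [simp]: "scal c \<in> polys V" by (rule polysI) (simp split: if_splits)
lemma polys_1 [simp]: "1 \<in> polys V" using polys_scal[of 1] by simp
lemma polys_var: "v \<in> V \<Longrightarrow> var v \<in> polys V" by (rule polysI) (simp add: var_def)

lemma polys_add: "p \<in> polys V \<Longrightarrow> q \<in> polys V \<Longrightarrow> p + q \<in> polys V"
  using keys_add[of p q] by (intro polysI) (blast dest: polysD)

lemma polys_mult: "p \<in> polys V \<Longrightarrow> q \<in> polys V \<Longrightarrow> p * q \<in> polys V"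
proof (rule polysI)
  fix m assume pq: "p \<in> polys V" "q \<in> polys V" and "m \<in> Poly_Mapping.keys (p * q)"
  then obtain a b where ab: "a \<in> Poly_Mapping.keys p" "b \<in> Poly_Mapping.keys q" "m = a + b"
    using keys_mult[of p q] by blast
  then have "Poly_Mapping.keys m \<subseteq> Poly_Mapping.keys a \<union> Poly_Mapping.keys b"
    by (simp add: keys_add)
  then show "Poly_Mapping.keys m \<subseteq> V" using polysD[OF pq(1) ab(1)] polysD[OF pq(2) ab(2)] by blast
qed

lemma polys_uminus: "p \<in> polys V \<Longrightarrow> - p \<in> polys V"
proof -
  assume "p \<in> polys V"
  then have "scal (-1) * p \<in> polys V" by (intro polys_mult) auto
  moreover have "scal (-1) * p = - p" by (simp add: single_uminus)
  ultimately show ?thesis by simp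
qed

lemma polys_diff: "p \<in> polys V \<Longrightarrow> q \<in> polys V \<Longrightarrow> p - q \<in> polys V"
  using polys_add[of p V "- q"] polys_uminus[of q V] by simp

lemma polys_sum: "(\<And>i. i \<in> A \<Longrightarrow> f i \<in> polys V) \<Longrightarrow> sum f A \<in> polys V"
  by (induction A rule: infinite_finite_induct) (auto intro: polys_add)

lemma polys_prod: "(\<And>i. i \<in> A \<Longrightarrow> f i \<in> polys V) \<Longrightarrow> prod f A \<in> polys V"
  by (induction A rule: infinite_finite_induct) (auto intro: polys_mult)

lemma polys_power: "p \<in> polys V \<Longrightarrow> p ^ k \<in> polys V"
  by (induction k) (auto intro: polys_mult)

lemmas polys_closed = polys_var polys_add polys_mult polys_uminus polys_diff polys_sum polys_prod polys_power

lemma qpoly_ring_simps [simp]: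
  "mult (qpoly_ring V) = (*)" "add (qpoly_ring V) = (+)" "one (qpoly_ring V) = 1" "zero (qpoly_ring V) = 0"
  by (simp_all add: qpoly_ring_def)

lemma cring_qpoly_ring: "cring (qpoly_ring V)"
proof (rule cringI)
  show "abelian_group (qpoly_ring V)"
  proof (rule abelian_groupI)
    fix x assume "x \<in> polys V"
    then show "\<exists>y\<in>polys V. y \<oplus>\<^bsub>qpoly_ring V\<^esub> x = \<zero>\<^bsub>qpoly_ring V\<^esub>"
      by (intro bexI[of _ "- x"]) (auto intro: polys_uminus)
  qed (auto intro: polys_add simp: add_ac)
  show "Group.comm_monoid (qpoly_ring V)"
    by (rule comm_monoidI) (auto intro: polys_mult simp: mult_ac)
qed (auto simp: distrib_right)

text \<open>
The closure properties of an ideal in terms of the operations of the type of polynomials.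
\<close>

lemma ideal_polys:
  assumes "ideal I (qpoly_ring V)"
  shows "I \<subseteq> polys V" "0 \<in> I" "x \<in> I \<Longrightarrow> y \<in> I \<Longrightarrow> x + y \<in> I"
    "x \<in> I \<Longrightarrow> p \<in> polys V \<Longrightarrow> p * x \<in> I" "x \<in> I \<Longrightarrow> - x \<in> I"
    "x \<in> I \<Longrightarrow> y \<in> I \<Longrightarrow> x - y \<in> I"
proof -
  interpret ideal I "qpoly_ring V" by fact
  show sub: "I \<subseteq> polys V" using a_subset by simp
  show "0 \<in> I" using additive_subgroup.zero_closed[OF is_additive_subgroup] by simp
  show add: "x \<in> I \<Longrightarrow> y \<in> I \<Longrightarrow> x + y \<in> I" for x y using additive_subgroup.a_closed[OF is_additive_subgroup, of x y] by simp
  show mult: "x \<in> I \<Longrightarrow> p \<in> polys V \<Longrightarrow> p * x \<in> I" for x p using I_l_closed[of x p] by simp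
  show um: "x \<in> I \<Longrightarrow> - x \<in> I" for x
    using mult[of x "scal (-1)", OF _ polys_scal] by (simp add: single_uminus)
  show "x \<in> I \<Longrightarrow> y \<in> I \<Longrightarrow> x - y \<in> I" using add[of x "- y"] um[of y] by simp
qed

lemma ideal_sum:
  assumes "ideal I (qpoly_ring V)" "\<And>i. i \<in> A \<Longrightarrow> f i \<in> I"
  shows "sum f A \<in> I"
  using assms(2) by (induction A rule: infinite_finite_induct) (auto simp: ideal_polys[OF assms(1)])

definition mdeg :: "('v \<Rightarrow>\<^sub>0 nat) \<Rightarrow> nat" where
  "mdeg m = (\<Sum>v\<in>Poly_Mapping.keys m. Poly_Mapping.lookup m v)"

lemma mdeg_superset:
  assumes "finite A" "Poly_Mapping.keys m \<subseteq> A"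
  shows "mdeg m = (\<Sum>v\<in>A. Poly_Mapping.lookup m v)"
  unfolding mdeg_def by (rule sum.mono_neutral_left) (use assms in \<open>auto simp: in_keys_iff\<close>)

lemma mdeg_add: "mdeg (a + b) = mdeg a + mdeg b"
proof -
  let ?A = "Poly_Mapping.keys a \<union> Poly_Mapping.keys b"
  have "mdeg (a + b) = (\<Sum>v\<in>?A. Poly_Mapping.lookup (a + b) v)"
    by (rule mdeg_superset) (use keys_add[of a b] in auto)
  also have "\<dots> = (\<Sum>v\<in>?A. Poly_Mapping.lookup a v) + (\<Sum>v\<in>?A. Poly_Mapping.lookup b v)"
    by (simp add: lookup_add sum.distrib)
  finally show ?thesis using mdeg_superset[of ?A a] mdeg_superset[of ?A b] by simp
qed

lemma homogeneous_iff:
  "p \<in> homogeneous V j \<longleftrightarrow> p \<in> polys V \<and> (\<forall>m\<in>Poly_Mapping.keys p. mdeg m = j)"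
  by (simp add: homogeneous_def mdeg_def)

lemma homogeneous_polys: "p \<in> homogeneous V j \<Longrightarrow> p \<in> polys V"
  by (simp add: homogeneous_iff)

lemma homogeneous_0 [simp]: "0 \<in> homogeneous V j" by (simp add: homogeneous_iff)

lemma homogeneous_scal: "scal c \<in> homogeneous V 0"
  by (simp add: homogeneous_iff mdeg_def)

lemma homogeneous_1: "1 \<in> homogeneous V 0"
  using homogeneous_scal[of 1] by simp

lemma homogeneous_var: "v \<in> V \<Longrightarrow> var v \<in> homogeneous V 1"
  by (simp add: homogeneous_iff polys_var) (simp add: var_def mdeg_def)

lemma homogeneous_add: "p \<in> homogeneous V j \<Longrightarrow> q \<in> homogeneous V j \<Longrightarrow> p + q \<in> homogeneous V j"
  using keys_add[of p q] by (auto simp: homogeneous_iff intro: polys_add)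

lemma homogeneous_mult:
  "p \<in> homogeneous V i \<Longrightarrow> q \<in> homogeneous V j \<Longrightarrow> p * q \<in> homogeneous V (i + j)"
  using keys_mult[of p q] by (fastforce simp: homogeneous_iff mdeg_add intro: polys_mult)

lemma homogeneous_scal_mult: "p \<in> homogeneous V j \<Longrightarrow> scal c * p \<in> homogeneous V j"
  using homogeneous_mult[OF homogeneous_scal, of p V j c] by simp

lemma homogeneous_uminus: "p \<in> homogeneous V j \<Longrightarrow> - p \<in> homogeneous V j"
  using homogeneous_scal_mult[of p V j "-1"] by (simp add: single_uminus)

lemma homogeneous_sum: "(\<And>i. i \<in> A \<Longrightarrow> f i \<in> homogeneous V j) \<Longrightarrow> sum f A \<in> homogeneous V j"
  by (induction A rule: infinite_finite_induct) (auto intro: homogeneous_add)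

lemma homogeneous_power: "p \<in> homogeneous V j \<Longrightarrow> p ^ k \<in> homogeneous V (k * j)"
  by (induction k) (auto intro: homogeneous_mult homogeneous_1)

lemma homogeneous_prod:
  "(\<And>i. i \<in> A \<Longrightarrow> f i \<in> homogeneous V (d i)) \<Longrightarrow> finite A \<Longrightarrow> prod f A \<in> homogeneous V (sum d A)"
proof (induction A rule: infinite_finite_induct)
  case (insert x F)
  then show ?case by (simp add: homogeneous_mult)
qed (auto intro: homogeneous_1)

lemma qpoly_expand: "p = (\<Sum>m\<in>Poly_Mapping.keys p. Poly_Mapping.single m (Poly_Mapping.lookup p m))"
  by (rule poly_mapping_eqI)
    (auto simp: lookup_sum lookup_single when_def in_keys_iff sum.delta' )

text \<open>
Linear extension of a function on monomials. Through the parameter \<open>\<kappa>\<close> for the action of the coefficients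
it covers both functionals with values in the rationals and substitutions with values in a
polynomial ring.
\<close>

definition lin_ext :: "(rat \<Rightarrow> 'b::comm_ring_1) \<Rightarrow> (('v \<Rightarrow>\<^sub>0 nat) \<Rightarrow> 'b) \<Rightarrow> 'v qpoly \<Rightarrow> 'b" where
  "lin_ext \<kappa> g p = (\<Sum>m\<in>Poly_Mapping.keys p. \<kappa> (Poly_Mapping.lookup p m) * g m)"

locale coefficients =
  fixes \<kappa> :: "rat \<Rightarrow> 'b::comm_ring_1"
  assumes add: "\<kappa> (a + b) = \<kappa> a + \<kappa> b" and mult: "\<kappa> (a * b) = \<kappa> a * \<kappa> b" and one: "\<kappa> 1 = 1"
begin

lemma zero: "\<kappa> 0 = 0" using add[of 0 0] by simp

lemma lin_ext_superset:
  assumes "finite A" "Poly_Mapping.keys p \<subseteq> A"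
  shows "lin_ext \<kappa> g p = (\<Sum>m\<in>A. \<kappa> (Poly_Mapping.lookup p m) * g m)"
  unfolding lin_ext_def by (rule sum.mono_neutral_left) (use assms zero in \<open>auto simp: in_keys_iff\<close>)

lemma lin_ext_add: "lin_ext \<kappa> g (p + q) = lin_ext \<kappa> g p + lin_ext \<kappa> g q"
proof -
  let ?A = "Poly_Mapping.keys p \<union> Poly_Mapping.keys q"
  have "lin_ext \<kappa> g (p + q) = (\<Sum>m\<in>?A. \<kappa> (Poly_Mapping.lookup (p + q) m) * g m)"
    by (rule lin_ext_superset) (use keys_add[of p q] in auto)
  also have "\<dots> = (\<Sum>m\<in>?A. \<kappa> (Poly_Mapping.lookup p m) * g m) + (\<Sum>m\<in>?A. \<kappa> (Poly_Mapping.lookup q m) * g m)"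
    by (simp add: lookup_add add distrib_right sum.distrib)
  finally show ?thesis using lin_ext_superset[of ?A p g] lin_ext_superset[of ?A q g] by simp
qed

lemma lin_ext_single: "lin_ext \<kappa> g (Poly_Mapping.single m c) = \<kappa> c * g m"
  by (cases "c = 0") (simp_all add: lin_ext_def zero)

lemma lin_ext_0 [simp]: "lin_ext \<kappa> g 0 = 0" by (simp add: lin_ext_def)

lemma lin_ext_sum: "lin_ext \<kappa> g (sum f A) = (\<Sum>i\<in>A. lin_ext \<kappa> g (f i))"
  by (induction A rule: infinite_finite_induct) (simp_all add: lin_ext_add)

lemma lin_ext_mult_single:
  "lin_ext \<kappa> g (Poly_Mapping.single a c * q) = \<kappa> c * lin_ext \<kappa> (\<lambda>m. g (a + m)) q"
proof -
  have "lin_ext \<kappa> g (Poly_Mapping.single a c * q) = lin_ext \<kappa> g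
     (\<Sum>m\<in>Poly_Mapping.keys q. Poly_Mapping.single (a + m) (c * Poly_Mapping.lookup q m))"
    by (subst (1) qpoly_expand[of q]) (simp add: sum_distrib_left mult_single)
  then show ?thesis
    by (simp add: lin_ext_sum lin_ext_single mult lin_ext_def[of _ _ q] sum_distrib_left mult.assoc)
qed

lemma lin_ext_scal_mult: "lin_ext \<kappa> g (scal c * q) = \<kappa> c * lin_ext \<kappa> g q"
  by (simp add: lin_ext_mult_single)

lemma lin_ext_uminus: "lin_ext \<kappa> g (- p) = - lin_ext \<kappa> g p"
  using lin_ext_add[of g p "- p"] by (simp add: eq_neg_iff_add_eq_0 add.commute)

lemma lin_ext_diff: "lin_ext \<kappa> g (p - q) = lin_ext \<kappa> g p - lin_ext \<kappa> g q"
  using lin_ext_add[of g p "- q"] lin_ext_uminus[of g q] by simp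

lemma lin_ext_scale: "lin_ext \<kappa> (\<lambda>m. h * g m) q = h * lin_ext \<kappa> g q"
  by (simp add: lin_ext_def sum_distrib_left mult.left_commute)

lemma lin_ext_mult:
  assumes "\<And>a b. g (a + b) = g a * g b"
  shows "lin_ext \<kappa> g (p * q) = lin_ext \<kappa> g p * lin_ext \<kappa> g q"
proof -
  have "lin_ext \<kappa> g (p * q) = (\<Sum>a\<in>Poly_Mapping.keys p. lin_ext \<kappa> g (Poly_Mapping.single a (Poly_Mapping.lookup p a) * q))"
    by (subst (1) qpoly_expand[of p]) (simp add: sum_distrib_right lin_ext_sum)
  also have "\<dots> = (\<Sum>a\<in>Poly_Mapping.keys p. \<kappa> (Poly_Mapping.lookup p a) * g a * lin_ext \<kappa> g q)"
    by (simp only: lin_ext_mult_single assms lin_ext_scale mult.assoc)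
  finally show ?thesis by (simp add: lin_ext_def[of _ _ p] sum_distrib_right)
qed

end

definition mon_eval :: "('v \<Rightarrow> 'b::comm_ring_1) \<Rightarrow> ('v \<Rightarrow>\<^sub>0 nat) \<Rightarrow> 'b" where
  "mon_eval f m = (\<Prod>v\<in>Poly_Mapping.keys m. f v ^ Poly_Mapping.lookup m v)"

lemma mon_eval_superset:
  assumes "finite A" "Poly_Mapping.keys m \<subseteq> A"
  shows "mon_eval f m = (\<Prod>v\<in>A. f v ^ Poly_Mapping.lookup m v)"
  unfolding mon_eval_def by (rule prod.mono_neutral_left) (use assms in \<open>auto simp: in_keys_iff\<close>)

lemma mon_eval_add: "mon_eval f (a + b) = mon_eval f a * mon_eval f b"
proof -
  let ?A = "Poly_Mapping.keys a \<union> Poly_Mapping.keys b"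
  have "mon_eval f (a + b) = (\<Prod>v\<in>?A. f v ^ Poly_Mapping.lookup (a + b) v)"
    by (rule mon_eval_superset) (use keys_add[of a b] in auto)
  also have "\<dots> = (\<Prod>v\<in>?A. f v ^ Poly_Mapping.lookup a v) * (\<Prod>v\<in>?A. f v ^ Poly_Mapping.lookup b v)"
    by (simp add: lookup_add power_add prod.distrib)
  finally show ?thesis using mon_eval_superset[of ?A a f] mon_eval_superset[of ?A b f] by simp
qed

lemma mon_eval_0 [simp]: "mon_eval f 0 = 1" by (simp add: mon_eval_def)

lemma coefficients_scal: "coefficients (scal :: rat \<Rightarrow> 'w qpoly)"
  by unfold_locales (simp_all add: scal_add scal_mult)

lemma coefficients_id: "coefficients (\<lambda>x::rat. x)"
  by unfold_locales simp_all

definition psubst :: "('v \<Rightarrow> 'w qpoly) \<Rightarrow> 'v qpoly \<Rightarrow> 'w qpoly" where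
  "psubst f = lin_ext scal (mon_eval f)"

lemma psubst_add: "psubst f (p + q) = psubst f p + psubst f q"
  unfolding psubst_def by (rule coefficients.lin_ext_add[OF coefficients_scal])
lemma psubst_diff: "psubst f (p - q) = psubst f p - psubst f q"
  unfolding psubst_def by (rule coefficients.lin_ext_diff[OF coefficients_scal])
lemma psubst_uminus: "psubst f (- p) = - psubst f p"
  unfolding psubst_def by (rule coefficients.lin_ext_uminus[OF coefficients_scal])
lemma psubst_sum: "psubst f (sum h A) = (\<Sum>i\<in>A. psubst f (h i))"
  unfolding psubst_def by (rule coefficients.lin_ext_sum[OF coefficients_scal])
lemma psubst_mult: "psubst f (p * q) = psubst f p * psubst f q"
  unfolding psubst_def by (rule coefficients.lin_ext_mult[OF coefficients_scal mon_eval_add])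
lemma psubst_scal: "psubst f (scal c) = scal c"
  unfolding psubst_def by (simp add: coefficients.lin_ext_single[OF coefficients_scal])
lemma psubst_1: "psubst f 1 = 1"
  using psubst_scal[of f 1] by simp
lemma psubst_var: "psubst f (var v) = f v"
  unfolding psubst_def var_def
  by (simp add: coefficients.lin_ext_single[OF coefficients_scal] mon_eval_def)
lemma psubst_prod: "psubst f (prod h A) = (\<Prod>i\<in>A. psubst f (h i))"
  by (induction A rule: infinite_finite_induct) (simp_all add: psubst_mult psubst_1)
lemma psubst_power: "psubst f (p ^ k) = psubst f p ^ k"
  by (induction k) (simp_all add: psubst_mult psubst_1)

lemma var_mon_eval: "mon_eval var m = Poly_Mapping.single m 1"
proof -
  have pw: "var v ^ k = Poly_Mapping.single (Poly_Mapping.single v k) 1" for v :: 'a and k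
  proof (induction k)
    case (Suc k)
    then show ?case by (simp add: var_def mult_single single_add[symmetric])
  qed simp
  have pr: "(\<Prod>v\<in>A. Poly_Mapping.single (h v) (1::rat)) = Poly_Mapping.single (sum h A) 1"
    for A :: "'a set" and h :: "'a \<Rightarrow> 'a \<Rightarrow>\<^sub>0 nat"
    by (induction A rule: infinite_finite_induct) (simp_all add: mult_single)
  have "(\<Sum>v\<in>Poly_Mapping.keys m. Poly_Mapping.single v (Poly_Mapping.lookup m v)) = m"
    by (rule poly_mapping_eqI) (auto simp: lookup_sum lookup_single when_def in_keys_iff sum.delta')
  then show ?thesis unfolding mon_eval_def pw pr by simp
qed

lemma single_scal: "Poly_Mapping.single m c = scal c * mon_eval var m"
  by (simp add: var_mon_eval mult_single)

text \<open>
The cosets of the \<open>b k\<close> form a basis of the graded piece, and are distinct by independence.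
\<close>

lemma dim_piece:
  fixes b :: "'n \<Rightarrow> 'v qpoly"
  assumes I: "ideal I (qpoly_ring V)" and finN: "finite N"
    and b: "\<And>k. k \<in> N \<Longrightarrow> b k \<in> homogeneous V j"
    and span: "\<And>p. p \<in> homogeneous V j \<Longrightarrow> \<exists>c. p - (\<Sum>k\<in>N. scal (c k) * b k) \<in> I"
    and indep: "\<And>c k. (\<Sum>k\<in>N. scal (c k) * b k) \<in> I \<Longrightarrow> k \<in> N \<Longrightarrow> c k = 0"
  shows "vectorspace.dim class_ring ((quotient_algebra V I)\<lparr>carrier := piece (quotient_algebra V I) j\<rparr>) = card N"
proof -
  interpret I: ideal I "qpoly_ring V" by fact
  let ?R = "qpoly_ring V"
  define M where "M = (quotient_algebra V I)\<lparr>carrier := piece (quotient_algebra V I) j\<rparr>"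
  define cos where "cos p = I +>\<^bsub>?R\<^esub> p" for p
  have carM: "carrier M = cos ` homogeneous V j"
    by (auto simp: M_def quotient_algebra_def Let_def cos_def)
  have cos_eq: "cos p = cos q \<longleftrightarrow> p - q \<in> I" if "p \<in> polys V" "q \<in> polys V" for p q
  proof -
    have "\<ominus>\<^bsub>?R\<^esub> q = - q"
      using that by (intro I.minus_equality) (auto intro: polys_uminus)
    then have "p \<ominus>\<^bsub>?R\<^esub> q = p - q" by (simp add: a_minus_def)
    then show ?thesis using I.quotient_eq_iff_same_a_r_cos[OF I that] by (simp add: cos_def)
  qed
  have addM: "cos p \<oplus>\<^bsub>M\<^esub> cos q = cos (p + q)" if "p \<in> polys V" "q \<in> polys V" for p q
    using that I.a_rcos_sum[of p q] by (simp add: M_def quotient_algebra_def Let_def cos_def FactRing_def)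
  have smultM: "c \<odot>\<^bsub>M\<^esub> cos p = cos (scal c * p)" if "p \<in> polys V" for p c
    using that I.rcoset_mult_add[of "scal c" p] by (simp add: M_def quotient_algebra_def Let_def cos_def FactRing_def)
  have zeroM: "\<zero>\<^bsub>M\<^esub> = cos 0"
    using I.a_rcos_zero[OF I ideal_polys(2)[OF I]]
    by (simp add: M_def quotient_algebra_def Let_def cos_def FactRing_def)
  note hp = homogeneous_polys[of _ V j]
  have field: "field (class_ring :: rat ring)" by (rule class_field.field_axioms)
  interpret vectorspace "class_ring :: rat ring" M
  proof (rule vs_criteria[OF field])
    show "\<zero>\<^bsub>M\<^esub> \<in> carrier M" by (simp add: carM zeroM)
    show "\<forall>v w. v \<in> carrier M \<and> w \<in> carrier M \<longrightarrow> v \<oplus>\<^bsub>M\<^esub> w \<in> carrier M"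
      by (auto simp: carM addM hp intro!: imageI homogeneous_add)
    show "\<forall>v\<in>carrier M. \<exists>neg_v\<in>carrier M. v \<oplus>\<^bsub>M\<^esub> neg_v = \<zero>\<^bsub>M\<^esub>"
    proof
      fix v assume "v \<in> carrier M"
      then obtain p where p: "p \<in> homogeneous V j" "v = cos p" by (auto simp: carM)
      have m: "- p \<in> homogeneous V j" using p by (simp add: homogeneous_uminus)
      have "v \<oplus>\<^bsub>M\<^esub> cos (- p) = \<zero>\<^bsub>M\<^esub>" using p m by (simp add: addM hp zeroM)
      then show "\<exists>neg_v\<in>carrier M. v \<oplus>\<^bsub>M\<^esub> neg_v = \<zero>\<^bsub>M\<^esub>" using m by (auto simp: carM)
    qed
  qed (auto simp: carM addM smultM zeroM hp homogeneous_scal_mult[THEN hp] homogeneous_add[THEN hp]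
      add_ac distrib_left distrib_right scal_add scal_mult mult.assoc intro!: imageI homogeneous_scal_mult)
  have bp: "b k \<in> polys V" if "k \<in> N" for k using b[OF that] by (rule hp)
  have inj: "inj_on (\<lambda>k. cos (b k)) N"
  proof (rule inj_onI, rule ccontr)
    fix x y assume xy: "x \<in> N" "y \<in> N" "cos (b x) = cos (b y)" "x \<noteq> y"
    define c where "c k = (if k = x then 1 else if k = y then -1 else 0 :: rat)" for k
    have "(\<Sum>k\<in>N. scal (c k) * b k) = (\<Sum>k\<in>{x, y}. scal (c k) * b k)"
      by (rule sum.mono_neutral_right) (use finN xy in \<open>auto simp: c_def\<close>)
    also have "\<dots> = b x - b y" using xy by (simp add: c_def single_uminus)
    also have "\<dots> \<in> I" using xy cos_eq bp by blast
    finally have "c x = 0" using indep xy by blast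
    then show False by (simp add: c_def)
  qed
  let ?B = "(\<lambda>k. cos (b k)) ` N"
  have BM: "?B \<subseteq> carrier M" using b by (auto simp: carM)
  have sumM: "(\<Oplus>\<^bsub>M\<^esub>k\<in>A. cos (f k)) = cos (sum f A)" if "finite A" "\<And>k. k \<in> A \<Longrightarrow> f k \<in> homogeneous V j" for f :: "'n \<Rightarrow> 'v qpoly" and A
    using that
  proof (induction A)
    case empty
    then show ?case by (simp add: zeroM)
  next
    case (insert x A)
    then show ?case by (subst finsum_insert) (auto simp: carM addM hp homogeneous_sum[THEN hp])
  qed
  have comb: "lincomb a ?B = cos (\<Sum>k\<in>N. scal (a (cos (b k))) * b k)" for a
  proof -
    have "lincomb a ?B = (\<Oplus>\<^bsub>M\<^esub>k\<in>N. a (cos (b k)) \<odot>\<^bsub>M\<^esub> cos (b k))"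
      unfolding lincomb_def by (rule finsum_reindex[OF _ inj]) (use BM in auto)
    also have "\<dots> = (\<Oplus>\<^bsub>M\<^esub>k\<in>N. cos (scal (a (cos (b k))) * b k))"
      by (rule finsum_cong) (use b in \<open>auto simp: smultM bp simp_implies_def carM intro!: imageI homogeneous_scal_mult\<close>)
    also have "\<dots> = cos (\<Sum>k\<in>N. scal (a (cos (b k))) * b k)"
      by (rule sumM[OF finN]) (use b in \<open>auto intro: homogeneous_scal_mult\<close>)
    finally show ?thesis .
  qed
  have sp: "(\<Sum>k\<in>N. scal (c k) * b k) \<in> polys V" for c
    by (intro polys_sum polys_mult bp) auto
  have "basis ?B"
    unfolding basis_def
  proof (intro conjI)
    show "lin_indpt ?B"
    proof (rule finite_lin_indpt2)
      fix a :: "'v qpoly set \<Rightarrow> rat" assume "lincomb a ?B = \<zero>\<^bsub>M\<^esub>"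
      then have "(\<Sum>k\<in>N. scal (a (cos (b k))) * b k) \<in> I"
        using cos_eq[OF sp polys_0] by (simp add: comb zeroM)
      then have "a (cos (b k)) = 0" if "k \<in> N" for k by (rule indep) (rule that)
      then show "\<forall>v\<in>?B. a v = \<zero>\<^bsub>class_ring\<^esub>" by simp
    qed (use finN BM in auto)
    show "span ?B = carrier M"
    proof
      show "span ?B \<subseteq> carrier M" using BM by (simp add: span_is_subset2)
      show "carrier M \<subseteq> span ?B"
      proof
        fix v assume "v \<in> carrier M"
        then obtain p where p: "p \<in> homogeneous V j" "v = cos p" by (auto simp: carM)
        obtain c where c: "p - (\<Sum>k\<in>N. scal (c k) * b k) \<in> I" using assms(4)[OF p(1)] by blast
        define a where "a v = c (the_inv_into N (\<lambda>k. cos (b k)) v)" for v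
        have "a (cos (b k)) = c k" if "k \<in> N" for k
          using the_inv_into_f_f[OF inj that] by (simp add: a_def)
        then have "lincomb a ?B = cos (\<Sum>k\<in>N. scal (c k) * b k)" unfolding comb by simp
        also have "\<dots> = v" using iffD2[OF cos_eq[OF hp[OF p(1)] sp] c] p(2) by simp
        finally have "v = lincomb a ?B" by simp
        then show "v \<in> span ?B" unfolding finite_span[OF finite_imageI[OF finN] BM] by auto
      qed
    qed
  qed (use BM in auto)
  then have "dim = card ?B" by (rule dim_basis[OF finite_imageI[OF finN]])
  then show ?thesis using card_image[OF inj] by (simp add: M_def)
qed

section \<open>The monomial basis\<close>

context truncation begin

lemma rk_empty: "rk {} = 0"
  using E_L by (auto simp: rk_def L_def)

lemma rk_strict_mono0:
  assumes "F \<in> insert {} L" "G \<in> L" "F \<subset> G" shows "rk F < rk G"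
  using assms rk_strict_mono rk_pos rk_empty by auto

lemma Int_L: "F \<in> L \<Longrightarrow> G \<in> L \<Longrightarrow> F \<inter> G \<in> insert {} L"
proof -
  assume FG: "F \<in> L" "G \<in> L"
  have "F \<inter> G \<in> P" using FG L_P Int_in by blast
  moreover have "dm (F \<inter> G) \<le> dm F" "dm (F \<inter> G) \<le> dm G"
    using FG L_P Int_in dm_mono by (meson Int_lower1 Int_lower2)+
  ultimately show ?thesis using FG by (auto simp: L_def)
qed

definition wdeg :: "('a set \<Rightarrow> nat) \<Rightarrow> nat" where "wdeg e = (\<Sum>F\<in>L. e F)"
text \<open>
The weight that straightening increases.
\<close>

definition wrk :: "('a set \<Rightarrow> nat) \<Rightarrow> nat" where "wrk e = (\<Sum>F\<in>L. e F * rk F)"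

definition degree_map :: "nat \<Rightarrow> 'a set qpoly \<Rightarrow> rat" where
  "degree_map \<epsilon> = lin_ext (\<lambda>x. x) (\<lambda>m. of_int (deg_mon (1 - int \<epsilon>) (Poly_Mapping.lookup m)))"

definition admissibles :: "nat \<Rightarrow> nat \<Rightarrow> ('a set \<Rightarrow> nat) set" where
  "admissibles \<epsilon> j = {e. admissible \<epsilon> e \<and> wdeg e = j}"

lemma finite_admissibles: "finite (admissibles \<epsilon> j)"
proof (rule finite_subset)
  show "admissibles \<epsilon> j \<subseteq> {e. \<forall>F. (F \<in> L \<longrightarrow> e F \<in> {..j}) \<and> (F \<notin> L \<longrightarrow> e F = 0)}"
  proof
    fix e assume e: "e \<in> admissibles \<epsilon> j"
    have "e F \<le> j" if "F \<in> L" for F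
      using e member_le_sum[OF that, of e] finite_L by (auto simp: admissibles_def wdeg_def)
    then show "e \<in> {e. \<forall>F. (F \<in> L \<longrightarrow> e F \<in> {..j}) \<and> (F \<notin> L \<longrightarrow> e F = 0)}"
      using e by (auto simp: admissibles_def admissible_def)
  qed
  show "finite {e. \<forall>F. (F \<in> L \<longrightarrow> e F \<in> {..j}) \<and> (F \<notin> L \<longrightarrow> e F = (0::nat))}"
    by (rule finite_set_of_finite_funs) (use finite_L in auto)
qed

lemma dual_outside: "F \<notin> L \<Longrightarrow> dual \<epsilon> e F = 0"
  using E_L by (auto simp: dual_def supp_def)

end

text \<open>
The common presentation of the two rings: \<open>x F\<close> is a polynomial that represents the variable \<open>x_F\<close>, and \<open>f\<close>
translates the variables of the ring back into polynomials in the \<open>x_F\<close>, so that the functional can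
be evaluated. The relations bound the ring from above, and the vanishing of the functional on the ideal
bounds it from below.
\<close>

locale presentation = truncation P E q dm r
  for P :: "'a set set" and E q dm r +
  fixes V :: "'v set" and I :: "'v qpoly set" and \<epsilon> :: nat
    and x :: "'a set \<Rightarrow> 'v qpoly" and f :: "'v \<Rightarrow> 'a set qpoly"
  assumes I: "ideal I (qpoly_ring V)" and eps: "\<epsilon> \<le> 1"
    and x_hom: "F \<in> L \<Longrightarrow> x F \<in> homogeneous V 1"
    and gens: "v \<in> V \<Longrightarrow> \<exists>c. var v - (\<Sum>F\<in>L. scal (c F) * x F) \<in> I"
    and rel_incomparable: "F \<in> L \<Longrightarrow> G \<in> L \<Longrightarrow> incomparable F G \<Longrightarrow> x F * x G \<in> I"
    and rel_linear: "F \<in> L \<Longrightarrow> i \<in> E \<Longrightarrow> i \<notin> F \<Longrightarrow> x F * (\<Sum>G | G \<in> L \<and> i \<in> G. x G) \<in> I"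
    and rel_power: "i \<in> E \<Longrightarrow> (\<Sum>G | G \<in> L \<and> i \<in> G. x G) ^ Suc \<epsilon> \<in> I"
    and degree_map_I: "p \<in> I \<Longrightarrow> degree_map \<epsilon> (psubst f p) = 0"
    and subst_x: "F \<in> L \<Longrightarrow> psubst f (x F) = var F"
begin

lemmas ideal_I = ideal_polys[OF I]

lemma x_polys: "F \<in> L \<Longrightarrow> x F \<in> polys V"
  using x_hom homogeneous_polys by blast

definition x_through :: "'a \<Rightarrow> 'v qpoly" where "x_through i = (\<Sum>G | G \<in> L \<and> i \<in> G. x G)"
definition x_above :: "'a set \<Rightarrow> 'v qpoly" where "x_above F = (\<Sum>G | G \<in> L \<and> F \<subseteq> G. x G)"
definition xmon :: "('a set \<Rightarrow> nat) \<Rightarrow> 'v qpoly" where "xmon e = (\<Prod>F\<in>L. x F ^ e F)"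

lemma x_through_polys: "x_through i \<in> polys V" and x_above_polys: "x_above F \<in> polys V" and xmon_polys: "xmon e \<in> polys V"
  unfolding x_through_def x_above_def xmon_def by (auto intro!: polys_sum polys_prod polys_power x_polys)

lemma x_through_split:
  "i \<in> G \<Longrightarrow> x_through i = x_above G + (\<Sum>H | H \<in> L \<and> i \<in> H \<and> \<not> G \<subseteq> H. x H)"
proof -
  assume i: "i \<in> G"
  have "{H. H \<in> L \<and> i \<in> H} = {H. H \<in> L \<and> G \<subseteq> H} \<union> {H. H \<in> L \<and> i \<in> H \<and> \<not> G \<subseteq> H}" using i by auto
  then show ?thesis unfolding x_through_def x_above_def using finite_L
    by (subst sum.union_disjoint[symmetric]) auto
qed

text \<open>
One factor is replaced with the help of a vector \<open>i\<close> in \<open>G\<close> but not in \<open>F\<close>: \<open>x_F\<close> kills the sum of all \<open>x_H\<close> with \<open>i \<in> H\<close>,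
so it may be subtracted. What remains are products \<open>x_F x_H\<close> with \<open>H\<close> not above \<open>G\<close>; either they vanish
or \<open>H\<close> contains both \<open>F\<close> and \<open>i\<close>, and then \<open>H\<close> meets \<open>G\<close> in a larger flat than \<open>F\<close> does.
\<close>

lemma x_times_x_above_power:
  assumes "F \<in> L" "G \<in> L" "\<not> G \<subseteq> F" "rk G \<le> rk (F \<inter> G) + k"
  shows "x F * x_above G ^ k \<in> I"
  using assms
proof (induction k arbitrary: F)
  case 0
  have "rk (F \<inter> G) < rk G" by (rule rk_strict_mono0) (use 0 Int_L in auto)
  then show ?case using 0 by simp
next
  case (Suc k)
  obtain i where i: "i \<in> G" "i \<notin> F" using Suc.prems by auto
  let ?S = "\<Sum>H | H \<in> L \<and> i \<in> H \<and> \<not> G \<subseteq> H. x H"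
  have iE: "i \<in> E" using i Suc.prems L_sub_E by blast
  have 1: "x_above G ^ k * (x F * x_through i) \<in> I"
    using ideal_I(4)[OF rel_linear[OF Suc.prems(1) iE i(2)] polys_power[OF x_above_polys]] by (simp add: x_through_def)
  have 2: "x F * x_above G ^ k * x H \<in> I" if H: "H \<in> L" "i \<in> H" "\<not> G \<subseteq> H" for H
  proof (cases "F \<subseteq> H")
    case True
    have "rk (F \<inter> G) < rk (H \<inter> G)"
      by (rule rk_strict_mono0[OF Int_L]) (use H Suc.prems i True Int_L[of H G] in auto)
    then have "x H * x_above G ^ k \<in> I" using Suc.IH[of H] H Suc.prems by simp
    then have "x F * (x H * x_above G ^ k) \<in> I" using ideal_I(4) x_polys Suc.prems by blast
    then show ?thesis by (simp add: mult_ac)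
  next
    case False
    then have "incomparable F H" using H i by (auto simp: incomparable_def)
    then have "x_above G ^ k * (x F * x H) \<in> I"
      by (intro ideal_I(4) rel_incomparable polys_power x_above_polys) (use Suc.prems H in auto)
    then show ?thesis by (simp add: mult_ac)
  qed
  have "x F * x_above G ^ k * ?S \<in> I" unfolding sum_distrib_left by (rule ideal_sum[OF I]) (use 2 in auto)
  then have "x_above G ^ k * (x F * x_through i) - x F * x_above G ^ k * ?S \<in> I" using 1 ideal_I(6) by blast
  also have "x_above G ^ k * (x F * x_through i) - x F * x_above G ^ k * ?S = x F * x_above G ^ Suc k"
    unfolding x_through_split[OF i(1)] by (simp add: algebra_simps)
  finally show ?case .
qed

text \<open>
The same relation with the empty flat in place of \<open>F\<close>; the exponent reflects its virtual rank \<open>- \<epsilon>\<close>.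
\<close>

lemma x_above_power:
  assumes "G \<in> L" shows "x_above G ^ (rk G + \<epsilon>) \<in> I"
proof -
  have "G \<noteq> {}" using assms by (simp add: L_def)
  then obtain i where i: "i \<in> G" by auto
  have iE: "i \<in> E" using i assms L_sub_E by blast
  define S where "S = (\<Sum>H | H \<in> L \<and> i \<in> H \<and> \<not> G \<subseteq> H. x H)"
  define a where "a = x_above G ^ (rk G - 1)"
  have aP: "a \<in> polys V" by (simp add: a_def polys_power x_above_polys)
  have SP: "S \<in> polys V" unfolding S_def by (intro polys_sum x_polys) auto
  have "x H * a \<in> I" if H: "H \<in> L" "i \<in> H" "\<not> G \<subseteq> H" for H
    unfolding a_def
  proof (rule x_times_x_above_power[OF H(1) assms H(3)])
    have "H \<inter> G \<in> L" using Int_L[OF H(1) assms] H i by auto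
    then show "rk G \<le> rk (H \<inter> G) + (rk G - 1)" using rk_pos[of "H \<inter> G"] by simp
  qed
  then have Sa: "S * a \<in> I" unfolding S_def sum_distrib_right by (intro ideal_sum[OF I]) auto
  have hS: "x_above G = x_through i - S" using x_through_split[OF i] by (simp add: S_def)
  have hp: "x_through i ^ Suc \<epsilon> \<in> I" using rel_power[OF iE] by (simp add: x_through_def)
  have "a * x_above G ^ Suc \<epsilon> \<in> I"
  proof (cases "\<epsilon> = 0")
    case True
    then have "a * x_through i \<in> I" using ideal_I(4)[OF hp aP] by simp
    then have "a * x_through i - S * a \<in> I" using Sa by (rule ideal_I(6))
    then show ?thesis using True by (simp add: hS algebra_simps)
  next
    case False
    then have e: "\<epsilon> = 1" using eps by simp
    have "a * x_through i ^ 2 \<in> I" using ideal_I(4)[OF hp aP] e by (simp add: numeral_2_eq_2)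
    moreover have "(x_through i + x_through i - S) * (S * a) \<in> I" by (intro ideal_I(4)[OF Sa] polys_closed x_through_polys SP)
    ultimately have "a * x_through i ^ 2 - (x_through i + x_through i - S) * (S * a) \<in> I" by (rule ideal_I(6))
    then show ?thesis using e by (simp add: hS algebra_simps power2_eq_square)
  qed
  moreover have "a * x_above G ^ Suc \<epsilon> = x_above G ^ (rk G + \<epsilon>)"
  proof -
    have "rk G - 1 + Suc \<epsilon> = rk G + \<epsilon>" using rk_pos[OF assms] by simp
    then show ?thesis unfolding a_def power_add[symmetric] by simp
  qed
  ultimately show ?thesis by simp
qed

text \<open>
The rational span of the monomials of degree \<open>j\<close> and weight at least \<open>w\<close>.
\<close>

inductive_set heavy :: "nat \<Rightarrow> nat \<Rightarrow> 'v qpoly set" for j w where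
  zero: "0 \<in> heavy j w"
| step: "p \<in> heavy j w \<Longrightarrow> wdeg e = j \<Longrightarrow> (\<And>F. F \<notin> L \<Longrightarrow> e F = 0) \<Longrightarrow> w \<le> wrk e \<Longrightarrow> p + scal c * xmon e \<in> heavy j w"

lemma heavy_mono: "p \<in> heavy j w \<Longrightarrow> w' \<le> w \<Longrightarrow> p \<in> heavy j w'"
  by (induction rule: heavy.induct) (auto intro: heavy.intros)

lemma heavy_polys: "p \<in> heavy j w \<Longrightarrow> p \<in> polys V"
  by (induction rule: heavy.induct) (auto intro!: polys_closed xmon_polys)

lemma heavy_add: "p \<in> heavy j w \<Longrightarrow> p' \<in> heavy j w \<Longrightarrow> p + p' \<in> heavy j w"
proof (induction rule: heavy.induct)
  case (step p e c)
  have "(p + p') + scal c * xmon e \<in> heavy j w" by (rule heavy.step) (use step in auto)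
  then show ?case by (simp add: add_ac)
qed simp

lemma heavy_sum: "(\<And>i. i \<in> A \<Longrightarrow> g i \<in> heavy j w) \<Longrightarrow> sum g A \<in> heavy j w"
  by (induction A rule: infinite_finite_induct) (auto intro: heavy_add heavy.zero)

lemma heavy_monomial:
  "wdeg e = j \<Longrightarrow> (\<And>F. F \<notin> L \<Longrightarrow> e F = 0) \<Longrightarrow> w \<le> wrk e \<Longrightarrow> scal c * xmon e \<in> heavy j w"
  using heavy.step[OF heavy.zero, of e j w c] by simp

lemma xmon_add: "xmon (\<lambda>F. e F + e' F) = xmon e * xmon e'"
  by (simp add: xmon_def power_add prod.distrib)

lemma wdeg_add: "wdeg (\<lambda>F. e F + e' F) = wdeg e + wdeg e'"
  by (simp add: wdeg_def sum.distrib)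

lemma wrk_add: "wrk (\<lambda>F. e F + e' F) = wrk e + wrk e'"
  by (simp add: wrk_def sum.distrib distrib_right)

lemma heavy_mult_monomial:
  assumes "wdeg e = i" "\<And>F. F \<notin> L \<Longrightarrow> e F = 0" "w \<le> wrk e" "p \<in> heavy j w'"
  shows "scal c * xmon e * p \<in> heavy (i + j) (w + w')"
  using assms(4)
proof (induction rule: heavy.induct)
  case zero
  show ?case by (simp add: heavy.zero)
next
  case (step p e' c')
  have "scal c * xmon e * p + scal (c * c') * xmon (\<lambda>F. e F + e' F) \<in> heavy (i + j) (w + w')"
    by (rule heavy.step) (use step assms in \<open>auto simp: wdeg_add wrk_add\<close>)
  then show ?case unfolding xmon_add scal_mult by (simp add: algebra_simps)
qed

lemma heavy_mult: "p \<in> heavy i w \<Longrightarrow> p' \<in> heavy j w' \<Longrightarrow> p * p' \<in> heavy (i + j) (w + w')"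
proof (induction rule: heavy.induct)
  case (step p e c)
  then have "p * p' + scal c * xmon e * p' \<in> heavy (i + j) (w + w')"
    by (intro heavy_add heavy_mult_monomial) auto
  then show ?case by (simp add: distrib_right)
qed (simp add: heavy.zero)

lemma heavy_1: "1 \<in> heavy 0 0"
  using heavy_monomial[of "\<lambda>_. 0" 0 0 1] by (simp add: xmon_def wdeg_def wrk_def)

lemma heavy_power: "p \<in> heavy j w \<Longrightarrow> p ^ k \<in> heavy (k * j) (k * w)"
  by (induction k) (auto intro: heavy_1 heavy_mult)

lemma heavy_scal: "p \<in> heavy j w \<Longrightarrow> scal c * p \<in> heavy j w"
  using heavy_mult_monomial[of "\<lambda>_. 0" 0 0 p j w c] by (simp add: xmon_def wdeg_def wrk_def)

lemma single_exponent:
  assumes "F \<in> L"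
  shows "xmon (\<lambda>G. if G = F then k else 0) = x F ^ k" "wdeg (\<lambda>G. if G = F then k else 0) = k"
    "wrk (\<lambda>G. if G = F then k else 0) = k * rk F"
proof -
  have "(\<Prod>G\<in>L. x G ^ (if G = F then k else 0)) = (\<Prod>G\<in>L. if G = F then x F ^ k else 1)"
    by (rule prod.cong) auto
  then show "xmon (\<lambda>G. if G = F then k else 0) = x F ^ k"
    using assms finite_L by (simp add: xmon_def)
  show "wdeg (\<lambda>G. if G = F then k else 0) = k"
    using assms finite_L by (simp add: wdeg_def)
  have "(\<Sum>G\<in>L. (if G = F then k else 0) * rk G) = (\<Sum>G\<in>L. if G = F then k * rk F else 0)"
    by (rule sum.cong) auto
  then show "wrk (\<lambda>G. if G = F then k else 0) = k * rk F"
    using assms finite_L by (simp add: wrk_def)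
qed

lemma heavy_x: "F \<in> L \<Longrightarrow> x F \<in> heavy 1 (rk F)"
proof -
  assume F: "F \<in> L"
  have "scal 1 * xmon (\<lambda>G. if G = F then 1 else 0) \<in> heavy 1 (rk F)"
    by (rule heavy_monomial) (use F single_exponent[OF F, of 1] in auto)
  then show ?thesis using single_exponent(1)[OF F, of 1] by simp
qed

text \<open>
Every term of the difference contains at least one \<open>x_G\<close> with \<open>G\<close> strictly above \<open>F\<close>.
\<close>

lemma straighten_power:
  assumes "F \<in> L"
  shows "x_above F ^ k - x F ^ k \<in> heavy k (k * rk F + 1)"
proof (cases k)
  case 0
  then show ?thesis by (simp add: heavy.zero)
next
  case (Suc m)
  have "{G. G \<in> L \<and> F \<subseteq> G} = insert F {G. G \<in> L \<and> F \<subset> G}" using assms by auto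
  then have d: "x_above F - x F = (\<Sum>G | G \<in> L \<and> F \<subset> G. x G)"
    unfolding x_above_def using finite_L by simp
  have 1: "x_above F - x F \<in> heavy 1 (rk F + 1)"
    unfolding d
  proof (rule heavy_sum)
    fix G assume "G \<in> {G. G \<in> L \<and> F \<subset> G}"
    then show "x G \<in> heavy 1 (rk F + 1)" using heavy_x[of G] heavy_mono rk_strict_mono[of F G] assms by fastforce
  qed
  have 2: "x_above F \<in> heavy 1 (rk F)"
    using heavy_add[OF heavy_mono[OF 1] heavy_x[OF assms]] by simp
  have "x_above F ^ k - x F ^ k = (x_above F - x F) * (\<Sum>i<k. x F ^ (k - Suc i) * x_above F ^ i)"
    by (rule power_diff_sumr2)
  also have "\<dots> \<in> heavy (1 + m) ((rk F + 1) + m * rk F)"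
  proof (rule heavy_mult[OF 1 heavy_sum])
    fix i assume "i \<in> {..<k}"
    then have i: "k - Suc i + i = m" using Suc by simp
    have "x F ^ (k - Suc i) * x_above F ^ i \<in> heavy ((k - Suc i) * 1 + i * 1) ((k - Suc i) * rk F + i * rk F)"
      by (intro heavy_mult heavy_power heavy_x assms 2)
    then show "x F ^ (k - Suc i) * x_above F ^ i \<in> heavy m (m * rk F)"
      using i by (simp add: distrib_right[symmetric])
  qed
  finally show ?thesis using Suc by (simp add: algebra_simps)
qed

text \<open>
If the support is a chain, some flat \<open>F\<close> carries at least the exponent \<open>k\<close> of one of the two power
relations for \<open>F\<close>, which lets \<open>x_F ^ k\<close> be replaced by heavier terms.
\<close>

lemma straighten:
  assumes e0: "\<And>F. F \<notin> L \<Longrightarrow> e F = 0" and "\<not> admissible \<epsilon> e"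
  shows "\<exists>t\<in>heavy (wdeg e) (wrk e + 1). xmon e - t \<in> I"
proof (cases "is_chain e")
  case False
  then obtain F G where FG: "F \<in> supp e" "G \<in> supp e" "\<not> F \<subseteq> G" "\<not> G \<subseteq> F"
    unfolding is_chain_def by blast
  then have L: "F \<in> L" "G \<in> L" "F \<noteq> G" by (auto simp: supp_def)
  have "xmon e = (\<Prod>H\<in>L - {F} - {G}. x H ^ e H) * (x F ^ (e F - 1) * x G ^ (e G - 1)) * (x F * x G)"
  proof -
    have "xmon e = x F ^ e F * (x G ^ e G * (\<Prod>H\<in>L - {F} - {G}. x H ^ e H))"
      unfolding xmon_def using L finite_L
      by (subst prod.remove[of _ F]; simp; subst prod.remove[of _ G]; simp)
    moreover have "x F ^ e F = x F ^ (e F - 1) * x F" "x G ^ e G = x G ^ (e G - 1) * x G"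
      using FG power_minus_mult[of "e F" "x F"] power_minus_mult[of "e G" "x G"] by (simp_all add: supp_def)
    ultimately show ?thesis by (simp add: mult_ac)
  qed
  also have "\<dots> \<in> I"
    by (intro ideal_I(4) rel_incomparable polys_mult polys_prod polys_power x_polys)
      (use L FG in \<open>auto simp: incomparable_def\<close>)
  finally show ?thesis using heavy.zero by (intro bexI[of _ 0]) auto
next
  case True
  then obtain F where F: "F \<in> supp e"
    and viol: "rk F + \<epsilon> \<le> e F \<or> (\<exists>G\<in>supp e. G \<subset> F \<and> rk F \<le> e F + rk G)"
    using assms unfolding admissible_def by (metis not_le)
  have FL: "F \<in> L" using F by (simp add: supp_def)
  define good where "good k e' = (k \<le> e F \<and> e' = (\<lambda>G. if G = F then e F - k else e G) \<and> xmon e' * x_above F ^ k \<in> I)" for k e'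
  \<comment> \<open>The relation used is \<open>x_above_power\<close> or \<open>x_times_x_above_power\<close>, according to which bound is violated.\<close>
  have "\<exists>k e'. good k e'"
    using viol
  proof
    assume "rk F + \<epsilon> \<le> e F"
    then have "good (rk F + \<epsilon>) (\<lambda>G. if G = F then e F - (rk F + \<epsilon>) else e G)"
      unfolding good_def using ideal_I(4)[OF x_above_power[OF FL] xmon_polys] by simp
    then show ?thesis by blast
  next
    assume "\<exists>G\<in>supp e. G \<subset> F \<and> rk F \<le> e F + rk G"
    then obtain G where G: "G \<in> supp e" "G \<subset> F" "rk F \<le> e F + rk G" by blast
    have GL: "G \<in> L" using G by (simp add: supp_def)
    define k where "k = rk F - rk G"
    define e' where "e' = (\<lambda>H. if H = F then e F - k else e H)"
    have "xmon e' = x G * (x G ^ (e' G - 1) * (\<Prod>H\<in>L - {G}. x H ^ e' H))"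
    proof -
      have "xmon e' = x G ^ e' G * (\<Prod>H\<in>L - {G}. x H ^ e' H)"
        unfolding xmon_def using GL finite_L by (simp add: prod.remove)
      moreover have "0 < e' G" using G by (auto simp: e'_def supp_def)
      then have "x G ^ e' G = x G * x G ^ (e' G - 1)" by (simp add: power_eq_if)
      ultimately show ?thesis by (simp add: mult_ac)
    qed
    moreover have "x G * x_above F ^ k \<in> I"
    proof (rule x_times_x_above_power[OF GL FL])
      show "\<not> F \<subseteq> G" using G by auto
      have "G \<inter> F = G" using G by auto
      then show "rk F \<le> rk (G \<inter> F) + k" by (simp add: k_def)
    qed
    ultimately have "xmon e' * x_above F ^ k \<in> I"
      using ideal_I(4)[of "x G * x_above F ^ k" "x G ^ (e' G - 1) * (\<Prod>H\<in>L - {G}. x H ^ e' H)"]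
      by (auto simp: mult_ac intro!: polys_mult polys_power polys_prod x_polys GL)
    moreover have "k \<le> e F" using G(3) by (simp add: k_def)
    ultimately have "good k e'" by (simp add: good_def e'_def)
    then show ?thesis by blast
  qed
  then obtain k e' where k: "k \<le> e F" and e': "e' = (\<lambda>G. if G = F then e F - k else e G)"
    and inI: "xmon e' * x_above F ^ k \<in> I" by (auto simp: good_def)
  have e_eq: "e = (\<lambda>G. e' G + (if G = F then k else 0))" using k by (auto simp: e')
  have xe: "xmon e = xmon e' * x F ^ k"
    by (subst e_eq) (simp only: xmon_add single_exponent(1)[OF FL])
  have de: "wdeg e = wdeg e' + k" "wrk e = wrk e' + k * rk F"
    by (subst e_eq, simp only: wdeg_add wrk_add single_exponent[OF FL])+
  have "scal 1 * xmon e' * (x_above F ^ k - x F ^ k) \<in> heavy (wdeg e' + k) (wrk e' + (k * rk F + 1))"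
    by (rule heavy_mult_monomial[OF _ _ _ straighten_power[OF FL]]) (use e0 e' FL in auto)
  then have t: "xmon e' * (x_above F ^ k - x F ^ k) \<in> heavy (wdeg e) (wrk e + 1)" by (simp add: de algebra_simps)
  have "scal (-1) * (xmon e' * (x_above F ^ k - x F ^ k)) \<in> heavy (wdeg e) (wrk e + 1)" using t by (rule heavy_scal)
  moreover have "xmon e - scal (-1) * (xmon e' * (x_above F ^ k - x F ^ k)) = xmon e' * x_above F ^ k"
    by (simp add: xe single_uminus algebra_simps)
  ultimately show ?thesis using inI by force
qed

definition spanned :: "nat \<Rightarrow> 'v qpoly set" where
  "spanned j = {p. \<exists>c. p - (\<Sum>e\<in>admissibles \<epsilon> j. scal (c e) * xmon e) \<in> I}"

lemma spanned_I: "p \<in> I \<Longrightarrow> p \<in> spanned j"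
  unfolding spanned_def by (auto intro!: exI[of _ "\<lambda>_. 0"])

lemma spanned_add: "p \<in> spanned j \<Longrightarrow> p' \<in> spanned j \<Longrightarrow> p + p' \<in> spanned j"
proof -
  assume "p \<in> spanned j" "p' \<in> spanned j"
  then obtain c c' where "p - (\<Sum>e\<in>admissibles \<epsilon> j. scal (c e) * xmon e) \<in> I"
    "p' - (\<Sum>e\<in>admissibles \<epsilon> j. scal (c' e) * xmon e) \<in> I" by (auto simp: spanned_def)
  then have "(p - (\<Sum>e\<in>admissibles \<epsilon> j. scal (c e) * xmon e)) + (p' - (\<Sum>e\<in>admissibles \<epsilon> j. scal (c' e) * xmon e)) \<in> I"
    by (rule ideal_I(3))
  then have "(p + p') - (\<Sum>e\<in>admissibles \<epsilon> j. scal (c e + c' e) * xmon e) \<in> I"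
    by (simp add: scal_add distrib_right sum.distrib algebra_simps)
  then show ?thesis unfolding spanned_def by (intro CollectI exI[of _ "\<lambda>e. c e + c' e"])
qed

lemma spanned_scal: "p \<in> spanned j \<Longrightarrow> scal a * p \<in> spanned j"
proof -
  assume "p \<in> spanned j"
  then obtain c where "p - (\<Sum>e\<in>admissibles \<epsilon> j. scal (c e) * xmon e) \<in> I" by (auto simp: spanned_def)
  then have "scal a * (p - (\<Sum>e\<in>admissibles \<epsilon> j. scal (c e) * xmon e)) \<in> I" by (rule ideal_I(4)) simp
  then have "scal a * p - (\<Sum>e\<in>admissibles \<epsilon> j. scal (a * c e) * xmon e) \<in> I"
    by (simp add: right_diff_distrib sum_distrib_left scal_mult mult.assoc)
  then show ?thesis unfolding spanned_def by (intro CollectI exI[of _ "\<lambda>e. a * c e"])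
qed

lemma spanned_sum: "(\<And>i. i \<in> A \<Longrightarrow> g i \<in> spanned j) \<Longrightarrow> sum g A \<in> spanned j"
  by (induction A rule: infinite_finite_induct) (auto intro: spanned_add spanned_I ideal_I(2))

text \<open>
Straightening terminates because the weight of a monomial of degree \<open>j\<close> is at most \<open>r * j\<close>.
\<close>

lemma xmon_spanned:
  assumes "\<And>F. F \<notin> L \<Longrightarrow> e F = 0" "wdeg e = j"
  shows "xmon e \<in> spanned j"
  using assms
proof (induction "r * j - wrk e" arbitrary: e rule: less_induct)
  case less
  show ?case
  proof (cases "admissible \<epsilon> e")
    case True
    then have e: "e \<in> admissibles \<epsilon> j" using less.prems by (simp add: admissibles_def)
    have "(\<Sum>e'\<in>admissibles \<epsilon> j. scal (if e' = e then 1 else 0) * xmon e') = xmon e"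
      using e finite_admissibles by (subst sum.remove[OF finite_admissibles e]) simp
    then show ?thesis unfolding spanned_def using ideal_I(2) by (intro CollectI exI[of _ "\<lambda>e'. if e' = e then 1 else 0"]) simp
  next
    case False
    obtain t where t: "t \<in> heavy (wdeg e) (wrk e + 1)" "xmon e - t \<in> I"
      using straighten[OF less.prems(1) False] by blast
    have "t \<in> spanned j" using t(1)
    proof (induction rule: heavy.induct)
      case zero
      show ?case using spanned_I ideal_I(2) by blast
    next
      case (step p e' c)
      have "wrk e' \<le> r * j"
      proof -
        have "wrk e' \<le> (\<Sum>F\<in>L. e' F * r)" unfolding wrk_def by (intro sum_mono mult_left_mono rk_le_r) auto
        also have "\<dots> = wdeg e' * r" unfolding wdeg_def sum_distrib_right ..
        finally show ?thesis using step(2) less.prems(2) by (simp add: mult.commute)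
      qed
      then have "r * j - wrk e' < r * j - wrk e" using step(4) by simp
      then have "xmon e' \<in> spanned j" using less.hyps[of e'] step less.prems by simp
      then show ?case using step by (intro spanned_add spanned_scal) auto
    qed
    then have "t + (xmon e - t) \<in> spanned j" using spanned_I[OF t(2)] by (rule spanned_add)
    then show ?thesis by simp
  qed
qed

lemma heavy_spanned: "p \<in> heavy j w \<Longrightarrow> p \<in> spanned j"
proof (induction rule: heavy.induct)
  case (step p e c)
  then show ?case by (intro spanned_add spanned_scal xmon_spanned) auto
qed (auto intro: spanned_I ideal_I(2))

text \<open>
The polynomials that modulo the ideal are homogeneous of degree \<open>j\<close> in the \<open>x F\<close>; they allow the passage from
the variables of the ring to these elements.
\<close>

definition reducible :: "nat \<Rightarrow> 'v qpoly set" where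
  "reducible j = {p \<in> polys V. \<exists>t\<in>heavy j 0. p - t \<in> I}"

lemma reducible_mult: "p \<in> reducible i \<Longrightarrow> p' \<in> reducible j \<Longrightarrow> p * p' \<in> reducible (i + j)"
proof -
  assume "p \<in> reducible i" "p' \<in> reducible j"
  then obtain t t' where t: "p \<in> polys V" "t \<in> heavy i 0" "p - t \<in> I" "p' \<in> polys V" "t' \<in> heavy j 0" "p' - t' \<in> I"
    by (auto simp: reducible_def)
  have "p * (p' - t') + t' * (p - t) \<in> I" by (intro ideal_I(3) ideal_I(4) t heavy_polys[OF t(5)])
  then have "p * p' - t * t' \<in> I" by (simp add: algebra_simps)
  moreover have "t * t' \<in> heavy (i + j) 0" using heavy_mult[OF t(2,5)] by simp
  ultimately show ?thesis using t by (auto simp: reducible_def intro: polys_mult)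
qed

lemma reducible_1: "1 \<in> reducible 0"
  using heavy_1 ideal_I(2) by (auto simp: reducible_def intro!: bexI[of _ 1])

lemma reducible_var: "v \<in> V \<Longrightarrow> var v \<in> reducible 1"
proof -
  assume v: "v \<in> V"
  then obtain c where c: "var v - (\<Sum>F\<in>L. scal (c F) * x F) \<in> I" using gens by blast
  have "(\<Sum>F\<in>L. scal (c F) * x F) \<in> heavy 1 0" by (intro heavy_sum heavy_scal heavy_mono[OF heavy_x]) auto
  then show ?thesis using c v by (auto simp: reducible_def polys_var)
qed

lemma reducible_power:
  assumes "p \<in> reducible j" shows "p ^ k \<in> reducible (k * j)"
proof (induction k)
  case (Suc k)
  then show ?case using reducible_mult[OF assms Suc] by simp
qed (simp add: reducible_1)

lemma reducible_prod: "finite A \<Longrightarrow> (\<And>i. i \<in> A \<Longrightarrow> g i \<in> reducible (d i)) \<Longrightarrow> prod g A \<in> reducible (sum d A)"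
proof (induction A rule: finite_induct)
  case (insert a A)
  then show ?case using reducible_mult[of "g a" "d a" "prod g A" "sum d A"] by simp
qed (simp add: reducible_1)

lemma homogeneous_spanned: "p \<in> homogeneous V j \<Longrightarrow> p \<in> spanned j"
proof -
  assume p: "p \<in> homogeneous V j"
  have "Poly_Mapping.single m c \<in> spanned j" if m: "m \<in> Poly_Mapping.keys p" for m c
  proof -
    have sub: "Poly_Mapping.keys m \<subseteq> V" using polysD[OF homogeneous_polys[OF p] m] .
    have "mon_eval var m \<in> reducible (\<Sum>v\<in>Poly_Mapping.keys m. Poly_Mapping.lookup m v * 1)"
      unfolding mon_eval_def
    proof (rule reducible_prod)
      fix v assume "v \<in> Poly_Mapping.keys m"
      then have "var v \<in> reducible 1" using sub by (intro reducible_var) auto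
      from reducible_power[OF this]
      show "var v ^ Poly_Mapping.lookup m v \<in> reducible (Poly_Mapping.lookup m v * 1)" .
    qed simp
    moreover have "(\<Sum>v\<in>Poly_Mapping.keys m. Poly_Mapping.lookup m v * 1) = j"
      using p m by (simp add: homogeneous_iff mdeg_def)
    ultimately obtain t where t: "t \<in> heavy j 0" "mon_eval var m - t \<in> I" by (auto simp: reducible_def)
    have "t + (mon_eval var m - t) \<in> spanned j" by (intro spanned_add heavy_spanned[OF t(1)] spanned_I t(2))
    then have "scal c * mon_eval var m \<in> spanned j" by (intro spanned_scal) simp
    then show ?thesis by (subst single_scal)
  qed
  then show ?thesis by (subst qpoly_expand) (rule spanned_sum)
qed

lemma degree_map_monomial:
  assumes "\<And>F. F \<notin> L \<Longrightarrow> e F = 0"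
  shows "degree_map \<epsilon> (psubst f (xmon e)) = of_int (deg_mon (1 - int \<epsilon>) e)"
proof -
  define m where "m = (\<Sum>F\<in>L. Poly_Mapping.single F (e F))"
  have lm: "Poly_Mapping.lookup m = e"
  proof
    fix F show "Poly_Mapping.lookup m F = e F"
      using assms[of F] finite_L by (cases "F \<in> L") (auto simp: m_def lookup_sum lookup_single when_def)
  qed
  have "psubst f (xmon e) = (\<Prod>F\<in>L. var F ^ e F)"
    by (simp add: xmon_def psubst_prod psubst_power subst_x)
  also have "\<dots> = mon_eval var m"
  proof -
    have "Poly_Mapping.keys m \<subseteq> L" using assms by (force simp: in_keys_iff lm)
    then show ?thesis using mon_eval_superset[OF finite_L, of m var] by (simp add: lm)
  qed
  finally show ?thesis
    by (simp add: degree_map_def var_mon_eval coefficients.lin_ext_single[OF coefficients_id] lm)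
qed

text \<open>
In a relation between admissible monomials, take the lexicographically smallest one that occurs and
multiply by its dual: by triangularity the functional sees no other term.
\<close>

lemma admissible_independent:
  assumes "(\<Sum>e\<in>admissibles \<epsilon> j. scal (c e) * xmon e) \<in> I" "e \<in> admissibles \<epsilon> j"
  shows "c e = 0"
proof (rule ccontr)
  assume "c e \<noteq> 0"
  let ?N = "admissibles \<epsilon> j"
  define w where "w e = (\<Sum>G\<in>L. e G * Suc j ^ rk G)" for e
  let ?A = "{e \<in> ?N. c e \<noteq> 0}"
  have "finite ?A" and "?A \<noteq> {}" using finite_admissibles assms \<open>c e \<noteq> 0\<close> by auto
  \<comment> \<open>The base \<open>j + 1\<close> of the weight exceeds the total degree \<open>j\<close>.\<close>
  define e0 where "e0 = arg_min_on w ?A"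
  have e0: "e0 \<in> ?A" "\<And>e'. e' \<in> ?A \<Longrightarrow> w e0 \<le> w e'"
    unfolding e0_def using arg_min_if_finite[OF \<open>finite ?A\<close> \<open>?A \<noteq> {}\<close>, of w]
    by (simp, meson not_le)
  have adm: "admissible \<epsilon> e0" using e0 by (simp add: admissibles_def)
  have outside: "e' F = 0" if "e' \<in> ?N" "F \<notin> L" for e' F
    using that by (simp add: admissibles_def admissible_def)
  have vanish: "c e' * of_int (deg_mon (1 - int \<epsilon>) (\<lambda>F. e' F + dual \<epsilon> e0 F)) = 0" if e': "e' \<in> ?N" "e' \<noteq> e0" for e'
  proof (rule ccontr)
    assume ne: "\<not> ?thesis"
    then have "c e' \<noteq> 0" by auto
    have "lex_less e' e0 \<or> (\<forall>G\<in>L. e' G = e0 G)"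
      using deg_mon_dual_triangular[OF adm] ne by auto
    then show False
    proof
      assume "lex_less e' e0"
      then have "w e' < w e0" unfolding w_def
        by (rule lex_less_measure) (use e' in \<open>simp add: admissibles_def wdeg_def\<close>)
      then show False using e0(2)[of e'] e' \<open>c e' \<noteq> 0\<close> by simp
    next
      assume same: "\<forall>G\<in>L. e' G = e0 G"
      have "e' F = e0 F" for F
        using same outside[OF e'(1), of F] outside[of e0 F] e0(1) by (cases "F \<in> L") auto
      then have "e' = e0" ..
      then show False using e' by simp
    qed
  qed
  have "xmon (dual \<epsilon> e0) * (\<Sum>e\<in>?N. scal (c e) * xmon e) \<in> I" by (rule ideal_I(4)[OF assms(1) xmon_polys])
  then have "0 = degree_map \<epsilon> (psubst f (xmon (dual \<epsilon> e0) * (\<Sum>e\<in>?N. scal (c e) * xmon e)))"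
    by (simp add: degree_map_I)
  also have "xmon (dual \<epsilon> e0) * (\<Sum>e\<in>?N. scal (c e) * xmon e) = (\<Sum>e\<in>?N. scal (c e) * xmon (\<lambda>F. e F + dual \<epsilon> e0 F))"
    unfolding xmon_add by (simp add: sum_distrib_left mult_ac)
  also have "degree_map \<epsilon> (psubst f \<dots>) = (\<Sum>e\<in>?N. c e * degree_map \<epsilon> (psubst f (xmon (\<lambda>F. e F + dual \<epsilon> e0 F))))"
    by (simp add: psubst_sum psubst_mult psubst_scal degree_map_def coefficients.lin_ext_sum[OF coefficients_id]
        coefficients.lin_ext_scal_mult[OF coefficients_id])
  also have "\<dots> = (\<Sum>e\<in>?N. c e * of_int (deg_mon (1 - int \<epsilon>) (\<lambda>F. e F + dual \<epsilon> e0 F)))"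
    by (intro sum.cong refl arg_cong2[of _ _ _ _ "(*)"] degree_map_monomial) (simp add: outside dual_outside)
  also have "\<dots> = c e0 * of_int (deg_mon (1 - int \<epsilon>) (\<lambda>F. e0 F + dual \<epsilon> e0 F))"
    using e0(1) vanish sum.neutral[of "?N - {e0}"]
    by (subst sum.remove[OF finite_admissibles, of e0]) (simp_all del: mult_eq_0_iff)
  finally show False using e0(1) deg_mon_dual_nonzero[OF adm] by simp
qed

theorem dim_piece_admissibles:
  "vectorspace.dim class_ring ((quotient_algebra V I)\<lparr>carrier := piece (quotient_algebra V I) j\<rparr>) =
     card (admissibles \<epsilon> j)"
proof (rule dim_piece[OF I finite_admissibles])
  fix e assume e: "e \<in> admissibles \<epsilon> j"
  have "xmon e \<in> homogeneous V (\<Sum>F\<in>L. e F * 1)"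
    unfolding xmon_def by (intro homogeneous_prod homogeneous_power x_hom finite_L)
  then show "xmon e \<in> homogeneous V j" using e by (simp add: admissibles_def wdeg_def)
next
  fix p assume "p \<in> homogeneous V j"
  from homogeneous_spanned[OF this] show "\<exists>c. p - (\<Sum>e\<in>admissibles \<epsilon> j. scal (c e) * xmon e) \<in> I"
    by (simp add: spanned_def)
qed (rule admissible_independent)

end

section \<open>The Chow ring and the augmented Chow ring\<close>

lemma genideal_subset:
  assumes "ideal K (qpoly_ring V)" "S \<subseteq> K"
  shows "Idl\<^bsub>qpoly_ring V\<^esub> S \<subseteq> K"
  using ring.genideal_minimal[OF cring.axioms(1)[OF cring_qpoly_ring] assms] .

lemma genideal_facts:
  assumes "S \<subseteq> polys V"
  shows "ideal (Idl\<^bsub>qpoly_ring V\<^esub> S) (qpoly_ring V)" "S \<subseteq> Idl\<^bsub>qpoly_ring V\<^esub> S"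
  using ring.genideal_ideal[OF cring.axioms(1)[OF cring_qpoly_ring] assms]
    ring.genideal_self[OF cring.axioms(1)[OF cring_qpoly_ring] assms] .

lemma ideal_add:
  assumes "ideal I (qpoly_ring V)" "ideal J (qpoly_ring V)"
  shows "ideal (I <+>\<^bsub>qpoly_ring V\<^esub> J) (qpoly_ring V)"
    "I \<subseteq> I <+>\<^bsub>qpoly_ring V\<^esub> J" "J \<subseteq> I <+>\<^bsub>qpoly_ring V\<^esub> J"
    "\<And>K. ideal K (qpoly_ring V) \<Longrightarrow> I \<subseteq> K \<Longrightarrow> J \<subseteq> K \<Longrightarrow> I <+>\<^bsub>qpoly_ring V\<^esub> J \<subseteq> K"
proof -
  show "ideal (I <+>\<^bsub>qpoly_ring V\<^esub> J) (qpoly_ring V)"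
    using ring.add_ideals[OF cring.axioms(1)[OF cring_qpoly_ring] assms] .
  have mem: "I <+>\<^bsub>qpoly_ring V\<^esub> J = {a + b |a b. a \<in> I \<and> b \<in> J}"
    by (auto simp: set_add_def')
  show "I \<subseteq> I <+>\<^bsub>qpoly_ring V\<^esub> J"
  proof
    fix a assume "a \<in> I"
    then show "a \<in> I <+>\<^bsub>qpoly_ring V\<^esub> J"
      unfolding mem using ideal_polys(2)[OF assms(2)] by (intro CollectI exI[of _ a] exI[of _ 0]) simp
  qed
  show "J \<subseteq> I <+>\<^bsub>qpoly_ring V\<^esub> J"
  proof
    fix a assume "a \<in> J"
    then show "a \<in> I <+>\<^bsub>qpoly_ring V\<^esub> J"
      unfolding mem using ideal_polys(2)[OF assms(1)] by (intro CollectI exI[of _ 0] exI[of _ a]) simp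
  qed
  show "I <+>\<^bsub>qpoly_ring V\<^esub> J \<subseteq> K" if "ideal K (qpoly_ring V)" "I \<subseteq> K" "J \<subseteq> K" for K
    unfolding mem using that ideal_polys(3)[OF that(1)] by blast
qed

context truncation begin

definition var_through :: "'a \<Rightarrow> 'a set qpoly" where "var_through i = (\<Sum>G | G \<in> L \<and> i \<in> G. var G)"

lemma degree_map_add: "degree_map \<epsilon> (p + p') = degree_map \<epsilon> p + degree_map \<epsilon> p'"
  and degree_map_sum: "degree_map \<epsilon> (sum g A) = (\<Sum>i\<in>A. degree_map \<epsilon> (g i))"
  and degree_map_uminus: "degree_map \<epsilon> (- p) = - degree_map \<epsilon> p"
  and degree_map_diff: "degree_map \<epsilon> (p - p') = degree_map \<epsilon> p - degree_map \<epsilon> p'"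
  and degree_map_0: "degree_map \<epsilon> 0 = 0"
  unfolding degree_map_def
  by (simp_all add: coefficients.lin_ext_add[OF coefficients_id] coefficients.lin_ext_sum[OF coefficients_id]
    coefficients.lin_ext_uminus[OF coefficients_id] coefficients.lin_ext_diff[OF coefficients_id]
    coefficients.lin_ext_0[OF coefficients_id])

lemma degree_map_single:
  "degree_map \<epsilon> (Poly_Mapping.single m c) = c * of_int (deg_mon (1 - int \<epsilon>) (Poly_Mapping.lookup m))"
  unfolding degree_map_def by (rule coefficients.lin_ext_single[OF coefficients_id])

lemma lookup_bump: "Poly_Mapping.lookup (Poly_Mapping.single F 1 + m) = bump (Poly_Mapping.lookup m) F"
  by (auto simp: lookup_add lookup_single when_def fun_eq_iff)

lemma var_single: "var F * Poly_Mapping.single m c = Poly_Mapping.single (Poly_Mapping.single F 1 + m) c"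
  by (simp add: var_def mult_single)

text \<open>
It suffices to test a product against single monomials.
\<close>

lemma vanish_by_monomials:
  assumes "\<And>m c. degree_map \<epsilon> (p * Poly_Mapping.single m c) = 0"
  shows "degree_map \<epsilon> (p * p') = 0"
  by (subst qpoly_expand[of p']) (simp add: sum_distrib_left degree_map_sum assms)

lemma degree_map_incomparable:
  assumes "F \<in> L" "G \<in> L" "incomparable F G"
  shows "degree_map \<epsilon> (var F * var G * p) = 0"
proof (rule vanish_by_monomials)
  fix m c
  have "F \<in> supp (bump (bump (Poly_Mapping.lookup m) G) F)" "G \<in> supp (bump (bump (Poly_Mapping.lookup m) G) F)"
    using assms by (simp_all add: supp_def)
  then have "\<not> is_chain (bump (bump (Poly_Mapping.lookup m) G) F)"
    using assms(3) unfolding is_chain_def incomparable_def by blast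
  then show "degree_map \<epsilon> (var F * var G * Poly_Mapping.single m c) = 0"
    unfolding mult.assoc var_single degree_map_single lookup_bump by (simp add: deg_mon_def)
qed

lemma degree_map_through_single:
  assumes "i \<in> E" "\<epsilon> \<le> 1"
  shows "degree_map \<epsilon> (var_through i * Poly_Mapping.single m c) =
    (if \<epsilon> = 0 \<or> (\<exists>F\<in>supp (Poly_Mapping.lookup m). i \<notin> F) then 0 else - degree_map 0 (Poly_Mapping.single m c))"
proof -
  have "degree_map \<epsilon> (var_through i * Poly_Mapping.single m c) =
      c * of_int (\<Sum>G | G \<in> L \<and> i \<in> G. deg_mon (1 - int \<epsilon>) (bump (Poly_Mapping.lookup m) G))"
    unfolding var_through_def sum_distrib_right degree_map_sum var_single degree_map_single lookup_bump
    by (simp add: sum_distrib_left)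
  also have "(\<Sum>G | G \<in> L \<and> i \<in> G. deg_mon (1 - int \<epsilon>) (bump (Poly_Mapping.lookup m) G)) =
     (if 1 - int \<epsilon> = 1 \<or> (\<exists>F\<in>supp (Poly_Mapping.lookup m). i \<notin> F) then 0 else - deg_mon 1 (Poly_Mapping.lookup m))"
    by (rule deg_mon_linear_relation[OF assms(1)]) (use assms(2) in auto)
  finally show ?thesis by (simp add: degree_map_single)
qed

lemma degree_map_var_through:
  assumes "F \<in> L" "i \<in> E" "i \<notin> F" "\<epsilon> \<le> 1"
  shows "degree_map \<epsilon> (var_through i * var F * p) = 0"
proof (rule vanish_by_monomials)
  fix m c
  have "F \<in> supp (Poly_Mapping.lookup (Poly_Mapping.single F 1 + m))"
    unfolding lookup_bump using assms by (simp add: supp_bump)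
  then show "degree_map \<epsilon> (var_through i * var F * Poly_Mapping.single m c) = 0"
    unfolding mult.assoc var_single using degree_map_through_single[OF assms(2,4)] assms(3) by auto
qed

lemma degree_map_through: "i \<in> E \<Longrightarrow> degree_map 0 (var_through i * p) = 0"
  by (rule vanish_by_monomials) (simp add: degree_map_through_single)

text \<open>
The first factor \<open>h_i\<close> turns the functional into minus the functional of the Chow ring, and that one is killed by
the second.
\<close>

lemma degree_map_through_through:
  assumes "i \<in> E" shows "degree_map 1 (var_through i * var_through i * p) = 0"
proof (rule vanish_by_monomials)
  fix m :: "'a set \<Rightarrow>\<^sub>0 nat" and c :: rat
  let ?s = "Poly_Mapping.single m c"
  have "degree_map 1 (var_through i * (var G * ?s)) =
      (if \<exists>F\<in>supp (Poly_Mapping.lookup m). i \<notin> F then 0 else - degree_map 0 (var G * ?s))" if "G \<in> L" "i \<in> G" for G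
    unfolding var_single degree_map_through_single[OF assms order_refl] lookup_bump using that by (simp add: supp_bump)
  then have "(\<Sum>G | G \<in> L \<and> i \<in> G. degree_map 1 (var_through i * (var G * ?s))) = (\<Sum>G | G \<in> L \<and> i \<in> G.
      (if \<exists>F\<in>supp (Poly_Mapping.lookup m). i \<notin> F then 0 else - degree_map 0 (var G * ?s)))"
    by (intro sum.cong) auto
  also have "\<dots> = (if \<exists>F\<in>supp (Poly_Mapping.lookup m). i \<notin> F then 0 else - degree_map 0 (var_through i * ?s))"
    by (simp add: var_through_def sum_distrib_right degree_map_sum sum_negf)
  also have "\<dots> = 0" using degree_map_through[OF assms] by simp
  also have "(\<Sum>G | G \<in> L \<and> i \<in> G. degree_map 1 (var_through i * (var G * ?s))) = degree_map 1 (var_through i * var_through i * ?s)"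
  proof -
    have "var_through i * ?s = (\<Sum>G | G \<in> L \<and> i \<in> G. var G * ?s)" by (simp add: var_through_def sum_distrib_right)
    then show ?thesis unfolding mult.assoc[of "var_through i" "var_through i"] by (simp add: sum_distrib_left degree_map_sum)
  qed
  finally show "degree_map 1 (var_through i * var_through i * ?s) = 0" .
qed

text \<open>
The largest ideal on which the functional vanishes after substitution. To see that a sum of generated
ideals is killed it is enough to find the generators in it.
\<close>

definition vanishing :: "nat \<Rightarrow> 'v set \<Rightarrow> ('v \<Rightarrow> 'a set qpoly) \<Rightarrow> 'v qpoly set" where
  "vanishing \<epsilon> V f = {p \<in> polys V. \<forall>p'. degree_map \<epsilon> (psubst f p * p') = 0}"

lemma ideal_vanishing: "ideal (vanishing \<epsilon> V f) (qpoly_ring V)"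
proof (rule idealI)
  interpret R: cring "qpoly_ring V" by (rule cring_qpoly_ring)
  show "ring (qpoly_ring V)" by (rule R.ring_axioms)
  have neg: "- p \<in> vanishing \<epsilon> V f" if "p \<in> vanishing \<epsilon> V f" for p
    using that by (simp add: vanishing_def polys_uminus psubst_uminus degree_map_uminus)
  show "subgroup (vanishing \<epsilon> V f) (add_monoid (qpoly_ring V))"
  proof (rule R.add.subgroupI)
    show "vanishing \<epsilon> V f \<noteq> {}"
    proof -
      have "0 \<in> vanishing \<epsilon> V f" by (simp add: vanishing_def psubst_def lin_ext_def degree_map_0)
      then show ?thesis by blast
    qed
    fix p assume p: "p \<in> vanishing \<epsilon> V f"
    then have "\<ominus>\<^bsub>qpoly_ring V\<^esub> p = - p"
      by (intro R.minus_equality) (auto simp: vanishing_def polys_uminus)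
    then show "\<ominus>\<^bsub>qpoly_ring V\<^esub> p \<in> vanishing \<epsilon> V f" using neg[OF p] by simp
  next
    fix p p' assume "p \<in> vanishing \<epsilon> V f" "p' \<in> vanishing \<epsilon> V f"
    then show "p \<oplus>\<^bsub>qpoly_ring V\<^esub> p' \<in> vanishing \<epsilon> V f"
      by (simp add: vanishing_def polys_add psubst_add distrib_right degree_map_add)
  qed (auto simp: vanishing_def)
  fix a p assume ap: "a \<in> vanishing \<epsilon> V f" "p \<in> polys V"
  have *: "psubst f (p * a) * b = psubst f a * (psubst f p * b)" for b
    by (simp add: psubst_mult mult_ac)
  then have "p * a \<in> vanishing \<epsilon> V f" using ap by (simp add: vanishing_def polys_mult)
  then show "p \<otimes>\<^bsub>qpoly_ring V\<^esub> a \<in> vanishing \<epsilon> V f" "a \<otimes>\<^bsub>qpoly_ring V\<^esub> p \<in> vanishing \<epsilon> V f"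
    by (simp_all add: mult.commute)
qed

lemma vanishing_degree_map: "p \<in> vanishing \<epsilon> V f \<Longrightarrow> degree_map \<epsilon> (psubst f p) = 0"
  unfolding vanishing_def using mult_1_right by (metis (mono_tags, lifting) mem_Collect_eq)

definition truncated_matroid :: "'a matroid" where "truncated_matroid = \<lparr>ground = E, flats = insert {} L\<rparr>"

lemma L_nonempty: "{} \<notin> L" by (simp add: L_def)

lemma chow_presentation:
  obtains I where "chow_ring truncated_matroid = quotient_algebra L I" "presentation P E q dm r L I 0 var var"
proof -
  let ?R = "qpoly_ring L"
  define S1 where "S1 = {var F * var G |F G. F \<in> L \<and> G \<in> L \<and> incomparable F G}"
  define S2 where "S2 = {(\<Sum>F | F \<in> L \<and> i \<in> F. var F) |i. i \<in> E}"
  define I where "I = Idl\<^bsub>?R\<^esub> S1 <+>\<^bsub>?R\<^esub> Idl\<^bsub>?R\<^esub> S2"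
  have eq: "chow_ring truncated_matroid = quotient_algebra L I"
    using L_nonempty by (simp add: chow_ring_def truncated_matroid_def I_def S1_def S2_def Let_def)
  have sub: "S1 \<subseteq> polys L" "S2 \<subseteq> polys L"
    by (auto simp: S1_def S2_def intro!: polys_closed)
  note g1 = genideal_facts[OF sub(1)] and g2 = genideal_facts[OF sub(2)]
  note a = ideal_add[OF g1(1) g2(1)]
  have I: "ideal I ?R" using a(1) by (simp add: I_def)
  have S1I: "S1 \<subseteq> I" and S2I: "S2 \<subseteq> I" using a(2,3) g1(2) g2(2) by (auto simp: I_def)
  have hI: "(\<Sum>G | G \<in> L \<and> i \<in> G. var G) \<in> I" if "i \<in> E" for i using S2I that by (auto simp: S2_def)
  have psv: "psubst var p = p" if "p \<in> S1 \<union> S2" for p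
    using that by (auto simp: S1_def S2_def psubst_mult psubst_var psubst_sum)
  have "S1 \<subseteq> vanishing 0 L var"
    using sub(1) psv degree_map_incomparable by (fastforce simp: vanishing_def S1_def)
  moreover have "S2 \<subseteq> vanishing 0 L var"
    using sub(2) psv degree_map_through by (fastforce simp: vanishing_def S2_def var_through_def)
  ultimately have IV: "I \<subseteq> vanishing 0 L var"
    unfolding I_def by (intro a(4) ideal_vanishing genideal_subset)
  have "presentation P E q dm r L I 0 var var"
  proof (intro presentation.intro presentation_axioms.intro truncation_axioms)
    show "ideal I ?R" by (rule I)
    show "(0::nat) \<le> 1" by simp
    show "F \<in> L \<Longrightarrow> var F \<in> homogeneous L 1" for F by (rule homogeneous_var)
    show "\<exists>c. var v - (\<Sum>F\<in>L. scal (c F) * var F) \<in> I" if "v \<in> L" for v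
    proof -
      have "(\<Sum>F\<in>L. scal (if F = v then 1 else 0) * var F) = (\<Sum>F\<in>L. if F = v then var v else 0)"
        by (rule sum.cong) auto
      then have "var v - (\<Sum>F\<in>L. scal (if F = v then 1 else 0) * var F) = 0" using that finite_L by simp
      then show ?thesis using ideal_polys(2)[OF I] by (intro exI[of _ "\<lambda>F. if F = v then 1 else 0"]) simp
    qed
    show "var F * var G \<in> I" if "F \<in> L" "G \<in> L" "incomparable F G" for F G
      using S1I that by (auto simp: S1_def)
    show "var F * (\<Sum>G | G \<in> L \<and> i \<in> G. var G) \<in> I" if "F \<in> L" "i \<in> E" "i \<notin> F" for F i
      by (rule ideal_polys(4)[OF I hI polys_var]) (use that in auto)
    show "(\<Sum>G | G \<in> L \<and> i \<in> G. var G) ^ Suc 0 \<in> I" if "i \<in> E" for i using hI[OF that] by simp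
    show "degree_map 0 (psubst var p) = 0" if "p \<in> I" for p
      using IV that by (blast intro: vanishing_degree_map)
    show "psubst var (var F) = var F" for F by (rule psubst_var)
  qed
  then show ?thesis using that eq by blast
qed

text \<open>
Here \<open>x_E\<close> is minus the sum of all variables \<open>X F\<close>. With this choice \<open>h_i\<close> equals minus the sum of the
\<open>X F\<close> with \<open>i \<notin> F\<close>, so \<open>h_i + y_i\<close> lies in the ideal, and the relations \<open>x_F h_i\<close> and
\<open>h_i ^ 2\<close> follow from \<open>y_i x_F = 0\<close>.
\<close>

lemma augmented_presentation:
  obtains V I x f where "augmented_chow_ring truncated_matroid = quotient_algebra (V :: 'a aug_var set) I" "presentation P E q dm r V I 1 x f"
proof -
  define Q where "Q = insert {} L - {E}"
  define V where "V = X ` Q \<union> Y ` E"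
  let ?R = "qpoly_ring V"
  define S1 where "S1 = {var (X F) * var (X G) |F G. F \<in> Q \<and> G \<in> Q \<and> incomparable F G}"
  define S2 where "S2 = {var (Y i) * var (X F) |i F. i \<in> E \<and> F \<in> Q \<and> i \<notin> F}"
  define S3 where "S3 = {var (Y i) - (\<Sum>F | F \<in> Q \<and> i \<notin> F. var (X F)) |i. i \<in> E}"
  define I where "I = Idl\<^bsub>?R\<^esub> S1 <+>\<^bsub>?R\<^esub> Idl\<^bsub>?R\<^esub> S2 <+>\<^bsub>?R\<^esub> Idl\<^bsub>?R\<^esub> S3"
  define x where "x F = (if F = E then - (\<Sum>G\<in>Q. var (X G)) else var (X F))" for F
  define f where "f v = (case v of X F \<Rightarrow> if F = {} then - (\<Sum>G\<in>L. var G) else var F | Y i \<Rightarrow> - var_through i)" for v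
  have eq: "augmented_chow_ring truncated_matroid = quotient_algebra V I"
    by (simp add: augmented_chow_ring_def truncated_matroid_def I_def S1_def S2_def S3_def V_def Q_def Let_def)
  have XV: "F \<in> Q \<Longrightarrow> X F \<in> V" and YV: "i \<in> E \<Longrightarrow> Y i \<in> V" for F i by (auto simp: V_def)
  have sub: "S1 \<subseteq> polys V" "S2 \<subseteq> polys V" "S3 \<subseteq> polys V"
    using XV YV by (auto simp: S1_def S2_def S3_def intro!: polys_closed)
  note g1 = genideal_facts[OF sub(1)] and g2 = genideal_facts[OF sub(2)] and g3 = genideal_facts[OF sub(3)]
  note a12 = ideal_add[OF g1(1) g2(1)]
  note a = ideal_add[OF a12(1) g3(1)]
  have I: "ideal I ?R" using a(1) by (simp add: I_def)
  have S1I: "S1 \<subseteq> I" and S2I: "S2 \<subseteq> I" and S3I: "S3 \<subseteq> I"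
    using a(2,3) a12(2,3) g1(2) g2(2) g3(2) by (auto simp: I_def)
  have finQ: "finite Q" using finite_L by (simp add: Q_def)
  have LQ: "L = insert E (Q - {{}})" "E \<notin> Q - {{}}" using E_L L_nonempty by (auto simp: Q_def)
  have E_ne: "E \<noteq> {}" using E_L L_nonempty by auto
  have Q0: "{} \<in> Q" using E_ne by (auto simp: Q_def)
  have xQ: "x F = var (X F)" if "F \<in> Q - {{}}" for F using that by (auto simp: x_def Q_def)
  have hx: "(\<Sum>G | G \<in> L \<and> i \<in> G. x G) = - (\<Sum>F | F \<in> Q \<and> i \<notin> F. var (X F))" if "i \<in> E" for i
  proof -
    have "{G. G \<in> L \<and> i \<in> G} = insert E {G \<in> Q. i \<in> G}" using LQ that by auto
    moreover have "E \<notin> {G \<in> Q. i \<in> G}" by (simp add: Q_def)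
    ultimately have "(\<Sum>G | G \<in> L \<and> i \<in> G. x G) = x E + (\<Sum>G\<in>{G \<in> Q. i \<in> G}. x G)"
      using finQ by simp
    also have "(\<Sum>G\<in>{G \<in> Q. i \<in> G}. x G) = (\<Sum>G\<in>{G \<in> Q. i \<in> G}. var (X G))"
      by (intro sum.cong refl xQ) auto
    also have "x E = - ((\<Sum>G\<in>{G \<in> Q. i \<in> G}. var (X G)) + (\<Sum>G\<in>{G \<in> Q. i \<notin> G}. var (X G)))"
    proof -
      have "Q = {G \<in> Q. i \<in> G} \<union> {G \<in> Q. i \<notin> G}" by auto
      then have "(\<Sum>G\<in>Q. var (X G)) = (\<Sum>G\<in>{G \<in> Q. i \<in> G} \<union> {G \<in> Q. i \<notin> G}. var (X G))" by simp
      also have "\<dots> = (\<Sum>G\<in>{G \<in> Q. i \<in> G}. var (X G)) + (\<Sum>G\<in>{G \<in> Q. i \<notin> G}. var (X G))"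
        by (rule sum.union_disjoint) (use finQ in auto)
      finally show ?thesis by (simp add: x_def)
    qed
    finally show ?thesis by simp
  qed
  have XY: "var (Y i) * var (X F) \<in> I" if "i \<in> E" "F \<in> Q" "i \<notin> F" for i F
    using S2I that by (auto simp: S2_def)
  have hY: "(\<Sum>G | G \<in> L \<and> i \<in> G. x G) + var (Y i) \<in> I" if "i \<in> E" for i
    using S3I that unfolding hx[OF that] by (auto simp: S3_def)
  have xP: "x F \<in> polys V" if "F \<in> L" for F
    using that XV LQ by (auto simp: x_def intro!: polys_closed)
  have fX: "f (X F) = var F" if "F \<in> Q - {{}}" for F using that by (simp add: f_def)
  have f0: "f (X {}) = - (\<Sum>G\<in>L. var G)" and fY: "f (Y i) = - var_through i" for i by (simp_all add: f_def)
  have sumL: "(\<Sum>G\<in>L. g G) = g E + (\<Sum>G\<in>Q - {{}}. g G)" for g :: "'a set \<Rightarrow> 'b::comm_monoid_add"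
    using LQ finQ by (metis finite_Diff sum.insert)
  have "S1 \<subseteq> vanishing 1 V f"
  proof
    fix p assume p: "p \<in> S1"
    then obtain F G where FG: "p = var (X F) * var (X G)" "F \<in> Q - {{}}" "G \<in> Q - {{}}" "incomparable F G"
      by (auto simp: S1_def incomparable_def)
    then have "psubst f p = var F * var G" by (simp add: psubst_mult psubst_var fX)
    then show "p \<in> vanishing 1 V f"
      using p sub(1) FG LQ degree_map_incomparable by (auto simp: vanishing_def)
  qed
  moreover have "S2 \<subseteq> vanishing 1 V f"
  proof
    fix p assume p: "p \<in> S2"
    then obtain i F where iF: "p = var (Y i) * var (X F)" "i \<in> E" "F \<in> Q" "i \<notin> F" by (auto simp: S2_def)
    have ps: "psubst f p = - (var_through i * f (X F))" by (simp add: iF(1) psubst_mult psubst_var fY)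
    have "degree_map 1 (var_through i * f (X F) * p') = 0" for p'
    proof (cases "F = {}")
      case False
      then show ?thesis using degree_map_var_through[of F i 1 p'] iF LQ fX by auto
    next
      case True
      have "(\<Sum>G\<in>L. var G) = var_through i + (\<Sum>G | G \<in> L \<and> i \<notin> G. var G)"
        unfolding var_through_def using finite_L by (subst sum.union_disjoint[symmetric]) (auto intro!: sum.cong)
      moreover have "(\<Sum>G | G \<in> L \<and> i \<notin> G. var_through i * var G * p') = var_through i * (\<Sum>G | G \<in> L \<and> i \<notin> G. var G) * p'"
        by (simp add: sum_distrib_left sum_distrib_right)
      ultimately have "var_through i * f (X F) * p' = - (var_through i * var_through i * p' + (\<Sum>G | G \<in> L \<and> i \<notin> G. var_through i * var G * p'))"
        using True by (simp add: f0 algebra_simps)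
      then show ?thesis
        using degree_map_through_through[OF iF(2)] degree_map_var_through[OF _ iF(2)]
        by (simp add: degree_map_uminus degree_map_diff degree_map_sum)
    qed
    then show "p \<in> vanishing 1 V f" using p sub(2) by (auto simp: vanishing_def ps degree_map_uminus)
  qed
  moreover have "S3 \<subseteq> vanishing 1 V f"
  proof
    fix p assume p: "p \<in> S3"
    then obtain i where i: "p = var (Y i) - (\<Sum>F | F \<in> Q \<and> i \<notin> F. var (X F))" "i \<in> E" by (auto simp: S3_def)
    have "{F. F \<in> Q \<and> i \<notin> F} = insert {} {F. F \<in> L \<and> i \<notin> F}" "{} \<notin> {F. F \<in> L \<and> i \<notin> F}"
      using LQ Q0 i(2) L_nonempty by auto
    then have "(\<Sum>F | F \<in> Q \<and> i \<notin> F. f (X F)) = f (X {}) + (\<Sum>F | F \<in> L \<and> i \<notin> F. f (X F))"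
      using finite_L by simp
    also have "(\<Sum>F | F \<in> L \<and> i \<notin> F. f (X F)) = (\<Sum>F | F \<in> L \<and> i \<notin> F. var F)"
      by (rule sum.cong) (use L_nonempty in \<open>auto simp: f_def\<close>)
    also have "f (X {}) = - (var_through i + (\<Sum>G | G \<in> L \<and> i \<notin> G. var G))"
      unfolding f0 var_through_def using finite_L by (subst sum.union_disjoint[symmetric]) (auto intro!: sum.cong)
    finally have "psubst f p = 0" by (simp add: i(1) psubst_diff psubst_sum psubst_var fY)
    then show "p \<in> vanishing 1 V f" using p sub(3) by (auto simp: vanishing_def degree_map_0)
  qed
  ultimately have IV: "I \<subseteq> vanishing 1 V f"
    unfolding I_def by (intro a(4) a12(4) ideal_vanishing genideal_subset)
  have "presentation P E q dm r V I 1 x f"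
  proof (intro presentation.intro presentation_axioms.intro truncation_axioms)
    show "ideal I ?R" by (rule I)
    show "(1::nat) \<le> 1" by simp
    show "x F \<in> homogeneous V 1" if "F \<in> L" for F
    proof (cases "F = E")
      case True
      then show ?thesis unfolding x_def
        by (simp only: if_True refl) (intro homogeneous_uminus homogeneous_sum homogeneous_var XV)
    next
      case False
      then show ?thesis unfolding x_def using that LQ
        by (simp only: if_False) (intro homogeneous_var XV, auto)
    qed
    show "\<exists>c. var v - (\<Sum>F\<in>L. scal (c F) * x F) \<in> I" if v: "v \<in> V" for v
    proof -
      consider "v = X {}" | F where "v = X F" "F \<in> Q - {{}}" | i where "v = Y i" "i \<in> E"
        using v Q0 by (auto simp: V_def)
      then show ?thesis
      proof cases
        case 1
        have "(\<Sum>F\<in>L. scal (-1) * x F) = - (\<Sum>F\<in>L. x F)"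
          by (simp add: single_uminus sum_negf)
        also have "(\<Sum>F\<in>L. x F) = - (\<Sum>G\<in>Q. var (X G)) + (\<Sum>G\<in>Q - {{}}. var (X G))"
          unfolding sumL by (simp add: x_def[of E] xQ)
        also have "\<dots> = - var (X {})" using Q0 finQ by (simp add: sum.remove)
        finally show ?thesis using ideal_polys(2)[OF I] 1 by (intro exI[of _ "\<lambda>_. -1"]) simp
      next
        case 2
        have FL: "F \<in> L" using 2 LQ by auto
        have "(\<Sum>G\<in>L. scal (if G = F then 1 else 0) * x G) = (\<Sum>G\<in>L. if G = F then x F else 0)"
          by (rule sum.cong) auto
        then have "var v - (\<Sum>G\<in>L. scal (if G = F then 1 else 0) * x G) = 0"
          using FL finite_L 2 xQ by simp
        then show ?thesis using ideal_polys(2)[OF I] by (intro exI[of _ "\<lambda>G. if G = F then 1 else 0"]) simp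
      next
        case 3
        have "(\<Sum>G\<in>L. scal (if i \<in> G then -1 else 0) * x G) = - (\<Sum>G | G \<in> L \<and> i \<in> G. x G)"
        proof -
          have "(\<Sum>G\<in>L. scal (if i \<in> G then -1 else 0) * x G) = (\<Sum>G\<in>L. if i \<in> G then - x G else 0)"
            by (rule sum.cong) (auto simp: single_uminus)
          also have "\<dots> = (\<Sum>G\<in>{G \<in> L. i \<in> G}. - x G)" using finite_L by (simp add: sum.inter_filter)
          finally show ?thesis by (simp add: sum_negf)
        qed
        then have "var v - (\<Sum>G\<in>L. scal (if i \<in> G then -1 else 0) * x G) = (\<Sum>G | G \<in> L \<and> i \<in> G. x G) + var (Y i)"
          using 3 by simp
        then show ?thesis using hY[OF 3(2)] by (intro exI[of _ "\<lambda>G. if i \<in> G then -1 else 0"]) simp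
      qed
    qed
    show "x F * x G \<in> I" if "F \<in> L" "G \<in> L" "incomparable F G" for F G
    proof -
      have "F \<in> Q - {{}}" "G \<in> Q - {{}}"
        using that LQ L_sub_E by (auto simp: incomparable_def)
      then show ?thesis using S1I that by (auto simp: S1_def xQ)
    qed
    show "x F * (\<Sum>G | G \<in> L \<and> i \<in> G. x G) \<in> I" if F: "F \<in> L" "i \<in> E" "i \<notin> F" for F i
    proof -
      have FQ: "F \<in> Q - {{}}" using F LQ by auto
      have "x F * ((\<Sum>G | G \<in> L \<and> i \<in> G. x G) + var (Y i)) - var (Y i) * var (X F) \<in> I"
        by (intro ideal_polys(6)[OF I] ideal_polys(4)[OF I] hY XY xP) (use F FQ in auto)
      then show ?thesis by (simp add: xQ[OF FQ] distrib_left mult.commute)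
    qed
    show "(\<Sum>G | G \<in> L \<and> i \<in> G. x G) ^ Suc 1 \<in> I" if i: "i \<in> E" for i
    proof -
      let ?h = "\<Sum>G | G \<in> L \<and> i \<in> G. x G"
      have hp: "?h \<in> polys V" by (intro polys_sum xP) auto
      have "var (Y i) * ?h = - (\<Sum>F | F \<in> Q \<and> i \<notin> F. var (Y i) * var (X F))"
        unfolding hx[OF i] by (simp add: sum_distrib_left)
      also have "\<dots> \<in> I" by (intro ideal_polys(5)[OF I] ideal_sum[OF I] XY) (use i in auto)
      finally have "?h * (?h + var (Y i)) - var (Y i) * ?h \<in> I"
        by (rule ideal_polys(6)[OF I ideal_polys(4)[OF I hY[OF i] hp]])
      then show ?thesis by (simp add: algebra_simps)
    qed
    show "degree_map 1 (psubst f p) = 0" if "p \<in> I" for p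
      using IV that by (blast intro: vanishing_degree_map)
    show "psubst f (x F) = var F" if "F \<in> L" for F
    proof (cases "F = E")
      case True
      have "(\<Sum>G\<in>Q. f (X G)) = f (X {}) + (\<Sum>G\<in>Q - {{}}. f (X G))"
        using Q0 finQ by (simp add: sum.remove)
      also have "(\<Sum>G\<in>Q - {{}}. f (X G)) = (\<Sum>G\<in>Q - {{}}. var G)" by (rule sum.cong) (auto simp: f_def)
      also have "f (X {}) = - (var E + (\<Sum>G\<in>Q - {{}}. var G))" unfolding f0 sumL ..
      finally show ?thesis using True by (simp add: x_def psubst_uminus psubst_sum psubst_var)
    next
      case False
      then show ?thesis using that LQ fX[of F] xQ[of F] by (auto simp: psubst_var)
    qed
  qed
  then show ?thesis using that eq by blast
qed

end

section \<open>The Hilbert series at minus one\<close>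

lemma alternating_sum: "1 \<le> m \<Longrightarrow> (\<Sum>a\<in>{1..<m}. (-1::int) ^ a) = (if even m then -1 else 0)"
proof (induction m rule: nat_induct_at_least)
  case (Suc m)
  then have "{1..<Suc m} = insert m {1..<m}" by auto
  then show ?case using Suc by auto
qed simp

context truncation begin

definition hilbert_poly :: "nat \<Rightarrow> int poly" where
  "hilbert_poly \<epsilon> = Abs_poly (\<lambda>j. int (card (admissibles \<epsilon> j)))"

lemma Hilb_chow_ring: "Hilb (chow_ring truncated_matroid) = hilbert_poly 0"
proof -
  obtain I where eq: "chow_ring truncated_matroid = quotient_algebra L I" and "presentation P E q dm r L I 0 var var"
    by (rule chow_presentation)
  then show ?thesis
    unfolding Hilb_def hilbert_poly_def eq by (simp add: presentation.dim_piece_admissibles)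
qed

lemma Hilb_augmented_chow_ring: "Hilb (augmented_chow_ring truncated_matroid) = hilbert_poly 1"
proof -
  obtain V I x f where eq: "augmented_chow_ring truncated_matroid = quotient_algebra (V :: 'a aug_var set) I"
    and "presentation P E q dm r V I 1 x f"
    by (rule augmented_presentation)
  then show ?thesis
    unfolding Hilb_def hilbert_poly_def eq by (simp add: presentation.dim_piece_admissibles)
qed

text \<open>
The exponents are bounded by the rank differences along the chain, whose sum telescopes.
\<close>

lemma sum_below_bound:
  assumes "admissible \<epsilon> e" "U \<in> L"
  shows "int (\<Sum>F\<in>below e U. e F) \<le> prev_rk \<epsilon> e U + int \<epsilon>"
  using assms(2)
proof (induction "card U" arbitrary: U rule: less_induct)
  case less
  show ?case
  proof (cases "below e U = {}")
    case True
    then show ?thesis by (simp add: prev_rk_empty)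
  next
    case False
    obtain F where F: "F \<in> below e U" "\<And>H. H \<in> below e U \<Longrightarrow> H \<subseteq> F"
      using chain_below_top[OF _ False] assms(1) unfolding admissible_def by metis
    have FL: "F \<in> L" "F \<subset> U" "F \<in> supp e" using below_L[OF F(1)] F(1) by (auto simp: below_def)
    have "below e U = insert F (below e F)" using F FL(2) by (auto simp: below_def)
    moreover have "F \<notin> below e F" by (simp add: below_def)
    ultimately have "(\<Sum>F\<in>below e U. e F) = e F + (\<Sum>F\<in>below e F. e F)"
      by (simp add: finite_below)
    moreover have "card F < card U"
      using FL(2) finite_in_P[OF L_P[OF less.prems]] by (rule psubset_card_mono[rotated])
    then have "int (\<Sum>F\<in>below e F. e F) \<le> prev_rk \<epsilon> e F + int \<epsilon>" using less.hyps FL(1) by blast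
    moreover have "int (e F) + prev_rk \<epsilon> e F < int (dm F)"
      using admissible_bound[OF assms(1) FL(3)] dm_below[OF F(1) less.prems] by simp
    ultimately show ?thesis using prev_rk_top[OF F, of \<epsilon>] by simp
  qed
qed

lemma wdeg_bound:
  assumes "admissible \<epsilon> e"
  shows "wdeg e < r + \<epsilon>"
proof -
  have "wdeg e = e E + (\<Sum>F\<in>L - {E}. e F)"
    unfolding wdeg_def using E_L finite_L by (simp add: sum.remove)
  also have "(\<Sum>F\<in>L - {E}. e F) = (\<Sum>F\<in>below e E. e F)"
    by (rule sum.mono_neutral_right) (use finite_L L_sub_E in \<open>auto simp: below_def supp_def\<close>)
  finally have "int (wdeg e) \<le> int (e E) + (prev_rk \<epsilon> e E + int \<epsilon>)"
    using sum_below_bound[OF assms E_L] by simp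
  moreover have "0 \<le> int (dual \<epsilon> e E)" by simp
  ultimately show ?thesis using dual_E[OF assms] by linarith
qed

lemma coeff_hilbert_poly: "coeff (hilbert_poly \<epsilon>) j = int (card (admissibles \<epsilon> j))"
proof -
  have "int (card (admissibles \<epsilon> j)) = 0" if "r + \<epsilon> < j" for j
  proof -
    have "admissibles \<epsilon> j = {}" using that wdeg_bound by (force simp: admissibles_def)
    then show ?thesis by simp
  qed
  then show ?thesis unfolding hilbert_poly_def by (subst coeff_Abs_poly[of "r + \<epsilon>"]) auto
qed

text \<open>
The top degree is attained by the power of \<open>x_E\<close>.
\<close>

lemma degree_hilbert_poly: "\<epsilon> \<le> 1 \<Longrightarrow> degree (hilbert_poly \<epsilon>) = r - 1 + \<epsilon>"
proof (rule antisym)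
  show "degree (hilbert_poly \<epsilon>) \<le> r - 1 + \<epsilon>"
  proof (rule degree_le, intro allI impI)
    fix j assume "r - 1 + \<epsilon> < j"
    then have "admissibles \<epsilon> j = {}" using wdeg_bound r_ge_1 by (force simp: admissibles_def)
    then show "coeff (hilbert_poly \<epsilon>) j = 0" by (simp add: coeff_hilbert_poly)
  qed
  define e where "e = (\<lambda>F. if F = E then r - 1 + \<epsilon> else 0)"
  have "supp e \<subseteq> {E}" by (auto simp: supp_def e_def)
  then have "admissible \<epsilon> e"
    using E_L r_ge_1 unfolding admissible_def is_chain_def by (auto simp: e_def rk_def)
  moreover have "wdeg e = r - 1 + \<epsilon>" using E_L finite_L by (simp add: wdeg_def e_def)
  ultimately have "e \<in> admissibles \<epsilon> (r - 1 + \<epsilon>)" by (simp add: admissibles_def)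
  then have "card (admissibles \<epsilon> (r - 1 + \<epsilon>)) \<noteq> 0" using finite_admissibles by auto
  then show "r - 1 + \<epsilon> \<le> degree (hilbert_poly \<epsilon>)"
    by (intro le_degree) (simp add: coeff_hilbert_poly)
qed

definition all_admissible :: "nat \<Rightarrow> ('a set \<Rightarrow> nat) set" where
  "all_admissible \<epsilon> = {e. admissible \<epsilon> e}"

lemma finite_all_admissible: "finite (all_admissible \<epsilon>)"
proof -
  have "all_admissible \<epsilon> = (\<Union>j<r + \<epsilon>. admissibles \<epsilon> j)"
    using wdeg_bound by (auto simp: all_admissible_def admissibles_def)
  then show ?thesis by (simp add: finite_admissibles)
qed

lemma poly_hilbert_poly:
  assumes "\<epsilon> \<le> 1"
  shows "poly (hilbert_poly \<epsilon>) (-1) = (\<Sum>e\<in>all_admissible \<epsilon>. (-1) ^ wdeg e)"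
proof -
  have "(\<Sum>e\<in>all_admissible \<epsilon>. (-1::int) ^ wdeg e) =
    (\<Sum>j\<in>{..r - 1 + \<epsilon>}. \<Sum>e\<in>{e \<in> all_admissible \<epsilon>. wdeg e = j}. (-1) ^ wdeg e)"
  proof (rule sum.group[symmetric, OF finite_all_admissible])
    show "wdeg ` all_admissible \<epsilon> \<subseteq> {..r - 1 + \<epsilon>}"
    proof (intro image_subsetI)
      fix e assume "e \<in> all_admissible \<epsilon>"
      then have "wdeg e < r + \<epsilon>" by (intro wdeg_bound) (simp add: all_admissible_def)
      then show "wdeg e \<in> {..r - 1 + \<epsilon>}" using r_ge_1 by simp
    qed
  qed simp
  also have "\<dots> = (\<Sum>j\<in>{..r - 1 + \<epsilon>}. coeff (hilbert_poly \<epsilon>) j * (-1) ^ j)"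
    by (rule sum.cong) (auto simp: coeff_hilbert_poly all_admissible_def admissibles_def)
  finally show ?thesis by (simp add: poly_altdef degree_hilbert_poly[OF assms])
qed

definition chains :: "'a set set set" where
  "chains = {C. C \<subseteq> L \<and> (\<forall>F\<in>C. \<forall>G\<in>C. F \<subseteq> G \<or> G \<subseteq> F)}"

text \<open>
The rank of a flat of the chain minus the rank of its predecessor, which is \<open>- \<epsilon>\<close> for the first one.
\<close>

definition gap :: "nat \<Rightarrow> 'a set set \<Rightarrow> 'a set \<Rightarrow> int" where
  "gap \<epsilon> C F = int (rk F) - Max (insert (- int \<epsilon>) ((\<lambda>G. int (rk G)) ` {G \<in> C. G \<subset> F}))"

lemma finite_chains: "finite chains"
  by (rule finite_subset[of _ "Pow L"]) (auto simp: chains_def finite_L)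

lemma finite_chain: "C \<in> chains \<Longrightarrow> finite C"
  using finite_L finite_subset by (auto simp: chains_def)

lemma gap_iff:
  assumes "C \<in> chains" "F \<in> C"
  shows "int k < gap \<epsilon> C F \<longleftrightarrow> k < rk F + \<epsilon> \<and> (\<forall>G\<in>C. G \<subset> F \<longrightarrow> k + rk G < rk F)"
proof -
  let ?A = "insert (- int \<epsilon>) ((\<lambda>G. int (rk G)) ` {G \<in> C. G \<subset> F})"
  have "finite ?A" using finite_chain[OF assms(1)] by simp
  then have "Max ?A < int (rk F) - int k \<longleftrightarrow> (\<forall>x\<in>?A. x < int (rk F) - int k)"
    by (subst Max_less_iff) auto
  also have "\<dots> \<longleftrightarrow> k < rk F + \<epsilon> \<and> (\<forall>G\<in>C. G \<subset> F \<longrightarrow> k + rk G < rk F)" by auto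
  finally show ?thesis by (auto simp: gap_def)
qed

lemma gap_pos: "C \<in> chains \<Longrightarrow> F \<in> C \<Longrightarrow> 0 < gap \<epsilon> C F"
  using gap_iff[of C F 0 \<epsilon>] rk_pos rk_strict_mono by (auto simp: chains_def subset_iff)

text \<open>
For a fixed chain the exponents range independently over intervals \<open>{1..<gap}\<close>, so the sum factors.
\<close>

lemma sum_admissible_support:
  assumes C: "C \<in> chains"
  shows "(\<Sum>e | e \<in> all_admissible \<epsilon> \<and> supp e = C. (-1::int) ^ wdeg e) =
    (\<Prod>F\<in>C. if even (gap \<epsilon> C F) then -1 else 0)"
proof -
  let ?B = "\<lambda>F. {1..<nat (gap \<epsilon> C F)}"
  have CL: "C \<subseteq> L" using C by (simp add: chains_def)
  have chain: "is_chain e" if "supp e = C" for e using C that by (simp add: chains_def is_chain_def)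
  have adm: "e \<in> all_admissible \<epsilon> \<longleftrightarrow> (\<forall>F. F \<notin> L \<longrightarrow> e F = 0) \<and> (\<forall>F\<in>C. int (e F) < gap \<epsilon> C F)"
    if "supp e = C" for e
    using that chain[OF that] gap_iff[OF C] by (simp add: all_admissible_def admissible_def)
  have "(\<Sum>e | e \<in> all_admissible \<epsilon> \<and> supp e = C. (-1::int) ^ wdeg e) = (\<Sum>g\<in>PiE C ?B. \<Prod>F\<in>C. (-1) ^ g F)"
  proof (rule sum.reindex_bij_witness[where i = "\<lambda>g F. if F \<in> C then g F else 0" and j = "\<lambda>e. restrict e C"])
    fix e assume e: "e \<in> {e. e \<in> all_admissible \<epsilon> \<and> supp e = C}"
    have out: "e F = 0" if "F \<notin> C" for F
      using e that adm[of e] by (cases "F \<in> L") (auto simp: supp_def)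
    show "(\<lambda>F. if F \<in> C then restrict e C F else 0) = e" using out by auto
    have "0 < e F \<and> int (e F) < gap \<epsilon> C F" if "F \<in> C" for F
      using e that adm[of e] by (auto simp: supp_def)
    then show "restrict e C \<in> PiE C ?B" by force
    have "wdeg e = (\<Sum>F\<in>C. e F)"
      unfolding wdeg_def by (rule sum.mono_neutral_right) (use out finite_L CL in auto)
    then show "(\<Prod>F\<in>C. (-1) ^ restrict e C F) = (-1::int) ^ wdeg e" by (simp add: power_sum)
  next
    fix g assume g: "g \<in> PiE C ?B"
    show "restrict (\<lambda>F. if F \<in> C then g F else 0) C = g"
      using g by (auto simp: fun_eq_iff PiE_def extensional_def)
    have gF: "1 \<le> g F \<and> int (g F) < gap \<epsilon> C F" if "F \<in> C" for F
    proof -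
      have "g F \<in> {1..<nat (gap \<epsilon> C F)}" using g that by (rule PiE_mem)
      then show ?thesis by auto
    qed
    have s: "supp (\<lambda>F. if F \<in> C then g F else 0) = C"
      using gF CL by (force simp: supp_def)
    then show "(\<lambda>F. if F \<in> C then g F else 0) \<in> {e. e \<in> all_admissible \<epsilon> \<and> supp e = C}"
      using adm[OF s] gF CL by auto
  qed
  also have "\<dots> = (\<Prod>F\<in>C. \<Sum>a\<in>?B F. (-1) ^ a)"
    by (rule prod_sum_PiE[symmetric]) (use finite_chain[OF C] in auto)
  also have "\<dots> = (\<Prod>F\<in>C. if even (gap \<epsilon> C F) then -1 else 0)"
  proof (rule prod.cong[OF refl])
    fix F assume "F \<in> C"
    then have "0 < gap \<epsilon> C F" by (rule gap_pos[OF C])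
    then show "(\<Sum>a\<in>?B F. (-1) ^ a) = (if even (gap \<epsilon> C F) then -1 else (0::int))"
      by (subst alternating_sum) (auto simp: even_nat_iff)
  qed
  finally show ?thesis .
qed

definition even_chains :: "nat \<Rightarrow> 'a set set set" where
  "even_chains \<epsilon> = {C \<in> chains. \<forall>F\<in>C. even (rk F + \<epsilon>)}"

text \<open>
If every rank has the parity of \<open>\<epsilon>\<close>, all gaps are even. Otherwise the lowest flat of the wrong parity has
an odd gap below it.
\<close>

lemma prod_gaps:
  assumes C: "C \<in> chains"
  shows "(\<Prod>F\<in>C. if even (gap \<epsilon> C F) then -1 else (0::int)) = (if C \<in> even_chains \<epsilon> then (-1) ^ card C else 0)"
proof -
  have par: "even (gap \<epsilon> C F) \<longleftrightarrow> even (rk F + \<epsilon>)"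
    if F: "F \<in> C" and ev: "\<And>G. G \<in> C \<Longrightarrow> G \<subset> F \<Longrightarrow> even (rk G + \<epsilon>)" for F
  proof -
    let ?A = "insert (- int \<epsilon>) ((\<lambda>G. int (rk G)) ` {G \<in> C. G \<subset> F})"
    have "Max ?A \<in> ?A" using finite_chain[OF C] by (intro Max_in) auto
    moreover have "even (x + int \<epsilon>)" if x: "x \<in> ?A" for x
    proof (cases "x = - int \<epsilon>")
      case False
      then obtain G where G: "G \<in> C" "G \<subset> F" "x = int (rk G)" using x by auto
      then have "even (int (rk G + \<epsilon>))" using ev by simp
      then show ?thesis using G(3) by simp
    qed simp
    ultimately have "even (Max ?A + int \<epsilon>)" by blast
    then show ?thesis by (auto simp: gap_def)
  qed
  show ?thesis
  proof (cases "C \<in> even_chains \<epsilon>")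
    case True
    then have "even (gap \<epsilon> C F)" if "F \<in> C" for F
      using par[OF that] that by (auto simp: even_chains_def)
    then show ?thesis using True by simp
  next
    case False
    define B where "B = {F \<in> C. odd (rk F + \<epsilon>)}"
    have "B \<noteq> {}" "finite B" using False C finite_chain[OF C] by (auto simp: even_chains_def B_def)
    define F where "F = arg_min_on rk B"
    have F: "F \<in> B" "\<And>G. G \<in> B \<Longrightarrow> rk F \<le> rk G"
      using arg_min_if_finite[OF \<open>finite B\<close> \<open>B \<noteq> {}\<close>, of rk] by (auto simp: F_def not_less)
    have "even (rk G + \<epsilon>)" if "G \<in> C" "G \<subset> F" for G
    proof (rule ccontr)
      assume "odd (rk G + \<epsilon>)"
      then have "rk F \<le> rk G" using F(2)[of G] that by (simp add: B_def)
      moreover have "rk G < rk F" using rk_strict_mono that F(1) C by (auto simp: B_def chains_def)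
      ultimately show False by simp
    qed
    then have "odd (gap \<epsilon> C F)" using par[of F] F(1) by (auto simp: B_def)
    then show ?thesis using False F(1) finite_chain[OF C] by (auto simp: B_def intro!: prod_zero)
  qed
qed

lemma poly_hilbert_poly_chains:
  assumes "\<epsilon> \<le> 1"
  shows "poly (hilbert_poly \<epsilon>) (-1) = (\<Sum>C\<in>even_chains \<epsilon>. (-1) ^ card C)"
proof -
  have "(\<Sum>e\<in>all_admissible \<epsilon>. (-1::int) ^ wdeg e) =
    (\<Sum>C\<in>chains. \<Sum>e\<in>{e \<in> all_admissible \<epsilon>. supp e = C}. (-1) ^ wdeg e)"
    by (rule sum.group[symmetric, OF finite_all_admissible finite_chains])
      (auto simp: all_admissible_def admissible_def chains_def is_chain_def supp_def)
  also have "\<dots> = (\<Sum>C\<in>chains. if C \<in> even_chains \<epsilon> then (-1) ^ card C else 0)"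
    by (rule sum.cong) (auto simp: sum_admissible_support prod_gaps)
  also have "\<dots> = (\<Sum>C\<in>{C \<in> chains. C \<in> even_chains \<epsilon>}. (-1) ^ card C)"
    by (rule sum.inter_filter[OF finite_chains, symmetric])
  also have "{C \<in> chains. C \<in> even_chains \<epsilon>} = even_chains \<epsilon>" by (auto simp: even_chains_def)
  finally show ?thesis by (simp add: poly_hilbert_poly[OF assms])
qed

text \<open>
Adding or removing \<open>E\<close> is a sign-reversing involution.
\<close>

lemma even_chains_cancel:
  assumes "even (r + \<epsilon>)"
  shows "(\<Sum>C\<in>even_chains \<epsilon>. (-1::int) ^ card C) = 0"
proof -
  let ?A = "{C \<in> even_chains \<epsilon>. E \<notin> C}"
  have fin: "finite ?A" using finite_chains by (simp add: even_chains_def)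
  have ins: "insert E C \<in> even_chains \<epsilon>" if "C \<in> even_chains \<epsilon>" for C
    using that E_L L_sub_E assms by (auto simp: even_chains_def chains_def rk_def)
  have split: "even_chains \<epsilon> = ?A \<union> insert E ` ?A"
  proof (rule Set.set_eqI, rule iffI)
    fix C assume C: "C \<in> even_chains \<epsilon>"
    show "C \<in> ?A \<union> insert E ` ?A"
    proof (cases "E \<in> C")
      case True
      then have "C - {E} \<in> ?A" "C = insert E (C - {E})" using C by (auto simp: even_chains_def chains_def)
      then show ?thesis by blast
    qed (use C in auto)
  next
    fix C assume "C \<in> ?A \<union> insert E ` ?A"
    then show "C \<in> even_chains \<epsilon>" using ins by auto
  qed
  have "(\<Sum>C\<in>even_chains \<epsilon>. (-1::int) ^ card C) = (\<Sum>C\<in>?A. (-1) ^ card C) + (\<Sum>C\<in>insert E ` ?A. (-1) ^ card C)"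
    by (subst split, rule sum.union_disjoint) (use fin in auto)
  also have "(\<Sum>C\<in>insert E ` ?A. (-1::int) ^ card C) = (\<Sum>C\<in>?A. - ((-1) ^ card C))"
  proof (subst sum.reindex)
    show "inj_on (insert E) ?A" by (rule inj_onI) (metis (mono_tags, lifting) insert_ident mem_Collect_eq)
    show "(\<Sum>C\<in>?A. ((\<lambda>C. (-1::int) ^ card C) \<circ> insert E) C) = (\<Sum>C\<in>?A. - ((-1) ^ card C))"
      by (rule sum.cong) (auto simp: even_chains_def finite_chain)
  qed
  finally show ?thesis by (simp add: sum_negf)
qed

definition flags_of :: "'a set \<Rightarrow> nat set \<Rightarrow> 'a set set set" where
  "flags_of U T = {C. C \<subseteq> {F \<in> P. F \<subset> U} \<and> (\<forall>F\<in>C. \<forall>G\<in>C. F \<subseteq> G \<or> G \<subseteq> F) \<and> dm ` C = T}"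

text \<open>
The largest member of the flag is chosen first; both sides then satisfy the recursion of \<open>descent_gf_Max\<close>.
\<close>

lemma card_flags_of:
  assumes "U \<in> P" "T \<subseteq> {1..<dm U}"
  shows "int (card (flags_of U T)) = descent_gf (int q) (dm U) T"
  using assms
proof (induction "card T" arbitrary: U T rule: less_induct)
  case less
  have finT: "finite T" using finite_subset[OF less.prems(2)] by simp
  show ?case
  proof (cases "T = {}")
    case True
    then have "flags_of U T = {{}}" by (auto simp: flags_of_def)
    then show ?thesis using True by (simp add: descent_gf_empty)
  next
    case False
    define d where "d = Max T"
    have d: "d \<in> T" "\<And>t. t \<in> T \<Longrightarrow> t \<le> d" using finT False by (auto simp: d_def)
    have dU: "d < dm U" using d less.prems(2) by auto
    have sub: "T - {d} \<subseteq> {1..<d}" using d(2) less.prems(2) by (force simp: less_le)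
    have card_less: "card (T - {d}) < card T" using finT d(1) by (rule card_Diff1_less)
    let ?K = "{F \<in> P. F \<subset> U \<and> dm F = d}"
    have finK: "finite ?K" using finite_P by simp
    have "?K = {F \<in> P. {} \<subseteq> F \<and> F \<subseteq> U \<and> dm F = dm {} + d}" using dU by auto
    then have cardK: "int (card ?K) = qbinom (int q) (dm U) d"
      using card_between[OF empty_in less.prems(1), of d] by simp
    have split: "flags_of U T = (\<Union>F\<in>?K. insert F ` flags_of F (T - {d}))"
    proof (rule Set.set_eqI, rule iffI)
      fix C assume C: "C \<in> flags_of U T"
      then obtain F where F: "F \<in> C" "dm F = d" using d(1) by (auto simp: flags_of_def)
      have CP: "C \<subseteq> P" "F \<in> P" "F \<subset> U" using C F by (auto simp: flags_of_def)
      have below: "G \<subset> F" if "G \<in> C" "G \<noteq> F" for G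
      proof -
        have "G \<subseteq> F \<or> F \<subseteq> G" using C F that by (auto simp: flags_of_def)
        moreover have "dm G \<le> d" using C that d(2) by (auto simp: flags_of_def)
        ultimately show ?thesis using dm_strict_mono[of F G] that CP F(2) by (auto simp: psubset_eq)
      qed
      have "C - {F} \<in> flags_of F (T - {d})"
        unfolding flags_of_def
      proof (intro CollectI conjI)
        show "C - {F} \<subseteq> {G \<in> P. G \<subset> F}" using below CP by auto
        show "\<forall>G\<in>C - {F}. \<forall>H\<in>C - {F}. G \<subseteq> H \<or> H \<subseteq> G" using C by (auto simp: flags_of_def)
        have "dm G \<noteq> d" if "G \<in> C" "G \<noteq> F" for G
          using dm_strict_mono[OF _ CP(2) below[OF that]] CP(1) that F(2) by auto
        then show "dm ` (C - {F}) = T - {d}" using C F by (auto simp: flags_of_def)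
      qed
      moreover have "C = insert F (C - {F})" using F by auto
      ultimately show "C \<in> (\<Union>F\<in>?K. insert F ` flags_of F (T - {d}))" using CP F(2) by blast
    next
      fix C assume "C \<in> (\<Union>F\<in>?K. insert F ` flags_of F (T - {d}))"
      then obtain F C' where F: "F \<in> P" "F \<subset> U" "dm F = d" "C' \<in> flags_of F (T - {d})" "C = insert F C'" by auto
      then show "C \<in> flags_of U T" using d(1) by (auto simp: flags_of_def)
    qed
    have dims: "F \<notin> C'" "\<And>G. G \<in> C' \<Longrightarrow> dm G \<noteq> d" if "F \<in> ?K" "C' \<in> flags_of F' (T - {d})" for F F' C'
      using that by (auto simp: flags_of_def)
    have finfl: "finite (flags_of F S)" for F S
      by (rule finite_subset[of _ "Pow P"]) (auto simp: flags_of_def finite_P)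
    have "card (flags_of U T) = (\<Sum>F\<in>?K. card (insert F ` flags_of F (T - {d})))"
      unfolding split
    proof (rule card_UN_disjoint[OF finK])
      show "\<forall>F\<in>?K. finite (insert F ` flags_of F (T - {d}))" using finfl by simp
      show "\<forall>F\<in>?K. \<forall>G\<in>?K. F \<noteq> G \<longrightarrow> insert F ` flags_of F (T - {d}) \<inter> insert G ` flags_of G (T - {d}) = {}"
      proof (intro ballI impI equals0I)
        fix F G C assume FG: "F \<in> ?K" "G \<in> ?K" "F \<noteq> G"
          and C: "C \<in> insert F ` flags_of F (T - {d}) \<inter> insert G ` flags_of G (T - {d})"
        then obtain C' C'' where "C' \<in> flags_of F (T - {d})" "C'' \<in> flags_of G (T - {d})" "insert F C' = insert G C''"
          by auto
        then show False using dims(1)[OF FG(1), of C'' G] FG(3) by blast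
      qed
    qed
    also have "\<dots> = (\<Sum>F\<in>?K. card (flags_of F (T - {d})))"
    proof (rule sum.cong[OF refl], rule card_image, rule inj_onI)
      fix F C C' assume a: "F \<in> ?K" "C \<in> flags_of F (T - {d})" "C' \<in> flags_of F (T - {d})" "insert F C = insert F C'"
      then show "C = C'" using dims(1)[OF a(1) a(2)] dims(1)[OF a(1) a(3)] by (metis insert_ident)
    qed
    finally have "int (card (flags_of U T)) = (\<Sum>F\<in>?K. int (card (flags_of F (T - {d}))))" by simp
    also have "\<dots> = (\<Sum>F\<in>?K. descent_gf (int q) d (T - {d}))"
    proof (rule sum.cong[OF refl])
      fix F assume "F \<in> ?K"
      then show "int (card (flags_of F (T - {d}))) = descent_gf (int q) d (T - {d})"
        using less.hyps[OF card_less, of F] sub by simp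
    qed
    also have "\<dots> = descent_gf (int q) (dm U) T"
      using descent_gf_Max[OF less.prems(2) False d_def, of "int q"] cardK by simp
    finally show ?thesis .
  qed
qed

lemma even_chains_flags:
  assumes "odd (r + \<epsilon>)"
  defines "S \<equiv> {k \<in> {1..r - 1}. even (k + \<epsilon>)}"
  shows "(\<Sum>C\<in>even_chains \<epsilon>. (-1::int) ^ card C) =
    (-1) ^ card S * (\<Sum>\<sigma> | \<sigma> permutes {1..dm E} \<and> DES (dm E) \<sigma> = S. int q ^ inv_num (dm E) \<sigma>)"
proof -
  have fin: "finite (even_chains \<epsilon>)" using finite_chains by (simp add: even_chains_def)
  have noE: "E \<notin> C" if "C \<in> even_chains \<epsilon>" for C
    using that assms(1) by (auto simp: even_chains_def rk_def)
  have CP: "F \<in> P \<and> F \<subset> E \<and> dm F \<in> S" if "C \<in> even_chains \<epsilon>" "F \<in> C" for C F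
  proof -
    have "F \<in> L" "F \<noteq> E" "even (rk F + \<epsilon>)" using that noE[OF that(1)] by (auto simp: even_chains_def chains_def)
    then show ?thesis using L_proper[of F] L_P by (auto simp: S_def)
  qed
  have inj: "inj_on dm C" if "C \<in> even_chains \<epsilon>" for C
  proof (rule inj_onI)
    fix F G assume FG: "F \<in> C" "G \<in> C" "dm F = dm G"
    then have "F \<subseteq> G \<or> G \<subseteq> F" using that by (auto simp: even_chains_def chains_def)
    then show "F = G" using FG CP[OF that] dm_eq_imp_eq[of F G] dm_eq_imp_eq[of G F] by auto
  qed
  have finS: "finite S" by (simp add: S_def)
  have S_sub: "S \<subseteq> {1..<dm E}" using r_le by (auto simp: S_def)
  have fl: "{C \<in> even_chains \<epsilon>. dm ` C = T} = flags_of E T" if "T \<in> Pow S" for T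
  proof (rule Set.set_eqI, rule iffI)
    fix C assume "C \<in> {C \<in> even_chains \<epsilon>. dm ` C = T}"
    then show "C \<in> flags_of E T" using CP by (auto simp: flags_of_def even_chains_def chains_def)
  next
    fix C assume C: "C \<in> flags_of E T"
    have "F \<in> L \<and> even (rk F + \<epsilon>)" if "F \<in> C" for F
    proof -
      have F: "F \<in> P" "F \<subset> E" "dm F \<in> S" using C that \<open>T \<in> Pow S\<close> by (auto simp: flags_of_def)
      then show ?thesis by (auto simp: S_def L_def rk_def)
    qed
    then show "C \<in> {C \<in> even_chains \<epsilon>. dm ` C = T}"
      using C by (auto simp: flags_of_def even_chains_def chains_def)
  qed
  have "(\<Sum>C\<in>even_chains \<epsilon>. (-1::int) ^ card C) =
     (\<Sum>T\<in>Pow S. \<Sum>C\<in>{C \<in> even_chains \<epsilon>. dm ` C = T}. (-1) ^ card C)"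
    by (rule sum.group[symmetric]) (use fin finS CP in auto)
  also have "\<dots> = (\<Sum>T\<in>Pow S. (-1) ^ card T * descent_gf (int q) (dm E) T)"
  proof (rule sum.cong[OF refl])
    fix T assume T: "T \<in> Pow S"
    have "(\<Sum>C\<in>{C \<in> even_chains \<epsilon>. dm ` C = T}. (-1::int) ^ card C) =
       (\<Sum>C\<in>{C \<in> even_chains \<epsilon>. dm ` C = T}. (-1) ^ card T)"
      by (rule sum.cong) (use card_image[OF inj] in auto)
    also have "\<dots> = (-1) ^ card T * int (card (flags_of E T))" unfolding fl[OF T] by simp
    also have "int (card (flags_of E T)) = descent_gf (int q) (dm E) T"
      by (rule card_flags_of[OF E_in]) (use T S_sub in auto)
    finally show "(\<Sum>C\<in>{C \<in> even_chains \<epsilon>. dm ` C = T}. (-1::int) ^ card C) =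
      (-1) ^ card T * descent_gf (int q) (dm E) T" .
  qed
  also have "\<dots> = (-1) ^ card S * (\<Sum>\<sigma> | \<sigma> permutes {1..dm E} \<and> DES (dm E) \<sigma> = S. int q ^ inv_num (dm E) \<sigma>)"
    by (rule descent_gf_inclusion_exclusion[OF finS])
  finally show ?thesis .
qed

end

section \<open>The q-uniform matroid\<close>

text \<open>
Coordinates with respect to a basis.
\<close>

lemma card_vectorspace:
  assumes "vectorspace K V" "finite (carrier V)"
  shows "card (carrier V) = card (carrier K) ^ vectorspace.dim K V"
proof -
  interpret vectorspace K V by fact
  have "span (carrier V) = carrier V"
    using in_own_span[of "carrier V"] span_is_subset2[of "carrier V"] by auto
  then have "fin_dim" unfolding fin_dim_def using assms(2) by blast
  then obtain B where B: "finite B" "basis B" using finite_basis_exists by blast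
  have BV: "B \<subseteq> carrier V" using B by (simp add: basis_def)
  have ex1: "\<exists>!a. a \<in> B \<rightarrow>\<^sub>E carrier K \<and> lincomb a B = v" if "v \<in> carrier V" for v
    using basis_criterion[OF B(1) BV] B(2) that by blast
  have "bij_betw (\<lambda>a. lincomb a B) (B \<rightarrow>\<^sub>E carrier K) (carrier V)"
    unfolding bij_betw_def
  proof
    have cl: "lincomb a B \<in> carrier V" if "a \<in> B \<rightarrow>\<^sub>E carrier K" for a
      using that BV by (intro lincomb_closed) auto
    show "inj_on (\<lambda>a. lincomb a B) (B \<rightarrow>\<^sub>E carrier K)"
    proof (rule inj_onI)
      fix a b assume ab: "a \<in> B \<rightarrow>\<^sub>E carrier K" "b \<in> B \<rightarrow>\<^sub>E carrier K" "lincomb a B = lincomb b B"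
      then show "a = b" using ex1[OF cl[OF ab(1)]] by (metis ab)
    qed
    show "(\<lambda>a. lincomb a B) ` (B \<rightarrow>\<^sub>E carrier K) = carrier V"
    proof
      show "(\<lambda>a. lincomb a B) ` (B \<rightarrow>\<^sub>E carrier K) \<subseteq> carrier V" using cl by blast
      show "carrier V \<subseteq> (\<lambda>a. lincomb a B) ` (B \<rightarrow>\<^sub>E carrier K)"
      proof
        fix v assume "v \<in> carrier V"
        from ex1_implies_ex[OF ex1[OF this]] show "v \<in> (\<lambda>a. lincomb a B) ` (B \<rightarrow>\<^sub>E carrier K)" by blast
      qed
    qed
  qed
  then have "card (carrier V) = card (B \<rightarrow>\<^sub>E carrier K)" by (simp add: bij_betw_same_card)
  also have "\<dots> = card (carrier K) ^ card B" using B(1) by (simp add: card_PiE)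
  also have "card B = dim" using dim_basis[OF B] by simp
  finally show ?thesis .
qed

locale finite_space =
  fixes n :: nat and K :: "'f ring" and S :: "('f, nat \<Rightarrow> 'f) module"
  assumes field_K: "field K" and fin_K: "finite (carrier K)" and S_def: "S = ring.func_space K {1..n}"
begin

sublocale F: field K by (rule field_K)

lemma module_S: "module K S"
  unfolding S_def by (rule F.func_space_is_module)

sublocale V: vectorspace K S
  by (rule vectorspace.intro[OF module_S field_K])

lemma carrier_S: "carrier S = {1..n} \<rightarrow>\<^sub>E carrier K"
  by (simp add: S_def F.func_space_def)

lemma finite_S: "finite (carrier S)"
  unfolding carrier_S using fin_K by (intro finite_PiE) auto

lemma card_S: "card (carrier S) = card (carrier K) ^ n"
  unfolding carrier_S by (simp add: card_PiE)

lemma card_K_ge_2: "2 \<le> card (carrier K)"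
proof -
  have "{\<zero>\<^bsub>K\<^esub>, \<one>\<^bsub>K\<^esub>} \<subseteq> carrier K" by auto
  then have "card {\<zero>\<^bsub>K\<^esub>, \<one>\<^bsub>K\<^esub>} \<le> card (carrier K)" by (rule card_mono[OF fin_K])
  moreover have "\<zero>\<^bsub>K\<^esub> \<noteq> \<one>\<^bsub>K\<^esub>" using F.zero_not_one .
  ultimately show ?thesis by simp
qed

definition sdim :: "(nat \<Rightarrow> 'f) set \<Rightarrow> nat" where "sdim W = vectorspace.dim K (S\<lparr>carrier := W\<rparr>)"

lemma subspaceD:
  assumes "subspace K W S"
  shows "W \<subseteq> carrier S" "\<zero>\<^bsub>S\<^esub> \<in> W" "v \<in> W \<Longrightarrow> w \<in> W \<Longrightarrow> v \<oplus>\<^bsub>S\<^esub> w \<in> W"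
    "c \<in> carrier K \<Longrightarrow> v \<in> W \<Longrightarrow> c \<odot>\<^bsub>S\<^esub> v \<in> W"
proof -
  interpret W: submodule K W S using assms by (simp add: subspace_def)
  show "W \<subseteq> carrier S" "\<zero>\<^bsub>S\<^esub> \<in> W" "v \<in> W \<Longrightarrow> w \<in> W \<Longrightarrow> v \<oplus>\<^bsub>S\<^esub> w \<in> W"
    "c \<in> carrier K \<Longrightarrow> v \<in> W \<Longrightarrow> c \<odot>\<^bsub>S\<^esub> v \<in> W"
    using W.subset W.zero_closed W.m_closed W.smult_closed by auto
qed

lemma subspaceI:
  assumes "W \<subseteq> carrier S" "\<zero>\<^bsub>S\<^esub> \<in> W" "\<And>v w. v \<in> W \<Longrightarrow> w \<in> W \<Longrightarrow> v \<oplus>\<^bsub>S\<^esub> w \<in> W"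
    "\<And>c v. c \<in> carrier K \<Longrightarrow> v \<in> W \<Longrightarrow> c \<odot>\<^bsub>S\<^esub> v \<in> W"
  shows "subspace K W S"
  using assms module_S V.vectorspace_axioms by (simp add: subspace_def submodule_def)

lemma card_subspace: "subspace K W S \<Longrightarrow> card W = card (carrier K) ^ sdim W"
  using card_vectorspace[OF V.subspace_is_vs, of W] finite_subset[OF subspaceD(1) finite_S, of W]
  by (simp add: sdim_def)

lemma sdim_S: "sdim (carrier S) = n"
proof -
  have "subspace K (carrier S) S" by (rule subspaceI) auto
  then have "card (carrier K) ^ sdim (carrier S) = card (carrier K) ^ n"
    using card_subspace card_S by metis
  then show ?thesis using card_K_ge_2 by simp
qed

lemma subspace_Int: "subspace K W S \<Longrightarrow> subspace K W' S \<Longrightarrow> subspace K (W \<inter> W') S"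
  by (rule subspaceI) (auto dest: subspaceD)

text \<open>
The span of a subspace and one more vector.
\<close>

definition extend :: "(nat \<Rightarrow> 'f) set \<Rightarrow> (nat \<Rightarrow> 'f) \<Rightarrow> (nat \<Rightarrow> 'f) set" where
  "extend W v = (\<lambda>(w, c). w \<oplus>\<^bsub>S\<^esub> c \<odot>\<^bsub>S\<^esub> v) ` (W \<times> carrier K)"

lemma extend_subspace:
  assumes W: "subspace K W S" and v: "v \<in> carrier S" "v \<notin> W"
  shows "subspace K (extend W v) S" "W \<subseteq> extend W v" "v \<in> extend W v" "sdim (extend W v) = Suc (sdim W)"
    "\<And>U. subspace K U S \<Longrightarrow> W \<subseteq> U \<Longrightarrow> v \<in> U \<Longrightarrow> extend W v \<subseteq> U"
proof -
  note Wd = subspaceD[OF W]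
  have WS: "w \<in> carrier S" if "w \<in> W" for w using that Wd(1) by auto
  show sub: "subspace K (extend W v) S"
  proof (rule subspaceI)
    show "extend W v \<subseteq> carrier S" using WS v by (auto simp: extend_def)
    have "\<zero>\<^bsub>S\<^esub> = \<zero>\<^bsub>S\<^esub> \<oplus>\<^bsub>S\<^esub> \<zero>\<^bsub>K\<^esub> \<odot>\<^bsub>S\<^esub> v" using v by simp
    then show "\<zero>\<^bsub>S\<^esub> \<in> extend W v" unfolding extend_def using Wd(2) by force
    fix x assume "x \<in> extend W v"
    then obtain w c where x: "x = w \<oplus>\<^bsub>S\<^esub> c \<odot>\<^bsub>S\<^esub> v" "w \<in> W" "c \<in> carrier K" by (auto simp: extend_def)
    { fix y assume "y \<in> extend W v"
      then obtain w' c' where y: "y = w' \<oplus>\<^bsub>S\<^esub> c' \<odot>\<^bsub>S\<^esub> v" "w' \<in> W" "c' \<in> carrier K" by (auto simp: extend_def)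
      have "x \<oplus>\<^bsub>S\<^esub> y = (w \<oplus>\<^bsub>S\<^esub> w') \<oplus>\<^bsub>S\<^esub> (c \<oplus>\<^bsub>K\<^esub> c') \<odot>\<^bsub>S\<^esub> v"
        using x y v WS by (simp add: V.smult_l_distr V.a_ac)
      then show "x \<oplus>\<^bsub>S\<^esub> y \<in> extend W v"
        unfolding extend_def using Wd(3)[OF x(2) y(2)] x(3) y(3) by (intro image_eqI[of _ _ "(w \<oplus>\<^bsub>S\<^esub> w', c \<oplus>\<^bsub>K\<^esub> c')"]) auto }
    fix a assume a: "a \<in> carrier K"
    have "a \<odot>\<^bsub>S\<^esub> x = (a \<odot>\<^bsub>S\<^esub> w) \<oplus>\<^bsub>S\<^esub> (a \<otimes>\<^bsub>K\<^esub> c) \<odot>\<^bsub>S\<^esub> v"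
      using x v WS a by (simp add: V.smult_r_distr V.smult_assoc1)
    then show "a \<odot>\<^bsub>S\<^esub> x \<in> extend W v"
      unfolding extend_def using Wd(4)[OF a x(2)] x(3) a by (intro image_eqI[of _ _ "(a \<odot>\<^bsub>S\<^esub> w, a \<otimes>\<^bsub>K\<^esub> c)"]) auto
  qed
  show "W \<subseteq> extend W v"
  proof
    fix w assume "w \<in> W"
    then show "w \<in> extend W v"
      unfolding extend_def using WS v by (intro image_eqI[of _ _ "(w, \<zero>\<^bsub>K\<^esub>)"]) auto
  qed
  show "v \<in> extend W v"
    unfolding extend_def using Wd(2) v by (intro image_eqI[of _ _ "(\<zero>\<^bsub>S\<^esub>, \<one>\<^bsub>K\<^esub>)"]) auto
  have "inj_on (\<lambda>(w, c). w \<oplus>\<^bsub>S\<^esub> c \<odot>\<^bsub>S\<^esub> v) (W \<times> carrier K)"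
  proof (rule inj_onI, clarify)
    fix w c w' c' assume a: "w \<in> W" "c \<in> carrier K" "w' \<in> W" "c' \<in> carrier K"
      and eq: "w \<oplus>\<^bsub>S\<^esub> c \<odot>\<^bsub>S\<^esub> v = w' \<oplus>\<^bsub>S\<^esub> c' \<odot>\<^bsub>S\<^esub> v"
    note [simp] = WS[OF a(1)] WS[OF a(3)] a(2,4) v(1)
    define d where "d = c \<ominus>\<^bsub>K\<^esub> c'"
    have dK: "d \<in> carrier K" by (simp add: d_def)
    have "c' \<oplus>\<^bsub>K\<^esub> (c \<oplus>\<^bsub>K\<^esub> \<ominus>\<^bsub>K\<^esub> c') = c \<oplus>\<^bsub>K\<^esub> (c' \<oplus>\<^bsub>K\<^esub> \<ominus>\<^bsub>K\<^esub> c')"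
      by (rule F.a_lcomm) auto
    then have cc: "c = c' \<oplus>\<^bsub>K\<^esub> d" by (simp add: d_def a_minus_def F.r_neg)
    have "w \<oplus>\<^bsub>S\<^esub> (d \<odot>\<^bsub>S\<^esub> v \<oplus>\<^bsub>S\<^esub> c' \<odot>\<^bsub>S\<^esub> v) = w' \<oplus>\<^bsub>S\<^esub> c' \<odot>\<^bsub>S\<^esub> v"
      using eq dK unfolding cc by (simp add: V.smult_l_distr V.a_comm)
    then have "(w \<oplus>\<^bsub>S\<^esub> d \<odot>\<^bsub>S\<^esub> v) \<oplus>\<^bsub>S\<^esub> c' \<odot>\<^bsub>S\<^esub> v = w' \<oplus>\<^bsub>S\<^esub> c' \<odot>\<^bsub>S\<^esub> v"
      using dK by (simp add: V.a_assoc)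
    then have e1: "w \<oplus>\<^bsub>S\<^esub> d \<odot>\<^bsub>S\<^esub> v = w'" using dK by simp
    have "d = \<zero>\<^bsub>K\<^esub>"
    proof (rule ccontr)
      assume "d \<noteq> \<zero>\<^bsub>K\<^esub>"
      then have inv: "inv\<^bsub>K\<^esub> d \<in> carrier K" "inv\<^bsub>K\<^esub> d \<otimes>\<^bsub>K\<^esub> d = \<one>\<^bsub>K\<^esub>"
        using dK F.field_Units by (auto intro: F.Units_l_inv)
      have mw: "(\<ominus>\<^bsub>K\<^esub> \<one>\<^bsub>K\<^esub>) \<odot>\<^bsub>S\<^esub> w \<in> W" using Wd(4) a by simp
      have "((\<ominus>\<^bsub>K\<^esub> \<one>\<^bsub>K\<^esub>) \<odot>\<^bsub>S\<^esub> w) \<oplus>\<^bsub>S\<^esub> w = \<zero>\<^bsub>S\<^esub>"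
        using V.smult_l_distr[of "\<ominus>\<^bsub>K\<^esub> \<one>\<^bsub>K\<^esub>" "\<one>\<^bsub>K\<^esub>" w] by (simp add: F.l_neg)
      then have "d \<odot>\<^bsub>S\<^esub> v = ((\<ominus>\<^bsub>K\<^esub> \<one>\<^bsub>K\<^esub>) \<odot>\<^bsub>S\<^esub> w) \<oplus>\<^bsub>S\<^esub> w'"
        unfolding e1[symmetric] using dK by (simp add: V.a_assoc[symmetric])
      then have "d \<odot>\<^bsub>S\<^esub> v \<in> W" using Wd(3)[OF mw a(3)] by simp
      then have "inv\<^bsub>K\<^esub> d \<odot>\<^bsub>S\<^esub> (d \<odot>\<^bsub>S\<^esub> v) \<in> W" using Wd(4) inv by blast
      then have "v \<in> W" using inv dK by (simp add: V.smult_assoc1[symmetric])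
      then show False using v by simp
    qed
    then show "w = w' \<and> c = c'" using e1 cc by simp
  qed
  then have "card (extend W v) = card W * card (carrier K)"
    unfolding extend_def by (simp add: card_image card_cartesian_product)
  then have "card (carrier K) ^ sdim (extend W v) = card (carrier K) ^ Suc (sdim W)"
    using card_subspace[OF sub] card_subspace[OF W] by simp
  then show "sdim (extend W v) = Suc (sdim W)"
    by (rule power_inject_exp[THEN iffD1, rotated]) (use card_K_ge_2 in simp)
  show "extend W v \<subseteq> U" if "subspace K U S" "W \<subseteq> U" "v \<in> U" for U
    using subspaceD[OF that(1)] that(2,3) by (auto simp: extend_def)
qed

definition P :: "(nat \<Rightarrow> 'f) set set" where "P = {W - {\<zero>\<^bsub>S\<^esub>} |W. subspace K W S}"
definition E :: "(nat \<Rightarrow> 'f) set" where "E = carrier S - {\<zero>\<^bsub>S\<^esub>}"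
definition dm :: "(nat \<Rightarrow> 'f) set \<Rightarrow> nat" where "dm F = sdim (insert \<zero>\<^bsub>S\<^esub> F)"

lemma dm_minus: "subspace K W S \<Longrightarrow> dm (W - {\<zero>\<^bsub>S\<^esub>}) = sdim W"
  using subspaceD(2)[of W] by (simp add: dm_def insert_absorb)

lemma subspace_carrier: "subspace K (carrier S) S" by (rule subspaceI) auto
lemma subspace_zero: "subspace K {\<zero>\<^bsub>S\<^esub>} S" by (rule subspaceI) auto

sublocale geometry P E "card (carrier K)" dm
proof
  show "2 \<le> card (carrier K)" by (rule card_K_ge_2)
  show "finite E" using finite_S by (simp add: E_def)
  show "F \<subseteq> E" if "F \<in> P" for F using that by (auto simp: P_def E_def dest: subspaceD(1))
  show "E \<in> P" using subspace_carrier by (auto simp: P_def E_def)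
  show "{} \<in> P" using subspace_zero by (auto simp: P_def)
  show "card F = card (carrier K) ^ dm F - 1" if F: "F \<in> P" for F
  proof -
    obtain W where W: "F = W - {\<zero>\<^bsub>S\<^esub>}" "subspace K W S" using F by (auto simp: P_def)
    then show ?thesis
      using card_subspace[OF W(2)] dm_minus[OF W(2)] subspaceD(2)[OF W(2)]
      by (simp add: card_Diff_singleton)
  qed
  show "F \<inter> G \<in> P" if "F \<in> P" "G \<in> P" for F G
  proof -
    obtain W W' where "F = W - {\<zero>\<^bsub>S\<^esub>}" "subspace K W S" "G = W' - {\<zero>\<^bsub>S\<^esub>}" "subspace K W' S"
      using \<open>F \<in> P\<close> \<open>G \<in> P\<close> by (auto simp: P_def)
    then have "F \<inter> G = (W \<inter> W') - {\<zero>\<^bsub>S\<^esub>}" "subspace K (W \<inter> W') S" using subspace_Int by auto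
    then show ?thesis by (auto simp: P_def)
  qed
  show "\<exists>G\<in>P. F \<subseteq> G \<and> i \<in> G \<and> dm G = Suc (dm F) \<and> (\<forall>H\<in>P. F \<subseteq> H \<and> i \<in> H \<longrightarrow> G \<subseteq> H)"
    if F: "F \<in> P" "i \<in> E" "i \<notin> F" for F i
  proof -
    obtain W where W: "F = W - {\<zero>\<^bsub>S\<^esub>}" "subspace K W S" using F by (auto simp: P_def)
    have i: "i \<in> carrier S" "i \<noteq> \<zero>\<^bsub>S\<^esub>" "i \<notin> W" using F W by (auto simp: E_def)
    note ext = extend_subspace[OF W(2) i(1,3)]
    show ?thesis
    proof (intro bexI[of _ "extend W i - {\<zero>\<^bsub>S\<^esub>}"] conjI ballI impI)
      show "extend W i - {\<zero>\<^bsub>S\<^esub>} \<in> P" using ext(1) by (auto simp: P_def)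
      show "F \<subseteq> extend W i - {\<zero>\<^bsub>S\<^esub>}" using ext(2) W by auto
      show "i \<in> extend W i - {\<zero>\<^bsub>S\<^esub>}" using ext(3) i by auto
      show "dm (extend W i - {\<zero>\<^bsub>S\<^esub>}) = Suc (dm F)"
        using ext(4) dm_minus[OF ext(1)] dm_minus[OF W(2)] W(1) by simp
      fix H assume H: "H \<in> P" "F \<subseteq> H \<and> i \<in> H"
      then obtain U where U: "H = U - {\<zero>\<^bsub>S\<^esub>}" "subspace K U S" by (auto simp: P_def)
      then have "W \<subseteq> U" "i \<in> U" using H W subspaceD(2)[OF U(2)] by auto
      then show "extend W i - {\<zero>\<^bsub>S\<^esub>} \<subseteq> H" using ext(5)[OF U(2)] U(1) by auto
    qed
  qed
qed

lemma dm_E: "dm E = n"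
  using dm_minus[OF subspace_carrier] sdim_S by (simp add: E_def)

lemma q_uniform_flats:
  assumes "1 \<le> r" "r \<le> n"
  shows "truncation P E (card (carrier K)) dm r"
    "q_uniform r n K = truncation.truncated_matroid P E dm r"
proof -
  show tr: "truncation P E (card (carrier K)) dm r"
    using assms dm_E by unfold_locales auto
  interpret truncation P E "card (carrier K)" dm r by (rule tr)
  have "{W - {\<zero>\<^bsub>S\<^esub>} |W. subspace K W S \<and> (sdim W \<le> r - 1 \<or> W = carrier S)} = insert {} L"
  proof (rule Set.set_eqI, rule iffI)
    fix F assume "F \<in> {W - {\<zero>\<^bsub>S\<^esub>} |W. subspace K W S \<and> (sdim W \<le> r - 1 \<or> W = carrier S)}"
    then obtain W where W: "F = W - {\<zero>\<^bsub>S\<^esub>}" "subspace K W S" "sdim W \<le> r - 1 \<or> W = carrier S" by auto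
    have "F \<in> P" using W(1,2) by (auto simp: P_def)
    moreover have "F = E \<or> dm F < r" using W(1,3) assms dm_minus[OF W(2)] by (auto simp: E_def)
    ultimately show "F \<in> insert {} L" by (auto simp: L_def)
  next
    fix F assume F: "F \<in> insert {} L"
    then have "F \<in> P" "F = E \<or> dm F < r" using empty_in assms by (auto simp: L_def)
    then obtain W where W: "F = W - {\<zero>\<^bsub>S\<^esub>}" "subspace K W S" by (auto simp: P_def)
    have "sdim W \<le> r - 1 \<or> W = carrier S"
      using \<open>F = E \<or> dm F < r\<close>
    proof
      assume "F = E"
      then have "W = carrier S" using W subspaceD(2)[OF W(2)] by (auto simp: E_def)
      then show ?thesis ..
    next
      assume "dm F < r"
      then show ?thesis using dm_minus[OF W(2)] W(1) by auto
    qed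
    then show "F \<in> {W - {\<zero>\<^bsub>S\<^esub>} |W. subspace K W S \<and> (sdim W \<le> r - 1 \<or> W = carrier S)}"
      using W by blast
  qed
  then show "q_uniform r n K = truncated_matroid"
    unfolding q_uniform_def S_def[symmetric] Let_def sdim_def[symmetric] E_def[symmetric] truncated_matroid_def by simp
qed

end

theorem theorem5p3:
  fixes n r :: nat
  assumes "1 \<le> n" and "1 \<le> r" and "r \<le> n"
  shows
    "(\<forall>q (K :: 'f ring). primepow q \<and> field K \<and> card (carrier K) = q \<longrightarrow>
        poly (Hilb (chow_ring (q_uniform r n K))) (-1) =
          (if even r then 0
           else (-1) ^ ((r - 1) div 2) *
             (\<Sum>\<sigma> | \<sigma> permutes {1..n} \<and> DES n \<sigma> = Even (r - 1). int q ^ inv_num n \<sigma>)) \<and>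
        poly (Hilb (augmented_chow_ring (q_uniform r n K))) (-1) =
          (if even r
           then (-1) ^ (r div 2) *
             (\<Sum>\<sigma> | \<sigma> permutes {1..n} \<and> DES n \<sigma> = Odd (r - 1). int q ^ inv_num n \<sigma>)
           else 0)) \<and>
     (\<exists>P :: int poly. (\<forall>k. 0 \<le> coeff P k) \<and>
        (\<forall>q (K :: 'f ring). primepow q \<and> field K \<and> card (carrier K) = q \<longrightarrow>
           charney_davis (chow_ring (q_uniform r n K)) = poly P (int q))) \<and>
     (\<exists>P :: int poly. (\<forall>k. 0 \<le> coeff P k) \<and>
        (\<forall>q (K :: 'f ring). primepow q \<and> field K \<and> card (carrier K) = q \<longrightarrow>
           charney_davis (augmented_chow_ring (q_uniform r n K)) = poly P (int q)))"
proof -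
  have even_eq: "{k \<in> {1..r - 1}. even (k + 0)} = Even (r - 1)" by (simp add: Even_def)
  have odd_eq: "{k \<in> {1..r - 1}. even (k + 1)} = Odd (r - 1)" by (simp add: Odd_def)
  have card_even: "card (Even (r - 1)) = (r - 1) div 2"
  proof -
    have "Even (r - 1) = (\<lambda>k. 2 * k) ` {1..(r - 1) div 2}"
      by (auto simp: Even_def image_iff elim!: evenE)
    then show ?thesis by (simp add: card_image inj_on_def)
  qed
  have card_odd: "card (Odd (r - 1)) = r div 2"
  proof -
    have "Odd (r - 1) = (\<lambda>k. 2 * k + 1) ` {..<r div 2}"
      by (auto simp: Odd_def image_iff elim!: oddE)
    then show ?thesis by (simp add: card_image inj_on_def)
  qed
  have main: "poly (Hilb (chow_ring (q_uniform r n K))) (-1) =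
          (if even r then 0 else (-1) ^ ((r - 1) div 2) *
             (\<Sum>\<sigma> | \<sigma> permutes {1..n} \<and> DES n \<sigma> = Even (r - 1). int q ^ inv_num n \<sigma>))"
      "poly (Hilb (augmented_chow_ring (q_uniform r n K))) (-1) =
          (if even r then (-1) ^ (r div 2) *
             (\<Sum>\<sigma> | \<sigma> permutes {1..n} \<and> DES n \<sigma> = Odd (r - 1). int q ^ inv_num n \<sigma>) else 0)"
      "degree (Hilb (chow_ring (q_uniform r n K))) = r - 1"
      "degree (Hilb (augmented_chow_ring (q_uniform r n K))) = r"
    if q: "primepow q" and K: "field K" "card (carrier K) = q" for q and K :: "'f ring"
  proof -
    have "finite (carrier K)" using K(2) primepow_gt_0_nat[OF q] by (intro card_ge_0_finite) simp
    from finite_space.intro[OF K(1) this refl]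
    interpret finite_space n K "ring.func_space K {1..n}" .
    note flats = q_uniform_flats[OF assms(2,3)]
    interpret truncation P E "card (carrier K)" dm r by (rule flats(1))
    have H: "Hilb (chow_ring (q_uniform r n K)) = hilbert_poly 0"
      "Hilb (augmented_chow_ring (q_uniform r n K)) = hilbert_poly 1"
      unfolding flats(2) by (rule Hilb_chow_ring, rule Hilb_augmented_chow_ring)
    show "degree (Hilb (chow_ring (q_uniform r n K))) = r - 1"
      "degree (Hilb (augmented_chow_ring (q_uniform r n K))) = r"
      unfolding H using degree_hilbert_poly[of 0] degree_hilbert_poly[of 1] assms(2) by simp_all
    show "poly (Hilb (chow_ring (q_uniform r n K))) (-1) =
          (if even r then 0 else (-1) ^ ((r - 1) div 2) *
             (\<Sum>\<sigma> | \<sigma> permutes {1..n} \<and> DES n \<sigma> = Even (r - 1). int q ^ inv_num n \<sigma>))"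
      unfolding H using poly_hilbert_poly_chains[of 0] even_chains_cancel[of 0] even_chains_flags[of 0]
      unfolding even_eq card_even dm_E K(2) by simp
    show "poly (Hilb (augmented_chow_ring (q_uniform r n K))) (-1) =
          (if even r then (-1) ^ (r div 2) *
             (\<Sum>\<sigma> | \<sigma> permutes {1..n} \<and> DES n \<sigma> = Odd (r - 1). int q ^ inv_num n \<sigma>) else 0)"
      unfolding H using poly_hilbert_poly_chains[of 1] even_chains_cancel[of 1] even_chains_flags[of 1]
      unfolding odd_eq card_odd dm_E K(2) by simp
  qed
  \<comment> \<open>The polynomials in \<open>q\<close> asked for: they depend only on \<open>n\<close> and \<open>r\<close>.\<close>
  define gf where "gf T = (\<Sum>\<sigma> | \<sigma> permutes {1..n} \<and> DES n \<sigma> = T. monom (1::int) (inv_num n \<sigma>))" for T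
  have gf_nonneg: "0 \<le> coeff (gf T) k" for T k
    unfolding gf_def coeff_sum by (intro sum_nonneg) simp
  have gf_poly: "poly (gf T) x = (\<Sum>\<sigma> | \<sigma> permutes {1..n} \<and> DES n \<sigma> = T. x ^ inv_num n \<sigma>)" for T x
    by (simp add: gf_def poly_sum poly_monom)
  have sq: "(-1::int) ^ k * ((-1) ^ k * x) = x" for k x
    by (simp add: mult.assoc[symmetric] power_mult_distrib[symmetric])
  show ?thesis
  proof (intro conjI)
    show "\<exists>P :: int poly. (\<forall>k. 0 \<le> coeff P k) \<and>
        (\<forall>q (K :: 'f ring). primepow q \<and> field K \<and> card (carrier K) = q \<longrightarrow>
           charney_davis (chow_ring (q_uniform r n K)) = poly P (int q))"
      using main(1,3) assms(2) by (intro exI[of _ "if even r then 0 else gf (Even (r - 1))"])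
        (auto simp: gf_nonneg charney_davis_def gf_poly sq Let_def)
    show "\<exists>P :: int poly. (\<forall>k. 0 \<le> coeff P k) \<and>
        (\<forall>q (K :: 'f ring). primepow q \<and> field K \<and> card (carrier K) = q \<longrightarrow>
           charney_davis (augmented_chow_ring (q_uniform r n K)) = poly P (int q))"
      using main(2,4) by (intro exI[of _ "if even r then gf (Odd (r - 1)) else 0"])
        (auto simp: gf_nonneg charney_davis_def gf_poly sq Let_def)
  qed (use main(1,2) in blast)
qed

end
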